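(* Let $(\mathbf G,\mathbf G')=(\mathrm{Sp}_{2n},\mathrm O^\pm_{2n'})$ or $(\mathrm{Sp}_{2n},\mathrm{SO}_{2n'+1})$, defined over a finite field $\mathbf F_q$ of odd characteristic, let $\psi$ be a nontrivial additive character of $\mathbf F_q$, and write the Weil character $\omega^\psi_{\mathbf G,\mathbf G'}$ with respect to the orthonormal bases of irreducible characters and of almost characters as $$\omega^\psi_{\mathbf G,\mathbf G'}=\sum_{x\in X(\mathbf G),\,x'\in X(\mathbf G')}m_{x,x'}\,\rho_x\otimes\rho_{x'}=\sum_{x\in X(\mathbf G),\,x'\in X(\mathbf G')}\widetilde m_{x,x'}\,R_x\otimes R_{x'}$$ with $m_{x,x'},\widetilde m_{x,x'}\in\mathbb C$. Then $m_{x,x'}=\widetilde m_{x,x'}$ for every $(x,x')\in X(\mathbf G)\times X(\mathbf G')$.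
   Context: **Class functions.** $\mathcal V(\mathbf G)$ is the space of complex class functions on $G=\mathbf G(\mathbf F_q)$ with $\langle f,f'\rangle_{\mathbf G}=|G|^{-1}\sum_{g\in G}f(g)f'(g^{-1})$; $\mathcal E(\mathbf G)=\{\rho_x\mid x\in X(\mathbf G)\}$ is the set of irreducible characters of $G$, indexed by a set $X(\mathbf G)$. The symbol $\mathrm O^\pm_{2n}$ is treated formally as a "group": $\mathcal E(\mathrm O^\pm_{2n})=\mathcal E(\mathrm O^+_{2n})\sqcup\mathcal E(\mathrm O^-_{2n})$, $X(\mathrm O^\pm_{2n})=X(\mathrm O^+_{2n})\sqcup X(\mathrm O^-_{2n})$, $\mathcal V(\mathrm O^\pm_{2n})=\mathcal V(\mathrm O^+_{2n})\oplus\mathcal V(\mathrm O^-_{2n})$ (orthogonal sum). **Weil characters.** For a dual pair $(\mathrm{Sp}_{2n},\mathrm O_m)$ (with $\mathrm O_m=\mathrm O^\epsilon_{2n'}$, $\epsilon=\pm$, or $\mathrm O_{2n'+1}$), $\omega^\psi_{\mathrm{Sp}_{2n},\mathrm O_m}$ is the restriction to $\mathrm{Sp}_{2n}(q)\times\mathrm O_m(q)$ of the character of the Weil representation of $\mathrm{Sp}_{2nm}(q)$ attached to $\psi$. Put $\omega^\psi_{\mathrm{Sp}_{2n},\mathrm O^\pm_{2n'}}=\omega^\psi_{\mathrm{Sp}_{2n},\mathrm O^+_{2n'}}+\omega^\psi_{\mathrm{Sp}_{2n},\mathrm O^-_{2n'}}\in\mathcal V(\mathrm{Sp}_{2n})\otimes\mathcal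 V(\mathrm O^\pm_{2n'})$ and $\omega^\psi_{\mathrm{Sp}_{2n},\mathrm{SO}_{2n'+1}}=\omega^\psi_{\mathrm{Sp}_{2n},\mathrm O_{2n'+1}}|_{\mathrm{Sp}_{2n}(q)\times\mathrm{SO}_{2n'+1}(q)}$. **Symbols.** A symbol is an ordered pair $\Lambda=\binom AB$ of finite (possibly empty) sets of non-negative integers; $\Lambda^*=A$, $\Lambda_*=B$, $\Lambda^{\mathrm t}=\binom BA$, $|\Lambda|=|A|+|B|$, $\mathrm{rk}(\Lambda)=\sum_{a\in A}a+\sum_{b\in B}b-\lfloor(\frac{|A|+|B|-1}2)^2\rfloor$, $\mathrm{def}(\Lambda)=|A|-|B|$. Symbols are taken modulo the equivalence generated by $\binom AB\sim\binom{(A+1)\cup\{0\}}{(B+1)\cup\{0\}}$, and are represented by the unique reduced representative ($0\notin A\cap B$). Set operations on symbols are rowwise. $\mathcal S_{\mathrm{Sp}_{2n}}$ is the set of symbols of rank $n$ and defect $\equiv1\pmod 4$; $\mathcal S_{\mathrm O^+_{2n}}$, $\mathcal S_{\mathrm O^-_{2n}}$ are the sets of symbols of rank $n$ and defect $\equiv0$, resp. $\equiv2\pmod 4$; $\mathcal S_{\mathrm O^\pm_{2n}}=\mathcal S_{\mathrm O^+_{2n}}\cup\mathcal S_{\mathrm O^-_{2n}}$. These sets parametrize the unipotent characters: $\Lambda\mapsto\rho_\Lambda$. **Unipotent almost characters.** A symbol $Z$ of defect $1$, $Z=\binom{a_1,\dots,a_{m+1}}{b_1,\dots,b_m}$, is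 special if $a_1\ge b_1\ge a_2\ge b_2\ge\cdots\ge b_m\ge a_{m+1}$; one of defect $0$, $Z=\binom{a_1,\dots,a_m}{b_1,\dots,b_m}$, is special if $a_1\ge b_1\ge\cdots\ge a_m\ge b_m$ (entries in each row strictly decreasing). $Z_{\mathrm I}=\binom{Z^*\smallsetminus Z_*}{Z_*\smallsetminus Z^*}$; $\deg(Z)=d$ where $|Z_{\mathrm I}|=2d+1$ (defect 1) or $2d$ (defect 0). For $M\subset Z_{\mathrm I}$ let $\Lambda_M=(Z\smallsetminus M)\cup M^{\mathrm t}$. $\mathcal S_Z=\{\Lambda_M\mid M\subset Z_{\mathrm I},|M|\text{ even}\}$ for defect $1$, and $\mathcal S_Z=\{\Lambda_M\mid M\subset Z_{\mathrm I}\}$ for defect $0$. $\mathcal S_{\mathrm{Sp}_{2n}}$ (resp. $\mathcal S_{\mathrm O^\pm_{2n}}$) is the disjoint union of the $\mathcal S_Z$, $Z$ special of rank $n$ and defect $1$ (resp. $0$). Put $\langle\Lambda_{M_1},\Lambda_{M_2}\rangle=|M_1||M_2|+|M_1\cap M_2|\bmod 2$ and, for $\Lambda\in\mathcal S_Z$, $R_\Lambda=2^{-\deg Z}\sum_{\Lambda_1\in\mathcal S_Z}(-1)^{\langle\Lambda,\Lambda_1\rangle}\rho_{\Lambda_1}$. **Normalization of the parametrization.** For $\Lambda=\binom{a_1>\dots>a_{m_1}}{b_1>\dots>b_{m_2}}$ put $\Upsilon(\Lambda)=\left[{\lambda\atop\mu}\right]$ with $\lambda_i=a_i-(m_1-i)$,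 $\mu_j=b_j-(m_2-j)$. For partitions, $\lambda\preccurlyeq\mu$ means $\mu_1\ge\lambda_1\ge\mu_2\ge\lambda_2\ge\cdots$. With $\Upsilon(\Lambda)=\left[{\lambda\atop\mu}\right]$, $\Upsilon(\Lambda')=\left[{\lambda'\atop\mu'}\right]$: $\mathcal B_{\mathrm{Sp}_{2n},\mathrm O^+_{2n'}}$ is the set of $(\Lambda,\Lambda')\in\mathcal S_{\mathrm{Sp}_{2n}}\times\mathcal S_{\mathrm O^+_{2n'}}$ with $\mu\preccurlyeq\lambda'$, $\mu'\preccurlyeq\lambda$, $\mathrm{def}(\Lambda')=-\mathrm{def}(\Lambda)+1$; $\mathcal B_{\mathrm{Sp}_{2n},\mathrm O^-_{2n'}}$ is the set of $(\Lambda,\Lambda')\in\mathcal S_{\mathrm{Sp}_{2n}}\times\mathcal S_{\mathrm O^-_{2n'}}$ with $\lambda'\preccurlyeq\mu$, $\lambda\preccurlyeq\mu'$, $\mathrm{def}(\Lambda')=-\mathrm{def}(\Lambda)-1$; $\mathcal B_{\mathrm{Sp}_{2n},\mathrm O^\pm_{2n'}}$ is their union. The parametrization $\Lambda\mapsto\rho_\Lambda$ is the one for which (by earlier work of Pan) the unipotent part $\omega_{\mathrm{Sp}_{2n},\mathrm O^\epsilon_{2n'},1}$ of the Weil character equals $\sum_{(\Lambda,\Lambda')\in\mathcal B_{\mathrm{Sp}_{2n},\mathrm O^\epsilon_{2n'}}}\rho_\Lambda\otimes\rho_{\Lambda'}$. **Modified Lusztig correspondence.** For a semisimple rational $s$ in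 the identity component of the dual group ($\mathrm{SO}_{2n+1}$, $\mathrm{SO}^\epsilon_{2n}$, $\mathrm{Sp}_{2n}$ for $\mathbf G=\mathrm{Sp}_{2n},\mathrm O^\epsilon_{2n},\mathrm{SO}_{2n+1}$), $\mathcal E(\mathbf G)_s$ is the Lusztig series of $s$ (for $\mathrm O^\epsilon_{2n}$: constituents of the characters induced from the series of $s$ for $\mathrm{SO}^\epsilon_{2n}$, $s$ up to $\mathrm O^\epsilon_{2n}(q)$-conjugacy). Write $s=s^{(0)}\times s^{(-)}\times s^{(+)}$, where $s^{(-)}$, $s^{(+)}$ are the parts with all eigenvalues $-1$, $+1$ (of multiplicities, counted in the torus, $n^{(-)},n^{(+)}$) and $s^{(0)}$ has no eigenvalue $\pm1$. $\mathbf G^{(0)}(s)$ is the product of general linear and unitary groups attached to $s^{(0)}$, and $(\mathbf G^{(-)}(s),\mathbf G^{(+)}(s))$ is $(\mathrm O^{\epsilon^{(-)}}_{2n^{(-)}},\mathrm O^{\epsilon^{(+)}}_{2n^{(+)}})$ with $\epsilon^{(-)}\epsilon^{(+)}=\epsilon$ if $\mathbf G=\mathrm O^\epsilon_{2n}$; $(\mathrm O^{\epsilon^{(-)}}_{2n^{(-)}},\mathrm{Sp}_{2n^{(+)}})$ if $\mathbf G=\mathrm{Sp}_{2n}$; $(\mathrm{Sp}_{2n^{(-)}},\mathrm{Sp}_{2n^{(+)}})$ if $\mathbf G=\mathrm{SO}_{2n+1}$. The modified Lusztig correspondence (a version of Lusztig's Jordan decomposition) is a bijection $\Xi_s:\mathcal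 E(\mathbf G)_s\to\mathcal E(\mathbf G^{(0)}(s)\times\mathbf G^{(-)}(s)\times\mathbf G^{(+)}(s))_1$ onto unipotent characters. Let $\mathcal E(\mathbf G)_{[s]}$ be the union of the series with the same $s^{(0)},n^{(-)},n^{(+)}$ and all possible signs (four series for $\mathrm O^\pm_{2n}$, signs $(\epsilon^{(-)},\epsilon^{(+)})$ arbitrary; two for $\mathrm{Sp}_{2n}$, $\epsilon^{(-)}=\pm$; one for $\mathrm{SO}_{2n+1}$). The $\Xi$'s combine to a bijection $\Xi_{[s]}:\mathcal E(\mathbf G)_{[s]}\to\mathcal E(\mathbf G^{(0)}[s]\times\mathbf G^{(-)}[s]\times\mathbf G^{(+)}[s])_1$, where $\mathbf G^{(0)}[s]=\mathbf G^{(0)}(s)$ and $(\mathbf G^{(-)}[s],\mathbf G^{(+)}[s])=(\mathrm O^\pm_{2n^{(-)}},\mathrm O^\pm_{2n^{(+)}})$, $(\mathrm O^\pm_{2n^{(-)}},\mathrm{Sp}_{2n^{(+)}})$, $(\mathrm{Sp}_{2n^{(-)}},\mathrm{Sp}_{2n^{(+)}})$ respectively. Write $\Xi_{[s]}(\rho_x)=\rho_{x^{(0)}}\otimes\rho_{\Lambda_x^{(-)}}\otimes\rho_{\Lambda_x^{(+)}}$ and $X(\mathbf G)_{[s]}=\{x\mid\rho_x\in\mathcal E(\mathbf G)_{[s]}\}$. **Almost characters.** For $x\in X(\mathbf G)_{[s]}$, $$R_x=\sum_{x_1}\langle R_{\Lambda_x^{(-)}},\rho_{\Lambda_{x_1}^{(-)}}\rangle\,\langle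 R_{\Lambda_x^{(+)}},\rho_{\Lambda_{x_1}^{(+)}}\rangle\,\rho_{x_1},$$ sum over $x_1\in X(\mathbf G)_{[s]}$ with $x_1^{(0)}=x^{(0)}$. For general linear and unitary groups $R_x=\rho_x$. The $R_x$ form an orthonormal basis of $\mathcal V(\mathbf G)$. **Choice of $\Xi$.** For the given pair and $\psi$, the modified Lusztig correspondences are fixed to be compatible with theta (possible by earlier work of Pan): $\omega^\psi_{\mathbf G,\mathbf G'}$ is the sum of $\rho_x\otimes\rho_{x'}$ over all $x\in X(\mathbf G)_{[s]}$, $x'\in X(\mathbf G')_{[s']}$ ($s,s'$ varying) such that: (i) if $\mathbf G'=\mathrm O^\pm_{2n'}$: $s^{(0)}=s'^{(0)}$ up to conjugation, $x^{(0)}=x'^{(0)}$, $\mathbf G^{(-)}[s]\simeq\mathbf G'^{(-)}[s']$, $\Lambda_x^{(-)}=\Lambda_{x'}^{(-)}$, and $(\Lambda_x^{(+)},\Lambda_{x'}^{(+)})\in\mathcal B_{\mathbf G^{(+)}[s],\mathbf G'^{(+)}[s']}$; (ii) if $\mathbf G'=\mathrm{SO}_{2n'+1}$: $s^{(0)}=-s'^{(0)}$ up to conjugation, $x^{(0)}=x'^{(0)}$, $\mathbf G^{(+)}[s]\simeq\mathbf G'^{(-)}[s']$, $\Lambda_x^{(+)}=\Lambda_{x'}^{(-)}$, and $(\Lambda_{x'}^{(+)},\Lambda_x^{(-)})\in\mathcal B_{\mathbf G'^{(+)}[s'],\mathbf G^{(-)}[s]}$. *)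

theory Defs
  imports
    Complex_Main
    "HOL-Library.Cardinality"
    "HOL-Algebra.Algebraic_Closure_Type"
    "Jordan_Normal_Form.Determinant"
    "Jordan_Normal_Form.Gauss_Jordan_Elimination"
begin

section \<open>Complex characters of finite groups\<close>

definition mat_trace :: "'r::comm_monoid_add mat \<Rightarrow> 'r" where
  "mat_trace A = (\<Sum>i<dim_row A. A $$ (i, i))"

definition representation ::
  "('g, 'b) monoid_scheme \<Rightarrow> nat \<Rightarrow> ('g \<Rightarrow> complex mat) \<Rightarrow> bool" where
  "representation G d \<rho> \<longleftrightarrow>
     (\<forall>x\<in>carrier G. \<rho> x \<in> carrier_mat d d) \<and> \<rho> \<one>\<^bsub>G\<^esub> = 1\<^sub>m d \<and>
     (\<forall>x\<in>carrier G. \<forall>y\<in>carrier G. \<rho> (x \<otimes>\<^bsub>G\<^esub> y) = \<rho> x * \<rho> y)"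

definition linear_subspace :: "nat \<Rightarrow> complex vec set \<Rightarrow> bool" where
  "linear_subspace d W \<longleftrightarrow>
     W \<subseteq> carrier_vec d \<and> 0\<^sub>v d \<in> W \<and>
     (\<forall>u\<in>W. \<forall>v\<in>W. u + v \<in> W) \<and> (\<forall>c. \<forall>v\<in>W. c \<cdot>\<^sub>v v \<in> W)"

definition irreducible_rep ::
  "('g, 'b) monoid_scheme \<Rightarrow> nat \<Rightarrow> ('g \<Rightarrow> complex mat) \<Rightarrow> bool" where
  "irreducible_rep G d \<rho> \<longleftrightarrow>
     d > 0 \<and> representation G d \<rho> \<and>
     (\<forall>W. linear_subspace d W \<and> (\<forall>x\<in>carrier G. \<forall>v\<in>W. \<rho> x *\<^sub>v v \<in> W)
        \<longrightarrow> W = {0\<^sub>v d} \<or> W = carrier_vec d)"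

(* Characters are extended by 0 outside the carrier, so that they are determined by their
   values on the group. *)
definition irr_chars :: "('g, 'b) monoid_scheme \<Rightarrow> ('g \<Rightarrow> complex) set" where
  "irr_chars G = {\<chi>. group G \<and> (\<exists>d \<rho>. irreducible_rep G d \<rho> \<and>
     \<chi> = (\<lambda>x. if x \<in> carrier G then mat_trace (\<rho> x) else 0))}"

definition cf_inner ::
  "('g, 'b) monoid_scheme \<Rightarrow> ('g \<Rightarrow> complex) \<Rightarrow> ('g \<Rightarrow> complex) \<Rightarrow> complex" where
  "cf_inner G f f' = (\<Sum>g\<in>carrier G. f g * f' (inv\<^bsub>G\<^esub> g)) / of_nat (card (carrier G))"

(* Induction from the subgroup H of G; the class function f is supported on H. *)
definition induced ::
  "('g, 'b) monoid_scheme \<Rightarrow> 'g set \<Rightarrow> ('g \<Rightarrow> complex) \<Rightarrow> 'g \<Rightarrow> complex" where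
  "induced G H f g =
     (\<Sum>x\<in>carrier G. f (inv\<^bsub>G\<^esub> x \<otimes>\<^bsub>G\<^esub> g \<otimes>\<^bsub>G\<^esub> x)) / of_nat (card H)"


section \<open>Classical groups\<close>

datatype sgn_type = Plus | Minus

definition isometries :: "nat \<Rightarrow> 'k::field mat \<Rightarrow> 'k mat set" where
  "isometries N S = {A \<in> carrier_mat N N. transpose_mat A * S * A = S}"

definition sisometries :: "nat \<Rightarrow> 'k::field mat \<Rightarrow> 'k mat set" where
  "sisometries N S = {A \<in> isometries N S. det A = 1}"

definition sp_form :: "nat \<Rightarrow> 'k::field mat" where
  "sp_form n = mat (2 * n) (2 * n)
     (\<lambda>(i, j). if i + j + 1 = 2 * n then (if i < n then 1 else - 1) else 0)"

definition split_form :: "nat \<Rightarrow> 'k::field mat" where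
  "split_form N = mat N N (\<lambda>(i, j). if i + j + 1 = N then 1 else 0)"

(* The two symmetric forms of dimension 2n over a finite field of odd order: the split one, and
   the sum of a split form of dimension 2n - 2 and the anisotropic plane x^2 - d y^2 with d a
   nonsquare (n > 0). *)
definition orth_form :: "sgn_type \<Rightarrow> nat \<Rightarrow> 'k::field mat" where
  "orth_form \<epsilon> n = (case \<epsilon> of
      Plus \<Rightarrow> split_form (2 * n)
    | Minus \<Rightarrow> four_block_mat (split_form (2 * n - 2)) (0\<^sub>m (2 * n - 2) 2) (0\<^sub>m 2 (2 * n - 2))
        (mat_diag 2 (\<lambda>i. if i = 0 then 1 else - (SOME d. \<nexists>x. d = x ^ 2))))"

definition matrix_group :: "nat \<Rightarrow> 'k::field mat set \<Rightarrow> 'k mat monoid" where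
  "matrix_group N H = \<lparr>carrier = H, monoid.mult = (*), one = 1\<^sub>m N\<rparr>"

(* Opm n is the formal group consisting of both orthogonal groups in dimension 2n; the second
   argument of SOodd n S is the symmetric matrix of the form, of size 2n + 1. *)
datatype 'k classical = Sp nat | Opm nat | SOodd nat "'k mat"

fun cl_rank :: "'k classical \<Rightarrow> nat" where
  "cl_rank (Sp n) = n" | "cl_rank (Opm n) = n" | "cl_rank (SOodd n S) = n"

fun cl_dim :: "'k classical \<Rightarrow> nat" where
  "cl_dim (Sp n) = 2 * n" | "cl_dim (Opm n) = 2 * n" | "cl_dim (SOodd n S) = 2 * n + 1"

fun cl_form :: "'k::field classical \<Rightarrow> sgn_type \<Rightarrow> 'k mat" where
  "cl_form (Sp n) \<epsilon> = sp_form n"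
| "cl_form (Opm n) \<epsilon> = orth_form \<epsilon> n"
| "cl_form (SOodd n S) \<epsilon> = S"

fun wf_classical :: "'k::field classical \<Rightarrow> bool" where
  "wf_classical (SOodd n S) \<longleftrightarrow>
     S \<in> carrier_mat (2 * n + 1) (2 * n + 1) \<and> transpose_mat S = S \<and> det S \<noteq> 0"
| "wf_classical _ \<longleftrightarrow> True"

(* A formal group is the family of its components, indexed by signs. Sp and SOodd have only a
   Plus component; Opm has two, except that there is no Minus group in dimension 0. *)
fun has_component :: "'k classical \<Rightarrow> sgn_type \<Rightarrow> bool" where
  "has_component (Opm n) \<epsilon> \<longleftrightarrow> \<epsilon> = Plus \<or> n > 0"
| "has_component _ \<epsilon> \<longleftrightarrow> \<epsilon> = Plus"

fun cl_set :: "'k::field classical \<Rightarrow> sgn_type \<Rightarrow> 'k mat set" where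
  "cl_set (Opm n) \<epsilon> = isometries (2 * n) (orth_form \<epsilon> n)"
| "cl_set G \<epsilon> = sisometries (cl_dim G) (cl_form G \<epsilon>)"

(* An absent component has empty carrier, hence is not a group and has no characters. *)
definition component :: "'k::field classical \<Rightarrow> sgn_type \<Rightarrow> 'k mat monoid" where
  "component G \<epsilon> = matrix_group (cl_dim G) (if has_component G \<epsilon> then cl_set G \<epsilon> else {})"

type_synonym 'k cf = "'k mat \<Rightarrow> complex"

(* Irreducible characters of a formal group, tagged with their component; this set also serves
   as the index set X(G). *)
type_synonym 'k fchar = "sgn_type \<times> 'k cf"

definition fchars :: "'k::field classical \<Rightarrow> 'k fchar set" where
  "fchars G = {(\<epsilon>, \<chi>). \<chi> \<in> irr_chars (component G \<epsilon>)}"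

(* The element of V(G) given by a tagged character: zero on the other component. *)
definition rho :: "'k fchar \<Rightarrow> sgn_type \<Rightarrow> 'k cf" where
  "rho x \<epsilon> g = (if \<epsilon> = fst x then snd x g else 0)"

definition fcf_inner ::
  "'k::field classical \<Rightarrow> (sgn_type \<Rightarrow> 'k cf) \<Rightarrow> (sgn_type \<Rightarrow> 'k cf) \<Rightarrow> complex" where
  "fcf_inner G f f' = (\<Sum>\<epsilon>\<in>{Plus, Minus}. cf_inner (component G \<epsilon>) (f \<epsilon>) (f' \<epsilon>))"


section \<open>The Weil character\<close>

definition nontrivial_additive_char :: "('a::field \<Rightarrow> complex) \<Rightarrow> bool" where
  "nontrivial_additive_char \<psi> \<longleftrightarrow>
     \<psi> 0 = 1 \<and> (\<forall>x y. \<psi> (x + y) = \<psi> x * \<psi> y) \<and> (\<exists>x. \<psi> x \<noteq> 1)"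

(* v in F^(2N) is written as (a, b) with respect to the polarization of sp_form N. *)
definition pos_part :: "nat \<Rightarrow> 'a vec \<Rightarrow> 'a vec" where
  "pos_part N v = vec N (\<lambda>i. v $ i)"

definition mom_part :: "nat \<Rightarrow> 'a vec \<Rightarrow> 'a vec" where
  "mom_part N v = vec N (\<lambda>i. v $ (2 * N - 1 - i))"

(* Operators on complex functions on F^N are given by their kernels. *)
definition kernel_comp :: "nat \<Rightarrow> ('a vec \<Rightarrow> 'a vec \<Rightarrow> complex)
    \<Rightarrow> ('a vec \<Rightarrow> 'a vec \<Rightarrow> complex) \<Rightarrow> 'a vec \<Rightarrow> 'a vec \<Rightarrow> complex" where
  "kernel_comp N K L x z = (\<Sum>y\<in>carrier_vec N. K x y * L y z)"

(* Schroedinger model of the Heisenberg representation with central character psi: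
   (H(a,b) f)(x) = psi(b.x + (a.b)/2) f(x + a), so that
   H(v) H(v') = psi(<v,v'>/2) H(v + v') for the form sp_form N. *)
definition heisenberg ::
  "('a::field \<Rightarrow> complex) \<Rightarrow> nat \<Rightarrow> 'a vec \<Rightarrow> 'a vec \<Rightarrow> 'a vec \<Rightarrow> complex" where
  "heisenberg \<psi> N v x y =
     (let a = pos_part N v; b = mom_part N v in
      if y = x + a then \<psi> (scalar_prod b x + scalar_prod a b / 2) else 0)"

(* The first three clauses say that W is a representation of Sp(2N,q) intertwining the Heisenberg
   representation with its twists; this determines W except for Sp(2,3). The formula for the
   unipotent radical of the Siegel parabolic in the last clause holds automatically when Sp(2N,q)
   is perfect, and singles out the usual choice (Gerardin, Howe) for Sp(2,3). *)
definition weil_rep ::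
  "('a::{field,finite} \<Rightarrow> complex) \<Rightarrow> nat \<Rightarrow> ('a mat \<Rightarrow> 'a vec \<Rightarrow> 'a vec \<Rightarrow> complex) \<Rightarrow> bool" where
  "weil_rep \<psi> N W \<longleftrightarrow>
     (\<forall>x\<in>carrier_vec N. \<forall>y\<in>carrier_vec N. W (1\<^sub>m (2 * N)) x y = (if x = y then 1 else 0)) \<and>
     (\<forall>g\<in>isometries (2 * N) (sp_form N). \<forall>h\<in>isometries (2 * N) (sp_form N).
        \<forall>x\<in>carrier_vec N. \<forall>y\<in>carrier_vec N. W (g * h) x y = kernel_comp N (W g) (W h) x y) \<and>
     (\<forall>g\<in>isometries (2 * N) (sp_form N). \<forall>v\<in>carrier_vec (2 * N).
        \<forall>x\<in>carrier_vec N. \<forall>y\<in>carrier_vec N.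
          kernel_comp N (W g) (heisenberg \<psi> N v) x y
            = kernel_comp N (heisenberg \<psi> N (g *\<^sub>v v)) (W g) x y) \<and>
     (\<forall>g\<in>isometries (2 * N) (sp_form N). \<forall>C\<in>carrier_mat N N.
        (\<forall>v\<in>carrier_vec (2 * N). pos_part N (g *\<^sub>v v) = pos_part N v \<and>
            mom_part N (g *\<^sub>v v) = mom_part N v + C *\<^sub>v pos_part N v) \<longrightarrow>
        (\<forall>x\<in>carrier_vec N. \<forall>y\<in>carrier_vec N.
           W g x y = (if x = y then \<psi> (- (scalar_prod x (C *\<^sub>v x) / 2)) else 0)))"

definition weil_char :: "('a::{field,finite} \<Rightarrow> complex) \<Rightarrow> nat \<Rightarrow> 'a cf" where
  "weil_char \<psi> N = (THE \<chi>. \<exists>W. weil_rep \<psi> N W \<and>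
     \<chi> = (\<lambda>g. if g \<in> isometries (2 * N) (sp_form N) then \<Sum>x\<in>carrier_vec N. W g x x else 0))"

definition kronecker :: "'a::times mat \<Rightarrow> 'a mat \<Rightarrow> 'a mat" where
  "kronecker A B = mat (dim_row A * dim_row B) (dim_col A * dim_col B)
     (\<lambda>(i, j). A $$ (i div dim_row B, j div dim_col B) * B $$ (i mod dim_row B, j mod dim_col B))"

(* Restriction to Sp(2n,q) x O(S), S symmetric of size m, along the tensor product. P identifies
   the symplectic space with form sp_form n (x) S with the standard one; its choice does not
   affect the character. *)
definition weil_pair_char :: "('a::{field,finite} \<Rightarrow> complex) \<Rightarrow> nat \<Rightarrow> nat \<Rightarrow> 'a mat
    \<Rightarrow> 'a mat \<Rightarrow> 'a mat \<Rightarrow> complex" where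
  "weil_pair_char \<psi> n m S g h =
     (let P = (SOME P. P \<in> carrier_mat (2 * (n * m)) (2 * (n * m)) \<and>
                transpose_mat P * sp_form (n * m) * P = kronecker (sp_form n) S)
      in weil_char \<psi> (n * m) (P * kronecker g h * the (mat_inverse P)))"

(* The Weil character of (Sp 2n, G') as an element of V(Sp 2n) (x) V(G'). *)
definition weil :: "('a::{field,finite} \<Rightarrow> complex) \<Rightarrow> nat \<Rightarrow> 'a classical
    \<Rightarrow> sgn_type \<Rightarrow> 'a mat \<Rightarrow> sgn_type \<Rightarrow> 'a mat \<Rightarrow> complex" where
  "weil \<psi> n G' \<epsilon> g \<epsilon>' h =
     (if g \<in> carrier (component (Sp n) \<epsilon>) \<and> h \<in> carrier (component G' \<epsilon>')
      then weil_pair_char \<psi> n (cl_dim G') (cl_form G' \<epsilon>') g h else 0)"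


section \<open>Deligne--Lusztig characters and Lusztig series\<close>

definition frob :: "'a::{field,finite} alg_closure mat \<Rightarrow> 'a alg_closure mat" where
  "frob A = map_mat (\<lambda>x. x ^ CARD('a)) A"

definition emb :: "'a::{field,finite} mat \<Rightarrow> 'a alg_closure mat" where
  "emb A = map_mat to_ac A"

definition rational_points ::
  "nat \<Rightarrow> 'a::{field,finite} alg_closure mat set \<Rightarrow> 'a mat set" where
  "rational_points N H = {A \<in> carrier_mat N N. emb A \<in> H}"

(* g is a basis of the geometric form S which is standard, i.e. has Gram matrix J = sp_form or
   J = split_form; these bases parametrize the pairs T < B of a maximal torus and a Borel subgroup:
   T (U) is the group of isometries that are diagonal (upper unitriangular) in this basis. *)
definition std_basis :: "nat \<Rightarrow> 'k::field mat \<Rightarrow> 'k mat \<Rightarrow> 'k mat \<Rightarrow> bool" where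
  "std_basis N S J g \<longleftrightarrow> g \<in> carrier_mat N N \<and> transpose_mat g * S * g = J"

definition torus :: "nat \<Rightarrow> 'k::field mat \<Rightarrow> 'k mat \<Rightarrow> 'k mat set" where
  "torus N S g = {A \<in> sisometries N S.
     \<exists>D\<in>carrier_mat N N. diagonal_mat D \<and> A * g = g * D}"

definition unip_radical :: "nat \<Rightarrow> 'k::field mat \<Rightarrow> 'k mat \<Rightarrow> 'k mat set" where
  "unip_radical N S g = {A \<in> sisometries N S.
     \<exists>D\<in>carrier_mat N N. upper_triangular D \<and> (\<forall>i<N. D $$ (i, i) = 1) \<and> A * g = g * D}"

(* The trace of sigma on the compactly supported l-adic cohomology of a variety X over the
   algebraic closure, for sigma of finite order commuting with F. By the Lefschetz trace formula
   |X^(sigma F^(e n))| = sum of k(a) a^n over the eigenvalues a of F^e, with k(a) the trace of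
   sigma on the (virtual) generalized eigenspace of a, and the wanted trace is the sum of the
   k(a). It is independent of the exponent e for which F^e preserves X. *)
definition lefschetz_number :: "'v set \<Rightarrow> ('v \<Rightarrow> 'v) \<Rightarrow> ('v \<Rightarrow> 'v) \<Rightarrow> complex" where
  "lefschetz_number V F \<sigma> = (THE c. \<exists>e>0. (F ^^ e) ` V = V \<and>
     (\<exists>(A :: complex set) k. finite A \<and> 0 \<notin> A \<and>
        (\<forall>n>0. of_nat (card {x \<in> V. \<sigma> ((F ^^ (e * n)) x) = x}) = (\<Sum>a\<in>A. k a * a ^ n)) \<and>
        c = (\<Sum>a\<in>A. k a)))"

(* The Deligne--Lusztig character R_T(theta) of a connected group H with unipotent radical U of a
   Borel subgroup containing the F-stable torus T, through the variety {x in H. x^-1 F(x) in U}. *)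
definition dl_char :: "nat \<Rightarrow> 'a::{field,finite} alg_closure mat set \<Rightarrow> 'a alg_closure mat set
    \<Rightarrow> 'a alg_closure mat set \<Rightarrow> 'a cf \<Rightarrow> 'a cf" where
  "dl_char N H U T \<theta> g =
     (\<Sum>t\<in>rational_points N T.
        lefschetz_number {x \<in> H. \<exists>u\<in>U. frob x = x * u} frob (\<lambda>x. emb g * x * emb t) / \<theta> t)
     / of_nat (card (rational_points N T))"

definition torus_char :: "nat \<Rightarrow> 'a::{field,finite} alg_closure mat set \<Rightarrow> 'a cf \<Rightarrow> bool" where
  "torus_char N T \<theta> \<longleftrightarrow> (\<forall>t\<in>rational_points N T. \<theta> t \<noteq> 0) \<and>
     (\<forall>s\<in>rational_points N T. \<forall>t\<in>rational_points N T. \<theta> (s * t) = \<theta> s * \<theta> t)"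

(* The usual choice of an embedding of the multiplicative group of the algebraic closure into
   the complex roots of unity, on which the duality between (T, theta) and s depends. *)
definition root_embedding :: "('a::{field,finite} alg_closure \<Rightarrow> complex) \<Rightarrow> bool" where
  "root_embedding \<kappa> \<longleftrightarrow> \<kappa> 1 = 1 \<and> inj_on \<kappa> (- {0}) \<and>
     (\<forall>x y. x \<noteq> 0 \<and> y \<noteq> 0 \<longrightarrow> \<kappa> (x * y) = \<kappa> x * \<kappa> y)"

fun frob_norm :: "nat \<Rightarrow> nat \<Rightarrow> 'a::{field,finite} alg_closure mat \<Rightarrow> 'a alg_closure mat" where
  "frob_norm N 0 y = 1\<^sub>m N"
| "frob_norm N (Suc m) y = y * frob (frob_norm N m y)"

(* The element s = (s_0, s_1, ...) of the dual torus corresponding to (T, theta), T given by the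
   basis g. Choose m such that F^m fixes every line of the basis, so that T is split over the
   extension of degree m. Let zeta be the generator of its multiplicative group with
   kappa(zeta) = exp(2 pi i / (q^m - 1)), and lambda_i the i-th coordinate cocharacter of T. Then
   kappa(s_i) = theta(N(lambda_i(zeta))), N being the norm from the F^m-points to the F-points. *)
definition dual_param :: "('a::{field,finite} alg_closure \<Rightarrow> complex) \<Rightarrow> nat
    \<Rightarrow> 'a alg_closure mat \<Rightarrow> 'a cf \<Rightarrow> (nat \<Rightarrow> 'a alg_closure) \<Rightarrow> bool" where
  "dual_param \<kappa> N g \<theta> s \<longleftrightarrow> (\<exists>m>0. \<exists>D\<in>carrier_mat N N. \<exists>\<zeta>.
     diagonal_mat D \<and> (frob ^^ m) g = g * D \<and>
     \<zeta> \<noteq> 0 \<and> \<kappa> \<zeta> = cis (2 * pi / real (CARD('a) ^ m - 1)) \<and>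
     (\<forall>i < N div 2. s i \<noteq> 0 \<and> (\<exists>y\<in>carrier_mat N N. \<exists>t\<in>carrier_mat N N.
        y * g = g * mat_diag N (\<lambda>j. if j = i then \<zeta> else if j = N - 1 - i then inverse \<zeta> else 1) \<and>
        emb t = frob_norm N m y \<and> \<kappa> (s i) = \<theta> t)))"

(* Eigenvalues of s, without the additional eigenvalue 1 if the dual group is SO(2n+1). *)
definition eigenvalues_of :: "nat \<Rightarrow> (nat \<Rightarrow> 'k::field) \<Rightarrow> 'k multiset" where
  "eigenvalues_of n s = (\<Sum>i<n. {#s i, inverse (s i)#})"

(* The type of the quadratic space of the eigenvalue c = 1 or -1 of s. F acts on the lines of the
   basis by a signed permutation, and the type is the product of its signs over the coordinates i
   with s_i = c. *)
definition eigenspace_type ::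
  "nat \<Rightarrow> 'a::{field,finite} alg_closure mat \<Rightarrow> (nat \<Rightarrow> 'a alg_closure) \<Rightarrow> 'a alg_closure
    \<Rightarrow> sgn_type" where
  "eigenspace_type N g s c =
     (if even (card {i. i < N div 2 \<and> s i = c \<and>
          (\<exists>\<nu>\<in>carrier_mat N N. frob g = g * \<nu> \<and>
             (\<exists>j. N - N div 2 \<le> j \<and> j < N \<and> \<nu> $$ (j, i) \<noteq> 0))})
      then Plus else Minus)"

(* Series of the rational points of the special isometry group of S attached to the semisimple
   class s with eigenvalues M and eigenspaces for -1 and 1 of types e1 and e2. *)
definition special_series :: "('a::{field,finite} alg_closure \<Rightarrow> complex) \<Rightarrow> nat \<Rightarrow> 'a mat
    \<Rightarrow> 'a alg_closure mat \<Rightarrow> 'a alg_closure multiset \<Rightarrow> sgn_type \<Rightarrow> sgn_type \<Rightarrow> 'a cf set" where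
  "special_series \<kappa> N S J M e1 e2 =
     {\<chi> \<in> irr_chars (matrix_group N (sisometries N S)). \<exists>g \<theta> s.
        std_basis N (emb S) J g \<and> frob ` torus N (emb S) g = torus N (emb S) g \<and>
        torus_char N (torus N (emb S) g) \<theta> \<and> dual_param \<kappa> N g \<theta> s \<and>
        eigenvalues_of (N div 2) s = M \<and>
        eigenspace_type N g s (- 1) = e1 \<and> eigenspace_type N g s 1 = e2 \<and>
        cf_inner (matrix_group N (sisometries N S)) \<chi>
          (dl_char N (sisometries N (emb S)) (unip_radical N (emb S) g) (torus N (emb S) g) \<theta>) \<noteq> 0}"

definition induced_constituents ::
  "'a::{field,finite} classical \<Rightarrow> sgn_type \<Rightarrow> 'a cf set \<Rightarrow> 'a cf set" where
  "induced_constituents G \<epsilon> E = {\<chi> \<in> irr_chars (component G \<epsilon>).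
     \<exists>\<eta>\<in>E. cf_inner (component G \<epsilon>) \<chi>
        (induced (component G \<epsilon>) (sisometries (cl_dim G) (cl_form G \<epsilon>)) \<eta>) \<noteq> 0}"

(* The Lusztig series of the class with eigenvalues M and signs (e1, e2). A sign is carried only
   by those of the groups G^(-), G^(+) that are orthogonal; for a symplectic one it is Plus. *)
fun lusztig_series :: "('a::{field,finite} alg_closure \<Rightarrow> complex) \<Rightarrow> 'a classical
    \<Rightarrow> 'a alg_closure multiset \<Rightarrow> sgn_type \<Rightarrow> sgn_type \<Rightarrow> 'a fchar set" where
  "lusztig_series \<kappa> (Sp n) M e1 e2 =
     {(Plus, \<chi>) | \<chi>. e2 = Plus \<and>
        (\<exists>e. \<chi> \<in> special_series \<kappa> (2 * n) (sp_form n) (sp_form n) M e1 e)}"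
| "lusztig_series \<kappa> (Opm n) M e1 e2 =
     {(\<epsilon>, \<chi>). \<chi> \<in> induced_constituents (Opm n) \<epsilon>
        (special_series \<kappa> (2 * n) (orth_form \<epsilon> n) (split_form (2 * n)) M e1 e2)}"
| "lusztig_series \<kappa> (SOodd n S) M e1 e2 =
     {(Plus, \<chi>) | \<chi>. e1 = Plus \<and> e2 = Plus \<and>
        (\<exists>e e'. \<chi> \<in> special_series \<kappa> (2 * n + 1) S (split_form (2 * n + 1)) M e e')}"

(* The classes [s]: eigenvalue multisets of rational semisimple elements of the identity component
   of the dual group. *)
definition ss_classes :: "nat \<Rightarrow> 'a::{field,finite} alg_closure multiset set" where
  "ss_classes n = {M. size M = 2 * n \<and> 0 \<notin># M \<and> image_mset inverse M = M \<and>
     image_mset (\<lambda>x. x ^ CARD('a)) M = M \<and> even (count M 1) \<and> even (count M (- 1))}"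

definition ss_zero :: "'k::field multiset \<Rightarrow> 'k multiset" where
  "ss_zero M = filter_mset (\<lambda>x. x \<noteq> 1 \<and> x \<noteq> - 1) M"

definition n_minus :: "'k::field multiset \<Rightarrow> nat" where
  "n_minus M = count M (- 1) div 2"

definition n_plus :: "'k::field multiset \<Rightarrow> nat" where
  "n_plus M = count M 1 div 2"

fun G_minus :: "'k classical \<Rightarrow> nat \<Rightarrow> 'k classical" where
  "G_minus (SOodd n S) k = Sp k" | "G_minus _ k = Opm k"

fun G_plus :: "'k classical \<Rightarrow> nat \<Rightarrow> 'k classical" where
  "G_plus (Opm n) k = Opm k" | "G_plus _ k = Sp k"


section \<open>Unipotent characters\<close>

definition centralizer :: "nat \<Rightarrow> 'k::field mat \<Rightarrow> 'k mat \<Rightarrow> 'k mat set" where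
  "centralizer N S s = {A \<in> sisometries N S. A * s = s * A}"

(* Unipotent characters of the centralizer of a rational semisimple s in the special isometry group
   of S, which must be connected. Its maximal tori containing s and the unipotent radicals of its
   Borel subgroups come from the bases in which s is diagonal. *)
definition unip_centralizer :: "nat \<Rightarrow> 'a::{field,finite} mat \<Rightarrow> 'a alg_closure mat \<Rightarrow> 'a mat
    \<Rightarrow> 'a cf set" where
  "unip_centralizer N S J s =
     {\<chi> \<in> irr_chars (matrix_group N (centralizer N S s)). \<exists>g.
        std_basis N (emb S) J g \<and> frob ` torus N (emb S) g = torus N (emb S) g \<and>
        emb s \<in> torus N (emb S) g \<and>
        cf_inner (matrix_group N (centralizer N S s)) \<chi>
          (dl_char N (centralizer N (emb S) (emb s))
             (unip_radical N (emb S) g \<inter> centralizer N (emb S) (emb s))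
             (torus N (emb S) g) (\<lambda>_. 1)) \<noteq> 0}"

fun unip :: "'a::{field,finite} classical \<Rightarrow> 'a fchar set" where
  "unip (Opm n) = {(\<epsilon>, \<chi>). \<chi> \<in> induced_constituents (Opm n) \<epsilon>
     (unip_centralizer (2 * n) (orth_form \<epsilon> n) (split_form (2 * n)) (1\<^sub>m (2 * n)))}"
| "unip (Sp n) = {Plus} \<times> unip_centralizer (2 * n) (sp_form n) (sp_form n) (1\<^sub>m (2 * n))"
| "unip (SOodd n S) =
     {Plus} \<times> unip_centralizer (2 * n + 1) S (split_form (2 * n + 1)) (1\<^sub>m (2 * n + 1))"

(* The product of general linear and unitary groups attached to s^(0) is realized as the (connected)
   centralizer in a symplectic group of a rational semisimple element with the eigenvalues of
   s^(0), which is unique up to rational conjugation. M0 has no entry 1 or -1. *)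
definition ss_elt :: "'a::{field,finite} alg_closure multiset \<Rightarrow> 'a mat" where
  "ss_elt M0 = (let n = size M0 div 2 in
     SOME s. s \<in> sisometries (2 * n) (sp_form n) \<and>
       (\<exists>g D. std_basis (2 * n) (sp_form n) (sp_form n) g \<and> D \<in> carrier_mat (2 * n) (2 * n) \<and>
          diagonal_mat D \<and> emb s * g = g * D \<and> mset (diag_mat D) = M0))"

definition G_zero :: "'a::{field,finite} alg_closure multiset \<Rightarrow> 'a mat set" where
  "G_zero M0 = (let n = size M0 div 2 in centralizer (2 * n) (sp_form n) (ss_elt M0))"

definition unip_zero :: "'a::{field,finite} alg_closure multiset \<Rightarrow> 'a cf set" where
  "unip_zero M0 = (let n = size M0 div 2 in
     unip_centralizer (2 * n) (sp_form n) (sp_form n) (ss_elt M0))"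

(* x0 and x0' agree under the identification of the centralizers of s^(0) and c s'^(0), c = 1 or -1,
   by a rational conjugation taking the one element to the other. *)
definition same_zero :: "'a::{field,finite} \<Rightarrow> 'a alg_closure multiset \<Rightarrow> 'a alg_closure multiset
    \<Rightarrow> 'a cf \<Rightarrow> 'a cf \<Rightarrow> bool" where
  "same_zero c M0 M0' \<chi> \<chi>' \<longleftrightarrow> M0 = image_mset (\<lambda>x. to_ac c * x) M0' \<and>
     (let n = size M0 div 2 in
      \<exists>h\<in>sisometries (2 * n) (sp_form n).
        h * ss_elt M0 = (c \<cdot>\<^sub>m ss_elt M0') * h \<and>
        (\<forall>A\<in>G_zero M0. \<forall>B\<in>G_zero M0'. h * A = B * h \<longrightarrow> \<chi> A = \<chi>' B))"


section \<open>Symbols\<close>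

type_synonym symbol = "nat set \<times> nat set"

(* Symbols are given by their reduced representatives. *)
definition is_symbol :: "symbol \<Rightarrow> bool" where
  "is_symbol \<Lambda> \<longleftrightarrow> finite (fst \<Lambda>) \<and> finite (snd \<Lambda>) \<and> 0 \<notin> fst \<Lambda> \<inter> snd \<Lambda>"

definition sym_card :: "symbol \<Rightarrow> nat" where
  "sym_card \<Lambda> = card (fst \<Lambda>) + card (snd \<Lambda>)"

definition sym_rank :: "symbol \<Rightarrow> int" where
  "sym_rank \<Lambda> = int (\<Sum>(fst \<Lambda>)) + int (\<Sum>(snd \<Lambda>)) - \<lfloor>((real (sym_card \<Lambda>) - 1) / 2) ^ 2\<rfloor>"

definition defect :: "symbol \<Rightarrow> int" where
  "defect \<Lambda> = int (card (fst \<Lambda>)) - int (card (snd \<Lambda>))"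

definition S_Sp :: "nat \<Rightarrow> symbol set" where
  "S_Sp n = {\<Lambda>. is_symbol \<Lambda> \<and> sym_rank \<Lambda> = int n \<and> defect \<Lambda> mod 4 = 1}"

definition S_O :: "sgn_type \<Rightarrow> nat \<Rightarrow> symbol set" where
  "S_O \<epsilon> n = {\<Lambda>. is_symbol \<Lambda> \<and> sym_rank \<Lambda> = int n \<and>
     defect \<Lambda> mod 4 = (case \<epsilon> of Plus \<Rightarrow> 0 | Minus \<Rightarrow> 2)}"

fun symbols :: "'k classical \<Rightarrow> symbol set" where
  "symbols (Sp n) = S_Sp n"
| "symbols (Opm n) = S_O Plus n \<union> S_O Minus n"
| "symbols (SOodd n S) = {}"

definition desc :: "nat set \<Rightarrow> nat list" where
  "desc A = rev (sorted_list_of_set A)"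

definition special :: "symbol \<Rightarrow> bool" where
  "special Z \<longleftrightarrow> is_symbol Z \<and>
     (let a = desc (fst Z); b = desc (snd Z) in
      (defect Z = 1 \<and> (\<forall>i < length b. a ! i \<ge> b ! i \<and> b ! i \<ge> a ! Suc i)) \<or>
      (defect Z = 0 \<and> (\<forall>i < length b. a ! i \<ge> b ! i) \<and>
         (\<forall>i. Suc i < length a \<longrightarrow> b ! i \<ge> a ! Suc i)))"

definition sym_singles :: "symbol \<Rightarrow> symbol" where
  "sym_singles Z = (fst Z - snd Z, snd Z - fst Z)"

definition sym_degree :: "symbol \<Rightarrow> nat" where
  "sym_degree Z = sym_card (sym_singles Z) div 2"

definition swaps :: "symbol \<Rightarrow> symbol set" where
  "swaps Z = {M. fst M \<subseteq> fst (sym_singles Z) \<and> snd M \<subseteq> snd (sym_singles Z) \<and>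
     (defect Z = 1 \<longrightarrow> even (sym_card M))}"

definition sym_swap :: "symbol \<Rightarrow> symbol \<Rightarrow> symbol" where
  "sym_swap Z M = ((fst Z - fst M) \<union> snd M, (snd Z - snd M) \<union> fst M)"

definition sym_family :: "symbol \<Rightarrow> symbol set" where
  "sym_family Z = sym_swap Z ` swaps Z"

definition special_of :: "symbol \<Rightarrow> symbol" where
  "special_of \<Lambda> = (THE Z. special Z \<and> \<Lambda> \<in> sym_family Z)"

definition swap_of :: "symbol \<Rightarrow> symbol" where
  "swap_of \<Lambda> = (THE M. M \<in> swaps (special_of \<Lambda>) \<and> sym_swap (special_of \<Lambda>) M = \<Lambda>)"

(* The exponent <Lambda1, Lambda2>, of which only the parity matters. *)
definition sym_pairing :: "symbol \<Rightarrow> symbol \<Rightarrow> nat" where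
  "sym_pairing \<Lambda>1 \<Lambda>2 = (let M1 = swap_of \<Lambda>1; M2 = swap_of \<Lambda>2 in
     sym_card M1 * sym_card M2 + sym_card (fst M1 \<inter> fst M2, snd M1 \<inter> snd M2))"

(* The parts of the partition attached to a row, padded with zeros; indices start at 0. *)
definition row_partition :: "nat set \<Rightarrow> nat \<Rightarrow> nat" where
  "row_partition A i = (if i < card A then desc A ! i - (card A - 1 - i) else 0)"

definition interlaced :: "(nat \<Rightarrow> nat) \<Rightarrow> (nat \<Rightarrow> nat) \<Rightarrow> bool" (infix "\<preceq>\<^sub>p" 50) where
  "l \<preceq>\<^sub>p m \<longleftrightarrow> (\<forall>i. l i \<le> m i \<and> m (Suc i) \<le> l i)"

fun B_eps :: "sgn_type \<Rightarrow> nat \<Rightarrow> nat \<Rightarrow> (symbol \<times> symbol) set" where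
  "B_eps Plus n n' = {(\<Lambda>, \<Lambda>'). \<Lambda> \<in> S_Sp n \<and> \<Lambda>' \<in> S_O Plus n' \<and>
     row_partition (snd \<Lambda>) \<preceq>\<^sub>p row_partition (fst \<Lambda>') \<and>
     row_partition (snd \<Lambda>') \<preceq>\<^sub>p row_partition (fst \<Lambda>) \<and> defect \<Lambda>' = - defect \<Lambda> + 1}"
| "B_eps Minus n n' = {(\<Lambda>, \<Lambda>'). \<Lambda> \<in> S_Sp n \<and> \<Lambda>' \<in> S_O Minus n' \<and>
     row_partition (fst \<Lambda>') \<preceq>\<^sub>p row_partition (snd \<Lambda>) \<and>
     row_partition (fst \<Lambda>) \<preceq>\<^sub>p row_partition (snd \<Lambda>') \<and> defect \<Lambda>' = - defect \<Lambda> - 1}"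

definition B_pm :: "nat \<Rightarrow> nat \<Rightarrow> (symbol \<times> symbol) set" where
  "B_pm n n' = B_eps Plus n n' \<union> B_eps Minus n n'"


section \<open>Parametrizations and almost characters\<close>

definition quadratic_char :: "'a::field \<Rightarrow> complex" where
  "quadratic_char x = (if x = 0 then 0 else if \<exists>y. x = y ^ 2 then 1 else - 1)"

(* Unipotent part of the Weil character of (Sp 2n, O^eps 2n'). In the restriction of the Weil
   representation, h in the orthogonal group acts on functions on V^n by
   f |-> chi(det h)^n f(h^-1 .) with chi the quadratic character, and the sign chi(det h)^n is
   nontrivial if q = 3 mod 4 and n is odd. The normalization of the parametrization refers to the
   natural action f |-> f(h^-1 .): with the sign, no parametrization would fit all n at once. *)
definition weil_unip :: "('a::{field,finite} \<Rightarrow> complex) \<Rightarrow> nat \<Rightarrow> nat \<Rightarrow> sgn_type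
    \<Rightarrow> 'a mat \<Rightarrow> 'a mat \<Rightarrow> complex" where
  "weil_unip \<psi> n n' \<epsilon> g h =
     (let G = component (Sp n) Plus; G' = component (Opm n') \<epsilon>;
          \<omega> = (\<lambda>a b. quadratic_char (det b) ^ n * weil \<psi> n (Opm n') Plus a \<epsilon> b)
      in \<Sum>\<chi>\<in>{\<chi>. (Plus, \<chi>) \<in> unip (Sp n)}. \<Sum>\<eta>\<in>{\<eta>. (\<epsilon>, \<eta>) \<in> unip (Opm n')}.
        (\<Sum>a\<in>carrier G. \<Sum>b\<in>carrier G'. \<omega> a b * \<chi> (inv\<^bsub>G\<^esub> a) * \<eta> (inv\<^bsub>G'\<^esub> b))
          / of_nat (card (carrier G) * card (carrier G')) * \<chi> g * \<eta> h)"

definition unip_parametrization ::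
  "('a::{field,finite} \<Rightarrow> complex) \<Rightarrow> ('a classical \<Rightarrow> symbol \<Rightarrow> 'a fchar) \<Rightarrow> bool" where
  "unip_parametrization \<psi> prm \<longleftrightarrow>
     (\<forall>n. bij_betw (prm (Sp n)) (S_Sp n) (unip (Sp n))) \<and>
     (\<forall>n \<epsilon>. bij_betw (prm (Opm n)) (S_O \<epsilon> n) {y \<in> unip (Opm n). fst y = \<epsilon>}) \<and>
     (\<forall>n n' \<epsilon> g h. has_component (Opm n' :: 'a classical) \<epsilon> \<longrightarrow>
        weil_unip \<psi> n n' \<epsilon> g h =
          (\<Sum>(\<Lambda>, \<Lambda>')\<in>B_eps \<epsilon> n n'. rho (prm (Sp n) \<Lambda>) Plus g * rho (prm (Opm n') \<Lambda>') \<epsilon> h))"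

definition unip_label ::
  "('a::{field,finite} classical \<Rightarrow> symbol \<Rightarrow> 'a fchar) \<Rightarrow> 'a classical \<Rightarrow> 'a fchar \<Rightarrow> symbol" where
  "unip_label prm G = inv_into (symbols G) (prm G)"

definition unip_almost :: "('a::{field,finite} classical \<Rightarrow> symbol \<Rightarrow> 'a fchar) \<Rightarrow> 'a classical
    \<Rightarrow> symbol \<Rightarrow> sgn_type \<Rightarrow> 'a cf" where
  "unip_almost prm G \<Lambda> \<epsilon> g =
     (\<Sum>\<Lambda>1\<in>sym_family (special_of \<Lambda>). (- 1) ^ sym_pairing \<Lambda> \<Lambda>1 * rho (prm G \<Lambda>1) \<epsilon> g)
       / 2 ^ sym_degree (special_of \<Lambda>)"

(* Xi x = (M, x0, y-, y+): the class M of s with x in the series of s, and the unipotent characters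
   of G^(0), G^(-), G^(+) whose tensor product is the image of x under the correspondence. *)
type_synonym 'a jordan =
  "'a fchar \<Rightarrow> 'a alg_closure multiset \<times> 'a cf \<times> 'a fchar \<times> 'a fchar"

(* The correspondences for all s, combined into one map. The second clause is Lusztig's theorem
   that every irreducible character lies in some series; disjointness of the series is implied by
   the first clause. *)
definition lusztig_correspondence ::
  "('a::{field,finite} alg_closure \<Rightarrow> complex) \<Rightarrow> 'a classical \<Rightarrow> 'a jordan \<Rightarrow> bool" where
  "lusztig_correspondence \<kappa> G \<Xi> \<longleftrightarrow>
     (\<forall>M\<in>ss_classes (cl_rank G). \<forall>e1 e2.
        bij_betw \<Xi> (lusztig_series \<kappa> G M e1 e2)
          ({M} \<times> unip_zero (ss_zero M) \<times> {y \<in> unip (G_minus G (n_minus M)). fst y = e1}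
             \<times> {y \<in> unip (G_plus G (n_plus M)). fst y = e2})) \<and>
     fchars G = (\<Union>M\<in>ss_classes (cl_rank G). \<Union>e1. \<Union>e2. lusztig_series \<kappa> G M e1 e2)"

definition ss_class :: "'a::{field,finite} jordan \<Rightarrow> 'a fchar \<Rightarrow> 'a alg_closure multiset" where
  "ss_class \<Xi> x = fst (\<Xi> x)"

definition zero_part :: "'a::{field,finite} jordan \<Rightarrow> 'a fchar \<Rightarrow> 'a cf" where
  "zero_part \<Xi> x = fst (snd (\<Xi> x))"

definition minus_symbol :: "('a::{field,finite} classical \<Rightarrow> symbol \<Rightarrow> 'a fchar) \<Rightarrow> 'a classical
    \<Rightarrow> 'a jordan \<Rightarrow> 'a fchar \<Rightarrow> symbol" where
  "minus_symbol prm G \<Xi> x =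
     unip_label prm (G_minus G (n_minus (ss_class \<Xi> x))) (fst (snd (snd (\<Xi> x))))"

definition plus_symbol :: "('a::{field,finite} classical \<Rightarrow> symbol \<Rightarrow> 'a fchar) \<Rightarrow> 'a classical
    \<Rightarrow> 'a jordan \<Rightarrow> 'a fchar \<Rightarrow> symbol" where
  "plus_symbol prm G \<Xi> x =
     unip_label prm (G_plus G (n_plus (ss_class \<Xi> x))) (snd (snd (snd (\<Xi> x))))"

definition almost_char :: "('a::{field,finite} classical \<Rightarrow> symbol \<Rightarrow> 'a fchar) \<Rightarrow> 'a classical
    \<Rightarrow> 'a jordan \<Rightarrow> 'a fchar \<Rightarrow> sgn_type \<Rightarrow> 'a cf" where
  "almost_char prm G \<Xi> x \<epsilon> g =
     (let Gm = G_minus G (n_minus (ss_class \<Xi> x)); Gp = G_plus G (n_plus (ss_class \<Xi> x)) in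
      \<Sum>x1\<in>{x1 \<in> fchars G. ss_class \<Xi> x1 = ss_class \<Xi> x \<and> zero_part \<Xi> x1 = zero_part \<Xi> x}.
        fcf_inner Gm (unip_almost prm Gm (minus_symbol prm G \<Xi> x))
            (rho (prm Gm (minus_symbol prm G \<Xi> x1))) *
        fcf_inner Gp (unip_almost prm Gp (plus_symbol prm G \<Xi> x))
            (rho (prm Gp (plus_symbol prm G \<Xi> x1))) *
        rho x1 \<epsilon> g)"


section \<open>Compatibility with the theta correspondence\<close>

fun theta_related :: "('a::{field,finite} classical \<Rightarrow> symbol \<Rightarrow> 'a fchar) \<Rightarrow> nat \<Rightarrow> 'a classical
    \<Rightarrow> 'a jordan \<Rightarrow> 'a jordan \<Rightarrow> 'a fchar \<Rightarrow> 'a fchar \<Rightarrow> bool" where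
  "theta_related prm n (Opm n') \<Xi> \<Xi>' x x' \<longleftrightarrow>
     (let M = ss_class \<Xi> x; M' = ss_class \<Xi>' x' in
      same_zero 1 (ss_zero M) (ss_zero M') (zero_part \<Xi> x) (zero_part \<Xi>' x') \<and>
      n_minus M = n_minus M' \<and>
      minus_symbol prm (Sp n) \<Xi> x = minus_symbol prm (Opm n') \<Xi>' x' \<and>
      (plus_symbol prm (Sp n) \<Xi> x, plus_symbol prm (Opm n') \<Xi>' x') \<in> B_pm (n_plus M) (n_plus M'))"
| "theta_related prm n (SOodd n' S) \<Xi> \<Xi>' x x' \<longleftrightarrow>
     (let M = ss_class \<Xi> x; M' = ss_class \<Xi>' x' in
      same_zero (- 1) (ss_zero M) (ss_zero M') (zero_part \<Xi> x) (zero_part \<Xi>' x') \<and>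
      n_plus M = n_minus M' \<and>
      plus_symbol prm (Sp n) \<Xi> x = minus_symbol prm (SOodd n' S) \<Xi>' x' \<and>
      (plus_symbol prm (SOodd n' S) \<Xi>' x', minus_symbol prm (Sp n) \<Xi> x)
        \<in> B_pm (n_plus M') (n_minus M))"
| "theta_related prm n (Sp n') \<Xi> \<Xi>' x x' \<longleftrightarrow> False"

definition theta_compatible :: "('a::{field,finite} \<Rightarrow> complex)
    \<Rightarrow> ('a classical \<Rightarrow> symbol \<Rightarrow> 'a fchar) \<Rightarrow> nat \<Rightarrow> 'a classical \<Rightarrow> 'a jordan \<Rightarrow> 'a jordan
    \<Rightarrow> bool" where
  "theta_compatible \<psi> prm n G' \<Xi> \<Xi>' \<longleftrightarrow> (\<forall>\<epsilon> g \<epsilon>' h.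
     weil \<psi> n G' \<epsilon> g \<epsilon>' h =
       (\<Sum>(x, x')\<in>{(x, x') \<in> fchars (Sp n) \<times> fchars G'. theta_related prm n G' \<Xi> \<Xi>' x x'}.
          rho x \<epsilon> g * rho x' \<epsilon>' h))"

end

theory Submission
  imports Defs "Jordan_Normal_Form.Spectral_Radius"
begin

text \<open>
Irreducible characters are orthonormal, so the coefficients $m$ can be read off from the
compatibility with the theta correspondence: $m_{x,x'}$ is $1$ or $0$ according to whether $x$ and
$x'$ are related. The almost characters arise from the irreducible characters by a real matrix $C$
with orthonormal rows. It is block diagonal along the sets of characters with the same semisimple
class and the same component $x^{(0)}$; on such a block, characters correspond to pairs of symbols
and $C$ is the Kronecker product of the two Fourier matrices of Lusztig. Comparing coefficients
gives $m = C^T m' C'$, hence $m' = C m C'^T$, and the theorem says that the $0$-$1$ matrix $m$ is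
fixed by this Fourier transform on both sides (\<open>theta_matrix_fourier_invariant\<close>). On
a pair of blocks, $m$ is zero or a Kronecker product as well. One of the factors is an identity
matrix, which is fixed because Fourier matrices are orthogonal. The other one is the indicator
function of the relation $\mathcal B$ between symbols of symplectic and of orthogonal type, and
its invariance (\<open>B_pm_fourier\<close>) is the heart of the proof.

To see it, put the entries $a$ of $\Lambda$ at the positions $2a$ of a line and the entries $a'$
of $\Lambda'$ at the positions $2(a' + c) + 1$, where the offset $c$ is determined by the numbers
of entries, and let all negative numbers be entries as well. The interlacing conditions say that
the upper row of $\Lambda$ alternates with the lower row of $\Lambda'$, and the lower row of
$\Lambda$ with the upper row of $\Lambda'$. Let the balance at $p$ be the number of entries of
$\Lambda$ minus the number of entries of $\Lambda'$ at positions at least $p$, and let the skew be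
the number of upper entries minus the number of lower ones among them. Then alternation means that
$|\mathrm{balance}| + |\mathrm{skew} - s| \le 1$ everywhere, for a sign $s$ telling $\mathrm O^+$
from $\mathrm O^-$ (\<open>B_pm_iff\<close>).

The balance depends only on the pair of families, and in its family a symbol is given by the set
of singles (the entries occurring in one row only) whose row differs from that in the special
symbol. Modulo $4$ the skew only depends on the parity of the number of such flipped singles above
$p$. It follows (\<open>skew_bound_iff_lagrangian\<close>) that $\mathcal B$ is either empty on
the pair of families or given by a linear condition on the set $W$ of all flipped singles, besides
their number in $\Lambda$ being even: ordering the singles of both symbols together from the top
as $u_1 > u_2 > \dots$, the set $W$ contains both or none of $u_{2k}$ and $u_{2k+1}$. These sets
form a vector space over the field of two elements under symmetric difference, and it is its own
orthogonal space with respect to the form that defines the Fourier matrices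
(\<open>lagrangian_isotropic\<close>, \<open>lagrangian_separates\<close>). The indicator function
of such a space is its own Fourier transform.

The orthonormality of irreducible characters is deduced from Schur's lemma
(\<open>irr_chars_orthonormal\<close>).
\<close>

section \<open>Fourier transforms on the subsets of a finite set\<close>

lemma card_sym_diff:
  assumes "finite A" "finite B"
  shows "card (sym_diff A B) + 2 * card (A \<inter> B) = card A + card B"
proof -
  have "card (sym_diff A B) = card (A - B) + card (B - A)"
    using assms by (intro card_Un_disjoint) auto
  then show ?thesis
    using card_Int_Diff[OF assms(1), of B] card_Int_Diff[OF assms(2), of A] by (simp add: Int_commute)
qed

lemma even_card_sym_diff:
  assumes "finite A" "finite B"
  shows "even (card (sym_diff A B)) \<longleftrightarrow> even (card A + card B)"
  using card_sym_diff[OF assms] by presburger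

text \<open>The form on sets, modulo $2$, whose signs are the entries of the Fourier matrices of
Lusztig.\<close>

definition pairing :: "'b set \<Rightarrow> 'b set \<Rightarrow> nat" where
  "pairing v w = card v * card w + card (v \<inter> w)"

lemma pairing_commute: "pairing v w = pairing w v"
  by (simp add: pairing_def Int_commute)

lemma even_pairing_sym_diff:
  assumes "finite v" "finite w" "finite w'"
  shows "even (pairing v (sym_diff w w')) \<longleftrightarrow> even (pairing v w + pairing v w')"
proof -
  have *: "v \<inter> sym_diff w w' = sym_diff (v \<inter> w) (v \<inter> w')" by blast
  have "even (card (v \<inter> sym_diff w w')) \<longleftrightarrow> even (card (v \<inter> w) + card (v \<inter> w'))"
    unfolding * using assms by (intro even_card_sym_diff) auto
  then show ?thesis
    using even_card_sym_diff[OF assms(2,3)] by (auto simp: pairing_def)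
qed

text \<open>Adding \<open>v\<close> permutes the summands and changes all signs, as for a
nontrivial character of a group.\<close>

lemma sum_signs_eq_0:
  fixes \<beta> :: "'b set \<Rightarrow> nat"
  assumes "v \<in> K" "odd (\<beta> v)" "\<And>w. w \<in> K \<Longrightarrow> sym_diff w v \<in> K"
    and "\<And>w. w \<in> K \<Longrightarrow> even (\<beta> (sym_diff w v)) \<longleftrightarrow> even (\<beta> w + \<beta> v)"
  shows "(\<Sum>w\<in>K. (- 1) ^ \<beta> w) = (0 :: complex)"
proof -
  let ?f = "\<lambda>w. sym_diff w v"
  have bij: "bij_betw ?f K K"
    by (rule bij_betw_byWitness[where f' = ?f]) (use assms in auto)
  have "(\<Sum>w\<in>K. (- 1) ^ \<beta> w) = (\<Sum>w\<in>K. (- 1 :: complex) ^ \<beta> (?f w))"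
    by (rule sum.reindex_bij_betw[OF bij, symmetric])
  also have "\<dots> = (\<Sum>w\<in>K. - ((- 1) ^ \<beta> w))"
    using assms(2,4) by (intro sum.cong refl) (simp add: minus_one_power_iff)
  also have "\<dots> = - (\<Sum>w\<in>K. (- 1) ^ \<beta> w)" by (simp add: sum_negf)
  finally show ?thesis by simp
qed

text \<open>The subsets that index a family of symbols with singles \<open>T\<close>: for an odd
number of singles, that is odd defect, only an even number of them may change rows.\<close>

definition swap_sets :: "'b set \<Rightarrow> 'b set set" where
  "swap_sets T = {w. w \<subseteq> T \<and> (odd (card T) \<longrightarrow> even (card w))}"

text \<open>If \<open>T\<close> is odd, and hence not empty, then half of its subsets are even.\<close>

lemma card_swap_sets:
  assumes "finite T"
  shows "card (swap_sets T) = 4 ^ (card T div 2)"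
proof (cases "even (card T)")
  case True
  then have "swap_sets T = Pow T" by (auto simp: swap_sets_def)
  moreover obtain k where "card T = 2 * k" using True by blast
  ultimately show ?thesis using assms by (simp add: card_Pow power_mult)
next
  case False
  then obtain t where t: "t \<in> T" by fastforce
  have sw: "swap_sets T = {w. w \<subseteq> T \<and> even (card w)}" using False by (auto simp: swap_sets_def)
  have fin: "finite w" if "w \<subseteq> T" for w using that assms finite_subset by blast
  have "(\<Sum>w\<in>Pow T. (- 1) ^ card w) = (0 :: complex)"
  proof (rule sum_signs_eq_0[of "{t}"])
    fix w assume w: "w \<in> Pow T"
    then show "even (card (sym_diff w {t})) = even (card w + card {t})"
      using even_card_sym_diff[of w "{t}"] fin by blast
  qed (use t in auto)
  also have "(\<Sum>w\<in>Pow T. (- 1) ^ card w)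
      = (\<Sum>w\<in>Pow T. (if even (card w) then 1 else 0) - (if odd (card w) then 1 else 0 :: complex))"
    by (intro sum.cong) (auto simp: minus_one_power_iff)
  also have "\<dots> = of_nat (card {w\<in>Pow T. even (card w)}) - of_nat (card {w\<in>Pow T. odd (card w)})"
    using assms by (simp add: sum_subtractf sum.If_cases Int_def)
  finally have eq: "card {w\<in>Pow T. even (card w)} = card {w\<in>Pow T. odd (card w)}" by simp
  have "card (Pow T) = card ({w\<in>Pow T. even (card w)} \<union> {w\<in>Pow T. odd (card w)})"
    by (rule arg_cong[of _ _ card]) auto
  also have "\<dots> = card {w\<in>Pow T. even (card w)} + card {w\<in>Pow T. odd (card w)}"
    using assms by (intro card_Un_disjoint) auto
  finally have "2 ^ card T = 2 * card (swap_sets T)" using eq assms by (simp add: sw card_Pow)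
  moreover obtain k where "card T = 2 * k + 1" using False oddE by blast
  ultimately show ?thesis by (simp add: power_mult)
qed

text \<open>A set of one element detects \<open>v\<close> if \<open>T\<close> is even, where the
element lies inside or outside of \<open>v\<close> depending on the parity of \<open>v\<close>; if
\<open>T\<close> is odd, a pair with one element inside and one outside does.\<close>

lemma pairing_nondegenerate:
  assumes T: "finite T" and v: "v \<in> swap_sets T" "v \<noteq> {}"
  obtains u where "u \<in> swap_sets T" "odd (pairing v u)"
proof -
  have vT: "v \<subseteq> T" "finite v" using v T finite_subset by (auto simp: swap_sets_def)
  have neq: "v \<noteq> T" if "odd (card v + card T)" using that by auto
  show ?thesis
  proof (cases "even (card T)")
    case True
    show ?thesis
    proof (cases "even (card v)")
      case even: True
      obtain x where "x \<in> v" using v by blast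
      then show ?thesis using that[of "{x}"] True even vT by (auto simp: swap_sets_def pairing_def)
    next
      case False
      obtain x where "x \<in> T" "x \<notin> v" using neq True False vT by auto
      then show ?thesis using that[of "{x}"] True False by (auto simp: swap_sets_def pairing_def)
    qed
  next
    case False
    then have ev: "even (card v)" using v by (auto simp: swap_sets_def)
    obtain x where x: "x \<in> v" using v by blast
    obtain y where y: "y \<in> T" "y \<notin> v" using neq ev False vT by auto
    have "v \<inter> {x, y} = {x}" "card {x, y} = 2" using x y by (auto simp: card_insert_if)
    then show ?thesis using that[of "{x, y}"] x y vT ev by (auto simp: swap_sets_def pairing_def)
  qed
qed

lemma swap_sets_sym_diff:
  assumes "finite T" "v \<in> swap_sets T" "w \<in> swap_sets T"
  shows "sym_diff v w \<in> swap_sets T"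
proof -
  have "finite v" "finite w" using assms finite_subset by (auto simp: swap_sets_def)
  then show ?thesis using assms even_card_sym_diff[of v w] by (auto simp: swap_sets_def)
qed

lemma pairing_orthogonality:
  assumes T: "finite T" and v: "v \<in> swap_sets T" and w: "w \<in> swap_sets T"
  shows "(\<Sum>u\<in>swap_sets T. (- 1) ^ pairing v u * (- 1) ^ pairing w u)
    = (if v = w then 4 ^ (card T div 2) else 0 :: complex)"
proof -
  let ?d = "sym_diff v w"
  have fin: "finite u" if "u \<in> swap_sets T" for u
    using that T finite_subset by (auto simp: swap_sets_def)
  have "(\<Sum>u\<in>swap_sets T. (- 1) ^ pairing v u * (- 1) ^ pairing w u)
      = (\<Sum>u\<in>swap_sets T. (- 1 :: complex) ^ pairing ?d u)"
  proof (rule sum.cong[OF refl])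
    fix u assume u: "u \<in> swap_sets T"
    have "even (pairing ?d u) = even (pairing v u + pairing w u)"
      using even_pairing_sym_diff[of u v w] fin u v w by (simp add: pairing_commute)
    then show "(- 1) ^ pairing v u * (- 1) ^ pairing w u = (- 1 :: complex) ^ pairing ?d u"
      by (simp add: minus_one_power_iff)
  qed
  also have "\<dots> = (if v = w then 4 ^ (card T div 2) else 0)"
  proof (cases "v = w")
    case True
    then show ?thesis using card_swap_sets[OF T] by (simp add: pairing_def)
  next
    case False
    then have "?d \<noteq> {}" by blast
    from pairing_nondegenerate[OF T swap_sets_sym_diff[OF T v w] this]
    obtain u where u: "u \<in> swap_sets T" "odd (pairing ?d u)" .
    have "(\<Sum>u\<in>swap_sets T. (- 1 :: complex) ^ pairing ?d u) = 0"
    proof (rule sum_signs_eq_0[where v = u and \<beta> = "pairing ?d"])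
      show "u \<in> swap_sets T" "odd (pairing ?d u)" by fact+
    next
      fix x assume x: "x \<in> swap_sets T"
      show "sym_diff x u \<in> swap_sets T" using swap_sets_sym_diff[OF T x u(1)] .
      show "even (pairing ?d (sym_diff x u)) = even (pairing ?d x + pairing ?d u)"
        using fin[OF v] fin[OF w] fin[OF x] fin[OF u(1)] by (intro even_pairing_sym_diff) auto
    qed
    then show ?thesis using False by simp
  qed
  finally show ?thesis .
qed

section \<open>A self-dual space of subsets\<close>

definition upper :: "int set \<Rightarrow> int \<Rightarrow> int set" where
  "upper W p = {u \<in> W. p \<le> u}"

text \<open>If $u_1 > u_2 > \dots$ are the elements of \<open>U\<close>, then an odd number of
them is at least \<open>p\<close> exactly when \<open>p\<close> separates some $u_{2k+1}$ from the
elements after it. Hence the last condition says that \<open>W\<close> contains both or none of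
$u_{2k}$ and $u_{2k+1}$, for all $k \ge 1$. Stating it through counting avoids the enumeration of
\<open>U\<close> and is the form in which the condition arises from symbols. The even and the odd
elements of \<open>U\<close> stand for the singles of the two symbols.\<close>

definition lagrangian :: "int set \<Rightarrow> int set set" where
  "lagrangian U = {W. W \<subseteq> U \<and> even (card {u \<in> W. even u}) \<and>
     (\<forall>p q. odd (card (upper U p)) \<and> odd (card (upper U q)) \<longrightarrow>
        (even (card (upper W p)) \<longleftrightarrow> even (card (upper W q))))}"

lemma upper_step: "upper W p = (if p \<in> W then insert p (upper W (p + 1)) else upper W (p + 1))"
  by (auto simp: upper_def) (metis order_le_less zless_imp_add1_zle)+

lemma card_upper_step:
  assumes "finite W"
  shows "card (upper W p) = card (upper W (p + 1)) + (if p \<in> W then 1 else 0)"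
proof -
  have "finite (upper W (p + 1))" "p \<notin> upper W (p + 1)" using assms by (auto simp: upper_def)
  then show ?thesis using upper_step[of W p] by auto
qed

lemma upper_above:
  assumes "finite U" obtains P where "\<And>p W. p \<ge> P \<Longrightarrow> W \<subseteq> U \<Longrightarrow> upper W p = {}"
proof
  fix p W assume p: "p \<ge> Max (insert 0 U) + 1" and W: "W \<subseteq> U"
  have "\<not> p \<le> u" if "u \<in> W" for u
  proof -
    have "u \<le> Max (insert 0 U)" using assms that W by (intro Max_ge) auto
    then show ?thesis using p by linarith
  qed
  then show "upper W p = {}" unfolding upper_def by blast
qed

lemma upper_below:
  assumes "finite U" obtains P where "\<And>p W. p \<le> P \<Longrightarrow> W \<subseteq> U \<Longrightarrow> upper W p = W"
proof
  fix p W assume p: "p \<le> Min (insert 0 U)" and W: "W \<subseteq> U"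
  have "p \<le> u" if "u \<in> W" for u
  proof -
    have "Min (insert 0 U) \<le> u" using assms that W by (intro Min_le) auto
    then show ?thesis using p by linarith
  qed
  then show "upper W p = W" unfolding upper_def by blast
qed

lemma int_downward_induct:
  fixes P :: "int \<Rightarrow> bool"
  assumes "\<And>q. q \<ge> b \<Longrightarrow> P q" "\<And>q. P (q + 1) \<Longrightarrow> P q"
  shows "P p"
proof (cases "p \<ge> b")
  case False
  then have "p \<le> b" by simp
  then show ?thesis
  proof (induction p rule: int_le_induct)
    case (step i)
    then show ?case using assms(2)[of "i - 1"] by simp
  qed (use assms in simp)
qed (use assms in simp)

text \<open>Below all elements of \<open>U\<close> the count is the odd number \<open>card
U\<close>, so that the common parity of the counts for \<open>W\<close> is the parity of
\<open>W\<close> itself.\<close>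

lemma lagrangian_odd_card:
  assumes U: "finite U" "odd (card U)" and W: "W \<in> lagrangian U" and p: "odd (card (upper U p))"
  shows "odd (card (upper W p)) \<longleftrightarrow> odd (card W)"
proof -
  obtain P where P: "\<And>p W. p \<le> P \<Longrightarrow> W \<subseteq> U \<Longrightarrow> upper W p = W" using upper_below[OF U(1)] by blast
  have "upper U P = U" "upper W P = W" using P W by (auto simp: lagrangian_def)
  then show ?thesis using W p U unfolding lagrangian_def by (metis (mono_tags, lifting) mem_Collect_eq)
qed

text \<open>Both sets, and hence $v \cap w$, consist of pairs $\{u_{2k}, u_{2k+1}\}$ and possibly
$u_1$, so that the parities of all three are determined by $u_1$. This is proved by going down the
line: with $a, b$ the parities of $v$ and $w$, and $v_p, w_p, (v \cap w)_p$ those of the parts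
from $p$ upwards, the invariant is $(v \cap w)_p = a b + (v_p + a)(w_p + b)$.\<close>

lemma lagrangian_isotropic:
  assumes U: "finite U" "odd (card U)" and v: "v \<in> lagrangian U" and w: "w \<in> lagrangian U"
  shows "even (pairing v w)"
proof -
  let ?o = "\<lambda>K p. odd (card (upper K p))"
  let ?a = "odd (card v)" and ?b = "odd (card w)"
  have sub: "v \<subseteq> U" "w \<subseteq> U" using v w by (auto simp: lagrangian_def)
  then have fin: "finite v" "finite w" "finite (v \<inter> w)"
    using U(1) finite_subset[of v U] finite_subset[of w U] by auto
  have main: "?o (v \<inter> w) p \<longleftrightarrow> (?a \<and> ?b) \<noteq> ((?o v p \<noteq> ?a) \<and> (?o w p \<noteq> ?b))" for p
  proof -
    obtain P where P: "\<And>p W. p \<ge> P \<Longrightarrow> W \<subseteq> U \<Longrightarrow> upper W p = {}" using upper_above[OF U(1)] by blast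
    show ?thesis
    proof (induction p rule: int_downward_induct[of P])
      case (1 q)
      have "v \<inter> w \<subseteq> U" using sub by blast
      then show ?case using P[OF 1] sub by simp
    next
      case (2 q)
      have st: "?o K q \<longleftrightarrow> (?o K (q + 1) \<noteq> (q \<in> K))" if "finite K" for K
        using card_upper_step[OF that, of q] by simp
      show ?case
      proof (cases "q \<in> U")
        case False
        then have "q \<notin> v" "q \<notin> w" using sub by auto
          then show ?thesis using 2 st[OF fin(1)] st[OF fin(2)] st[OF fin(3)] by simp
      next
        case True
        then have "?o U q \<noteq> ?o U (q + 1)" using st[OF U(1)] by simp
        then consider "?o U q" "\<not> ?o U (q + 1)" | "?o U (q + 1)" "\<not> ?o U q" by blast
        then show ?thesis
        proof cases
          case 1
          then have "?o v q = ?a" "?o w q = ?b" using lagrangian_odd_card U v w by blast+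
          then show ?thesis using 2 st[OF fin(1)] st[OF fin(2)] st[OF fin(3)] by auto
        next
          case c: 2
          then have "?o v (q + 1) = ?a" "?o w (q + 1) = ?b" using lagrangian_odd_card U v w by blast+
          then show ?thesis using 2 st[OF fin(1)] st[OF fin(2)] st[OF fin(3)] by auto
        qed
      qed
    qed
  qed
  obtain P where P: "\<And>p W. p \<le> P \<Longrightarrow> W \<subseteq> U \<Longrightarrow> upper W p = W"
    using upper_below[OF U(1)] by blast
  have "v \<inter> w \<subseteq> U" using sub by blast
  then have "odd (card (v \<inter> w)) \<longleftrightarrow> ?a \<and> ?b"
    using main[of P] P[OF order_refl] sub by simp
  then show ?thesis by (auto simp: pairing_def)
qed

text \<open>If \<open>v\<close> violates the defining condition of \<open>lagrangian\<close>
between two cuts \<open>p\<close> and \<open>q\<close>, then the elements of \<open>U\<close>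
between them form a set \<open>P\<close> which satisfies this condition and meets \<open>v\<close>
in an odd number of elements. If \<open>P\<close> has an odd number of even elements, it is
replaced by its complement.\<close>

lemma lagrangian_separates:
  assumes U: "finite U" "odd (card {u \<in> U. even u})" "even (card {u \<in> U. odd u})"
    and v: "v \<subseteq> U" "even (card {u \<in> v. even u})" "v \<notin> lagrangian U"
  obtains w where "w \<in> lagrangian U" "odd (pairing v w)"
proof -
  let ?o = "\<lambda>K p. odd (card (upper K p))"
  have fin: "finite K" if "K \<subseteq> U" for K using that U finite_subset by blast
  have "card U = card ({u \<in> U. even u} \<union> {u \<in> U. odd u})" by (rule arg_cong[of _ _ card]) auto
  also have "\<dots> = card {u \<in> U. even u} + card {u \<in> U. odd u}"
    using U by (intro card_Un_disjoint) auto
  finally have oU: "odd (card U)" using U by simp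
  from v obtain p q where "?o U p" "?o U q" "?o v p \<noteq> ?o v q" by (auto simp: lagrangian_def)
  then obtain p q where pq: "p \<le> q" "?o U p" "?o U q" "?o v p \<noteq> ?o v q" by (metis linear)
  define P where "P = {u \<in> U. p \<le> u \<and> u < q}"
  have PU: "P \<subseteq> U" by (auto simp: P_def)
  \<comment> \<open>Cutting at \<open>p\<close> and at \<open>q\<close> differs exactly by \<open>P\<close>.\<close>
  have cut: "card (upper K p) = card (K \<inter> P) + card (upper K q)" if "K \<subseteq> U" for K
  proof -
    have "upper K p = (K \<inter> P) \<union> upper K q" using that pq(1) by (auto simp: upper_def P_def)
    then show ?thesis using fin[OF that]
      by (simp add: card_Un_disjoint upper_def P_def disjoint_iff)
  qed
  have eP: "even (card P)" using cut[of U] pq PU by (simp add: Int_absorb1)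
  have ovP: "odd (card (v \<inter> P))" using cut[OF v(1)] pq by presburger
  have upP: "even (card (upper P r))" if r: "?o U r" for r
  proof -
    consider "r \<le> p" | "p \<le> r" "r \<le> q" | "q \<le> r" by linarith
    then show ?thesis
    proof cases
      case 1
      then have "upper P r = P" by (auto simp: upper_def P_def)
      then show ?thesis using eP by simp
    next
      case 2
      then have "upper U r = upper P r \<union> upper U q" by (auto simp: upper_def P_def)
      moreover have "card (upper P r \<union> upper U q) = card (upper P r) + card (upper U q)"
        using fin[OF PU] U by (intro card_Un_disjoint) (auto simp: upper_def P_def)
      ultimately show ?thesis using r pq by simp
    next
      case 3
      then have "upper P r = {}" by (auto simp: upper_def P_def)
      then show ?thesis by simp
    qed
  qed
  have diff: "card {u \<in> K - Y. R u} + card {u \<in> Y. R u} = card {u \<in> K. R u}"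
    if "Y \<subseteq> K" "K \<subseteq> U" for K Y R
  proof -
    have "{u \<in> K. R u} = {u \<in> K - Y. R u} \<union> {u \<in> Y. R u}" using that by blast
    then show ?thesis using that fin[of K] fin[of Y] by (simp add: card_Un_disjoint disjoint_iff)
  qed
  show ?thesis
  proof (cases "even (card {u \<in> P. even u})")
    case True
    then have "P \<in> lagrangian U" using PU upP by (simp add: lagrangian_def)
    moreover have "odd (pairing v P)" using eP ovP by (simp add: pairing_def)
    ultimately show ?thesis by (rule that)
  next
    case False
    have a: "card (upper (U - P) r) + card (upper P r) = card (upper U r)" for r
      using diff[OF PU order_refl, of "\<lambda>u. r \<le> u"] by (simp add: upper_def)
    have c: "odd (card (upper (U - P) r))" if "?o U r" for r using upP[OF that] that a[of r] by presburger
    have "even (card {u \<in> U - P. even u})" using diff[OF PU order_refl, of even] False U by presburger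
    then have "U - P \<in> lagrangian U" using c by (simp add: lagrangian_def)
    moreover have "card (U - P) + card P = card U"
      using card_Diff_subset[OF fin[OF PU] PU] card_mono[OF U(1) PU] by simp
    then have "odd (card (U - P))" using eP oU by presburger
    moreover have "card (v \<inter> (U - P)) + card (v \<inter> P) = card v"
    proof -
      have "v \<inter> (U - P) = v - v \<inter> P" using v(1) by blast
      then show ?thesis using fin[OF v(1)]
        by (simp add: card_Diff_subset card_mono)
    qed
    then have "even (card v) \<longleftrightarrow> odd (card (v \<inter> (U - P)))" using ovP by presburger
    ultimately show ?thesis using that[of "U - P"] by (auto simp: pairing_def)
  qed
qed

lemma card_even_odd_split:
  assumes "finite (U :: int set)"
  shows "card U = card {u \<in> U. even u} + card {u \<in> U. odd u}"
proof -
  have "U = {u \<in> U. even u} \<union> {u \<in> U. odd u}" by auto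
  moreover have "card ({u \<in> U. even u} \<union> {u \<in> U. odd u}) = card {u \<in> U. even u} + card {u \<in> U. odd u}"
    using assms by (intro card_Un_disjoint) auto
  ultimately show ?thesis by simp
qed

lemma lagrangian_sym_diff:
  assumes U: "finite U" and v: "v \<in> lagrangian U" and w: "w \<in> lagrangian U"
  shows "sym_diff v w \<in> lagrangian U"
proof -
  have sub: "v \<subseteq> U" "w \<subseteq> U" using v w by (auto simp: lagrangian_def)
  then have fin: "finite v" "finite w" using U finite_subset by auto
  have "{u \<in> sym_diff v w. R u} = sym_diff {u \<in> v. R u} {u \<in> w. R u}" for R by auto
  then have "even (card {u \<in> sym_diff v w. R u}) = even (card {u \<in> v. R u} + card {u \<in> w. R u})" for R
    using even_card_sym_diff[of "{u \<in> v. R u}" "{u \<in> w. R u}"] fin by simp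
  note ev = this
  show ?thesis unfolding lagrangian_def upper_def
  proof (intro CollectI conjI allI impI)
    show "sym_diff v w \<subseteq> U" using sub by blast
    show "even (card {u \<in> sym_diff v w. even u})" using ev[of even] v w by (simp add: lagrangian_def)
    fix p q assume "odd (card {u \<in> U. p \<le> u}) \<and> odd (card {u \<in> U. q \<le> u})"
    then have "even (card {u \<in> v. p \<le> u}) = even (card {u \<in> v. q \<le> u})"
      "even (card {u \<in> w. p \<le> u}) = even (card {u \<in> w. q \<le> u})"
      using v w by (simp_all add: lagrangian_def upper_def)
    then show "even (card {u \<in> sym_diff v w. p \<le> u}) = even (card {u \<in> sym_diff v w. q \<le> u})"
      unfolding ev by simp
  qed
qed

text \<open>The ambient space, for a family of odd defect on the even positions and one of even
defect on the odd positions: only in the former is the number of flips restricted.\<close>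

definition even_sets :: "int set \<Rightarrow> int set set" where
  "even_sets U = {W. W \<subseteq> U \<and> even (card {u \<in> W. even u})}"

lemma lagrangian_subset: "lagrangian U \<subseteq> even_sets U"
  by (auto simp: lagrangian_def even_sets_def)

lemma even_sets_sym_diff:
  assumes U: "finite U" and v: "v \<in> even_sets U" and w: "w \<in> even_sets U"
  shows "sym_diff v w \<in> even_sets U"
proof -
  have sub: "v \<subseteq> U" "w \<subseteq> U" using v w by (auto simp: even_sets_def)
  then have fin: "finite v" "finite w" using U finite_subset by auto
  have "{u \<in> sym_diff v w. even u} = sym_diff {u \<in> v. even u} {u \<in> w. even u}" by auto
  then have "even (card {u \<in> sym_diff v w. even u}) = even (card {u \<in> v. even u} + card {u \<in> w. even u})"
    using even_card_sym_diff[of "{u \<in> v. even u}" "{u \<in> w. even u}"] fin by simp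
  then show ?thesis using v w sub by (auto simp: even_sets_def)
qed

lemma even_sets_nondegenerate:
  assumes U: "finite U" "odd (card {u \<in> U. even u})" "even (card {u \<in> U. odd u})"
    and w: "w \<in> even_sets U" "w \<noteq> {}"
  obtains v where "v \<in> even_sets U" "odd (pairing w v)"
proof (cases "{u \<in> w. even u} = {}")
  case False
  then obtain x where x: "x \<in> w" "even x" by blast
  have "{u \<in> w. even u} \<noteq> {u \<in> U. even u}" using U w unfolding even_sets_def by force
  then obtain y where y: "y \<in> U" "even y" "y \<notin> w" using w unfolding even_sets_def by blast
  have "{u \<in> {x, y}. even u} = {x, y}" using x y by auto
  moreover have "card {x, y} = 2" "w \<inter> {x, y} = {x}" using x y by (auto simp: card_insert_if)
  ultimately show ?thesis using that[of "{x, y}"] x y w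
    by (auto simp: even_sets_def pairing_def)
next
  case True
  then have wo: "w \<subseteq> {u \<in> U. odd u}" using w by (auto simp: even_sets_def)
  have sing: "{x} \<in> even_sets U" if "x \<in> {u \<in> U. odd u}" for x
  proof -
    have "{u \<in> {x}. even u} = {}" using that by auto
    then have "even (card {u \<in> {x}. even u})" by (simp only: card.empty dvd_0_right)
    moreover have "{x} \<subseteq> U" using that by simp
    ultimately show ?thesis unfolding even_sets_def by (intro CollectI conjI)
  qed
  show ?thesis
  proof (cases "even (card w)")
    case True
    obtain x where x: "x \<in> w" using w by blast
    have "odd (pairing w {x})" using x True by (simp add: pairing_def)
    moreover have "{x} \<in> even_sets U" using sing wo x by blast
    ultimately show ?thesis using that by blast
  next
    case False
    then have "w \<noteq> {u \<in> U. odd u}" using U by auto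
    then obtain x where x: "x \<in> {u \<in> U. odd u}" "x \<notin> w" using wo by blast
    have "odd (pairing w {x})" using x False by (simp add: pairing_def)
    then show ?thesis using that sing[OF x(1)] by blast
  qed
qed

lemma fourier_lagrangian_card:
  assumes U: "finite U" "odd (card {u \<in> U. even u})" "even (card {u \<in> U. odd u})"
    and v: "v \<in> even_sets U"
  shows "(\<Sum>w\<in>lagrangian U. (- 1) ^ pairing v w) = (if v \<in> lagrangian U then of_nat (card (lagrangian U)) else 0 :: complex)"
proof -
  have oU: "odd (card U)" using U card_even_odd_split[of U] by simp
  have fin: "finite x" if "x \<in> even_sets U" for x
    using that U finite_subset by (auto simp: even_sets_def)
  show ?thesis
  proof (cases "v \<in> lagrangian U")
    case True
    have "(\<Sum>w\<in>lagrangian U. (- 1) ^ pairing v w) = (\<Sum>w\<in>lagrangian U. 1 :: complex)"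
      by (rule sum.cong[OF refl]) (use lagrangian_isotropic[OF U(1) oU True] in simp)
    then show ?thesis using True by simp
  next
    case False
    then obtain u where u: "u \<in> lagrangian U" "odd (pairing v u)"
      using lagrangian_separates[OF U, of v] v by (auto simp: even_sets_def)
    have "(\<Sum>w\<in>lagrangian U. (- 1 :: complex) ^ pairing v w) = 0"
    proof (rule sum_signs_eq_0[where v = u and \<beta> = "pairing v"])
      fix x assume x: "x \<in> lagrangian U"
      show "sym_diff x u \<in> lagrangian U" using lagrangian_sym_diff[OF U(1) x u(1)] .
      show "even (pairing v (sym_diff x u)) = even (pairing v x + pairing v u)"

        by (rule even_pairing_sym_diff) (use fin v x u(1) lagrangian_subset[of U] in blast)+
    qed (use u in auto)
    then show ?thesis using False by simp
  qed
qed

text \<open>Double counting of the signs of all pairs from the space and the ambient space: by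
\<open>fourier_lagrangian_card\<close> summed one way, and by nondegeneracy summed the other way.\<close>

lemma card_lagrangian:
  assumes U: "finite U" "odd (card {u \<in> U. even u})" "even (card {u \<in> U. odd u})"
  shows "card (lagrangian U) * card (lagrangian U) = card (even_sets U)"
proof -
  have fin: "finite x" if "x \<in> even_sets U" for x
    using that U finite_subset by (auto simp: even_sets_def)
  have finE: "finite (even_sets U)"
    by (rule finite_subset[of _ "Pow U"]) (use U in \<open>auto simp: even_sets_def\<close>)
  have finL: "finite (lagrangian U)" using finite_subset[OF lagrangian_subset finE] .
  have empty: "{} \<in> lagrangian U" by (simp add: lagrangian_def upper_def)
  have "(\<Sum>v\<in>even_sets U. \<Sum>w\<in>lagrangian U. (- 1 :: complex) ^ pairing v w)
     = (\<Sum>v\<in>even_sets U. if v \<in> lagrangian U then of_nat (card (lagrangian U)) else 0)"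
    by (rule sum.cong[OF refl]) (rule fourier_lagrangian_card[OF U])
  also have "\<dots> = (\<Sum>v\<in>lagrangian U. of_nat (card (lagrangian U)))"
    by (rule sum.mono_neutral_cong_right[OF finE lagrangian_subset]) auto
  also have "\<dots> = of_nat (card (lagrangian U) * card (lagrangian U))" by simp
  finally have 1: "(\<Sum>v\<in>even_sets U. \<Sum>w\<in>lagrangian U. (- 1 :: complex) ^ pairing v w)
     = of_nat (card (lagrangian U) * card (lagrangian U))" .
  have "(\<Sum>w\<in>lagrangian U. \<Sum>v\<in>even_sets U. (- 1 :: complex) ^ pairing v w)
     = (\<Sum>w\<in>lagrangian U. if w = {} then of_nat (card (even_sets U)) else 0)"
  proof (rule sum.cong[OF refl])
    fix w assume w: "w \<in> lagrangian U"
    show "(\<Sum>v\<in>even_sets U. (- 1 :: complex) ^ pairing v w)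
        = (if w = {} then of_nat (card (even_sets U)) else 0)"
    proof (cases "w = {}")
      case False
      have wE: "w \<in> even_sets U" using w lagrangian_subset by blast
      obtain u where u: "u \<in> even_sets U" "odd (pairing w u)"
        by (rule even_sets_nondegenerate[OF U wE False])
      have "(\<Sum>v\<in>even_sets U. (- 1 :: complex) ^ pairing w v) = 0"
      proof (rule sum_signs_eq_0[where v = u and \<beta> = "pairing w"])
        fix x assume x: "x \<in> even_sets U"
        show "sym_diff x u \<in> even_sets U" using even_sets_sym_diff[OF U(1) x u(1)] .
        show "even (pairing w (sym_diff x u)) = even (pairing w x + pairing w u)"

            by (rule even_pairing_sym_diff) (use fin x u(1) wE in blast)+
      qed (use u in auto)
      then show ?thesis using False by (simp add: pairing_commute)
    qed (simp add: pairing_def)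
  qed
  also have "\<dots> = of_nat (card (even_sets U))" using finL empty by simp
  finally have 2: "(\<Sum>w\<in>lagrangian U. \<Sum>v\<in>even_sets U. (- 1 :: complex) ^ pairing v w)
     = of_nat (card (even_sets U))" .
  have "(of_nat (card (lagrangian U) * card (lagrangian U)) :: complex) = of_nat (card (even_sets U))"
    unfolding 1[symmetric] 2[symmetric] by (rule sum.swap)
  then show ?thesis by (simp only: of_nat_eq_iff)
qed

section \<open>Rows of symbols and their counting functions\<close>

text \<open>All negative numbers are counted as additional entries of the row. Then equivalent
symbols have the same counting functions up to translation, and conditions on the partitions of
the rows, which are padded with zeros, need no treatment of the ends.\<close>

definition cnt :: "nat set \<Rightarrow> int \<Rightarrow> nat" where
  "cnt A x = card {a \<in> A. x \<le> int a} + nat (- x)"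

text \<open>The entries of the row in decreasing order, continued by the negative numbers.\<close>

definition row_entry :: "nat set \<Rightarrow> nat \<Rightarrow> int" where
  "row_entry A i = int (row_partition A i) + int (card A) - 1 - int i"

definition tally :: "nat set \<Rightarrow> int \<Rightarrow> nat" where
  "tally T x = card {t \<in> T. x \<le> int t}"

lemma tally_step:
  assumes "finite T"
  shows "tally T x = tally T (x + 1) + (if x \<ge> 0 \<and> nat x \<in> T then 1 else 0)"
proof -
  have "{a \<in> T. x \<le> int a} = (if x \<ge> 0 \<and> nat x \<in> T then insert (nat x) {a \<in> T. x + 1 \<le> int a} else {a \<in> T. x + 1 \<le> int a})"
  proof (rule Set.set_eqI)
    fix a
    have "x = int a \<or> x + 1 \<le> int a \<or> int a < x" by linarith
    then show "a \<in> {a \<in> T. x \<le> int a} \<longleftrightarrow> a \<in> (if x \<ge> 0 \<and> nat x \<in> T then insert (nat x) {a \<in> T. x + 1 \<le> int a} else {a \<in> T. x + 1 \<le> int a})"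
      by auto
  qed
  then show ?thesis using assms by (auto simp: tally_def)
qed

lemma cnt_step:
  assumes "finite A"
  shows "cnt A x = cnt A (x + 1) + (if x < 0 \<or> nat x \<in> A then 1 else 0)"
  using tally_step[OF assms, of x] by (auto simp: cnt_def tally_def)

lemma desc_props:
  assumes "finite A"
  shows "length (desc A) = card A" "set (desc A) = A" "sorted_wrt (>) (desc A)"
  using assms by (auto simp: desc_def sorted_wrt_rev)

text \<open>The positions of the entries that are at least \<open>x\<close> form an initial
segment, whose length is the number of these entries.\<close>

lemma desc_ge_iff:
  assumes A: "finite A" and i: "i < card A"
  shows "x \<le> int (desc A ! i) \<longleftrightarrow> i < card {a \<in> A. x \<le> int a}"
proof -
  let ?d = "desc A" and ?J = "{j. j < card A \<and> x \<le> int (desc A ! j)}"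
  note d = desc_props[OF A]
  have mono: "?d ! k < ?d ! j" if "j < k" "k < card A" for j k
    using d(3) that d(1) by (auto simp: sorted_wrt_iff_nth_less)
  have inj: "inj_on (nth ?d) ?J"
    using d(1) assms by (intro inj_on_nth) (auto simp: desc_def)
  have "{a \<in> A. x \<le> int a} = nth ?d ` ?J"
  proof
    show "{a \<in> A. x \<le> int a} \<subseteq> nth ?d ` ?J"
    proof
      fix a assume a: "a \<in> {a \<in> A. x \<le> int a}"
      then have "a \<in> set ?d" using d(2) by simp
      then obtain j where "j < length ?d" "?d ! j = a" unfolding in_set_conv_nth by blast
      then show "a \<in> nth ?d ` ?J" using a d(1) by force
    qed
    show "nth ?d ` ?J \<subseteq> {a \<in> A. x \<le> int a}"
    proof
      fix a assume "a \<in> nth ?d ` ?J"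
      then obtain j where j: "j < card A" "x \<le> int (?d ! j)" "a = ?d ! j" by blast
      then have "?d ! j \<in> set ?d" using d(1) by (intro nth_mem) simp
      then show "a \<in> {a \<in> A. x \<le> int a}" using j d(2) by simp
    qed
  qed
  then have card: "card {a \<in> A. x \<le> int a} = card ?J" using card_image[OF inj] by simp
  show ?thesis
  proof
    assume x: "x \<le> int (?d ! i)"
    have "{..i} \<subseteq> ?J"
    proof
      fix j assume "j \<in> {..i}"
      then have "?d ! i \<le> ?d ! j" "j < card A" using mono[of j i] i by (cases "j = i"; simp)+
      then show "j \<in> ?J" using x by simp
    qed
    then have "card {..i} \<le> card ?J" by (intro card_mono) auto
    then show "i < card {a \<in> A. x \<le> int a}" using card by simp
  next
    assume lt: "i < card {a \<in> A. x \<le> int a}"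
    show "x \<le> int (?d ! i)"
    proof (rule ccontr)
      assume n: "\<not> x \<le> int (?d ! i)"
      have "?J \<subseteq> {..<i}"
      proof
        fix j assume j: "j \<in> ?J"
        show "j \<in> {..<i}"
        proof (rule ccontr)
          assume "j \<notin> {..<i}"
          then have "?d ! j \<le> ?d ! i" using mono[of i j] j by (cases "j = i") auto
          then show False using n j by simp
        qed
      qed
      then have "card ?J \<le> card {..<i}" by (intro card_mono) auto
      then show False using lt card by simp
    qed
  qed
qed

lemma row_entry_desc:
  assumes A: "finite A" and i: "i < card A"
  shows "row_entry A i = int (desc A ! i)"
proof -
  let ?y = "desc A ! i"
  have "\<not> i < card {a \<in> A. int ?y + 1 \<le> int a}"
    using desc_ge_iff[OF A i, of "int ?y + 1"] by simp
  moreover have "card A \<le> card {a \<in> A. int ?y + 1 \<le> int a} + card {..?y}"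
  proof -
    have "A \<subseteq> {a \<in> A. int ?y + 1 \<le> int a} \<union> {..?y}" by auto
    then have "card A \<le> card ({a \<in> A. int ?y + 1 \<le> int a} \<union> {..?y})" using A by (intro card_mono) auto
    also have "\<dots> \<le> card {a \<in> A. int ?y + 1 \<le> int a} + card {..?y}" by (rule card_Un_le)
    finally show ?thesis .
  qed
  ultimately have "card A - 1 - i \<le> ?y" by simp
  then show ?thesis using i by (simp add: row_entry_def row_partition_def of_nat_diff)
qed

lemma row_entry_beyond: "i \<ge> card A \<Longrightarrow> row_entry A i = int (card A) - 1 - int i"
  by (simp add: row_entry_def row_partition_def)

lemma row_entry_ge_iff:
  assumes A: "finite A"
  shows "x \<le> row_entry A i \<longleftrightarrow> i < cnt A x"
proof (cases "i < card A")
  case True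
  show ?thesis
  proof (cases "x < 0")
    case neg: True
    then have "{a \<in> A. x \<le> int a} = A" by auto
    then show ?thesis using True neg by (simp add: row_entry_desc[OF A True] cnt_def)
  next
    case False
    then show ?thesis by (simp add: row_entry_desc[OF A True] desc_ge_iff[OF A True] cnt_def)
  qed
next
  case False
  show ?thesis
  proof (cases "x < 0")
    case neg: True
    then have "{a \<in> A. x \<le> int a} = A" by auto
    then show ?thesis using False neg by (auto simp: row_entry_beyond cnt_def)
  next
    case nn: False
    have "card {a \<in> A. x \<le> int a} \<le> card A" using A by (intro card_mono) auto
    then show ?thesis using False nn by (auto simp: row_entry_beyond cnt_def)
  qed
qed

lemma row_entry_le_iff:
  assumes "finite A" "finite B"
  shows "(\<forall>i. row_entry A i + d \<le> row_entry B i) \<longleftrightarrow> (\<forall>x. cnt A x \<le> cnt B (x + d))"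
proof safe
  fix x assume *: "\<forall>i. row_entry A i + d \<le> row_entry B i"
  have "i < cnt B (x + d)" if "i < cnt A x" for i
    using that *[rule_format, of i] row_entry_ge_iff[OF assms(1), of x i] row_entry_ge_iff[OF assms(2), of "x + d" i]
    by linarith
  then show "cnt A x \<le> cnt B (x + d)" using not_less by blast
next
  fix i assume *: "\<forall>x. cnt A x \<le> cnt B (x + d)"
  have "i < cnt A (row_entry A i)" using row_entry_ge_iff[OF assms(1)] by blast
  then have "i < cnt B (row_entry A i + d)" using * less_le_trans by blast
  then show "row_entry A i + d \<le> row_entry B i" using row_entry_ge_iff[OF assms(2)] by blast
qed

lemma row_entry_Suc_le_iff:
  assumes "finite A" "finite B"
  shows "(\<forall>i. row_entry A (Suc i) + d \<le> row_entry B i) \<longleftrightarrow> (\<forall>x. cnt A x \<le> Suc (cnt B (x + d)))"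
proof safe
  fix x assume *: "\<forall>i. row_entry A (Suc i) + d \<le> row_entry B i"
  have "i < cnt B (x + d)" if "Suc i < cnt A x" for i
    using that *[rule_format, of i] row_entry_ge_iff[OF assms(1), of x "Suc i"] row_entry_ge_iff[OF assms(2), of "x + d" i]
    by linarith
  then show "cnt A x \<le> Suc (cnt B (x + d))" by (metis not_less_eq_eq not_less order_refl)
next
  fix i assume *: "\<forall>x. cnt A x \<le> Suc (cnt B (x + d))"
  have "Suc i < cnt A (row_entry A (Suc i))" using row_entry_ge_iff[OF assms(1)] by blast
  then have "i < cnt B (row_entry A (Suc i) + d)" using *[rule_format, of "row_entry A (Suc i)"] by linarith
  then show "row_entry A (Suc i) + d \<le> row_entry B i" using row_entry_ge_iff[OF assms(2)] by blast
qed

text \<open>Passing from entries to parts of partitions subtracts the number of the remaining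
entries of the row, so that two rows of different lengths are compared after a translation by the
difference.\<close>

lemma interlaced_iff_cnt:
  assumes "finite A" "finite B"
  shows "row_partition A \<preceq>\<^sub>p row_partition B \<longleftrightarrow>
    (\<forall>x. cnt A x \<le> cnt B (x + (int (card B) - int (card A)))) \<and>
    (\<forall>x. cnt B x \<le> Suc (cnt A (x + (int (card A) - int (card B) + 1))))"
proof -
  have "row_partition A \<preceq>\<^sub>p row_partition B \<longleftrightarrow>
    (\<forall>i. row_entry A i + (int (card B) - int (card A)) \<le> row_entry B i) \<and>
    (\<forall>i. row_entry B (Suc i) + (int (card A) - int (card B) + 1) \<le> row_entry A i)"
  proof -
    have "row_partition A i \<le> row_partition B i \<longleftrightarrow>
        row_entry A i + (int (card B) - int (card A)) \<le> row_entry B i"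
      "row_partition B (Suc i) \<le> row_partition A i \<longleftrightarrow>
        row_entry B (Suc i) + (int (card A) - int (card B) + 1) \<le> row_entry A i" for i
      by (auto simp: row_entry_def)
    then show ?thesis unfolding interlaced_def by blast
  qed
  then show ?thesis using row_entry_le_iff[OF assms] row_entry_Suc_le_iff[OF assms(2,1)] by simp
qed

section \<open>Symbols described by their doubles, singles and flips\<close>

text \<open>Comparing the entries of two decreasing sequences one by one amounts to comparing
their counting functions.\<close>

lemma special_iff:
  "special Z \<longleftrightarrow> is_symbol Z \<and> defect Z \<in> {0, 1} \<and>
     (\<forall>x. cnt (snd Z) x \<le> cnt (fst Z) x \<and> cnt (fst Z) x \<le> Suc (cnt (snd Z) x))"
proof (cases "is_symbol Z \<and> defect Z \<in> {0, 1}")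
  case True
  obtain A B where Z: "Z = (A, B)" by force
  have fin: "finite A" "finite B" using True Z by (auto simp: is_symbol_def)
  note d = desc_props[OF fin(1)] desc_props[OF fin(2)]
  have def: "card A = card B \<or> card A = Suc (card B)" using True Z by (auto simp: defect_def)
  have nn: "row_entry K i \<ge> 0" if "finite K" "i < card K" for K i using row_entry_desc that by simp
  have "special Z \<longleftrightarrow> (\<forall>i < card B. desc A ! i \<ge> desc B ! i) \<and>
     (\<forall>i. Suc i < card A \<longrightarrow> desc B ! i \<ge> desc A ! Suc i)"
    using True Z d def by (auto simp: special_def Let_def defect_def)
  also have "\<dots> \<longleftrightarrow> (\<forall>i < card B. row_entry B i \<le> row_entry A i) \<and>
     (\<forall>i. Suc i < card A \<longrightarrow> row_entry A (Suc i) \<le> row_entry B i)"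
    using def by (auto simp: row_entry_desc fin)
  also have "\<dots> \<longleftrightarrow> (\<forall>i. row_entry B i + 0 \<le> row_entry A i) \<and> (\<forall>i. row_entry A (Suc i) + 0 \<le> row_entry B i)"
  proof -
    have "row_entry B i \<le> row_entry A i" if "\<not> i < card B" for i
    proof (cases "i < card A")
      case True
      then show ?thesis using nn[OF fin(1) True] that row_entry_beyond[of B i] by linarith
    next
      case False
      then show ?thesis using that def row_entry_beyond[of B i] row_entry_beyond[of A i] by linarith
    qed
    moreover have "row_entry A (Suc i) \<le> row_entry B i" if "\<not> Suc i < card A" for i
    proof (cases "i < card B")
      case True
      then show ?thesis using nn[OF fin(2) True] that row_entry_beyond[of A "Suc i"] by linarith
    next
      case False
      then show ?thesis using that def row_entry_beyond[of B i] row_entry_beyond[of A "Suc i"] by linarith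
    qed
    ultimately show ?thesis by auto
  qed
  also have "\<dots> \<longleftrightarrow> (\<forall>x. cnt B x \<le> cnt A (x + 0)) \<and> (\<forall>x. cnt A x \<le> Suc (cnt B (x + 0)))"
    using row_entry_le_iff[OF fin(2,1), of 0] row_entry_Suc_le_iff[OF fin, of 0] by simp
  finally show ?thesis using True Z by auto
qed (auto simp: special_def Let_def)

definition singles :: "symbol \<Rightarrow> nat set" where
  "singles \<Lambda> = sym_diff (fst \<Lambda>) (snd \<Lambda>)"

definition doubles :: "symbol \<Rightarrow> nat set" where
  "doubles \<Lambda> = fst \<Lambda> \<inter> snd \<Lambda>"

text \<open>The defect of the part of the symbol with entries at least \<open>x\<close>.\<close>

definition excess :: "symbol \<Rightarrow> int \<Rightarrow> int" where
  "excess \<Lambda> x = int (cnt (fst \<Lambda>) x) - int (cnt (snd \<Lambda>) x)"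

text \<open>The first, third, fifth, ... largest element of \<open>T\<close>. They are the singles
in the upper row of a special symbol with singles \<open>T\<close>.\<close>

definition alt :: "nat set \<Rightarrow> nat set" where
  "alt T = {t \<in> T. odd (tally T (int t))}"

text \<open>The set \<open>M\<close> with $\Lambda = \Lambda_M$, with its two rows united.\<close>

definition flips :: "symbol \<Rightarrow> nat set" where
  "flips \<Lambda> = {t \<in> singles \<Lambda>. (t \<in> fst \<Lambda>) \<noteq> (t \<in> alt (singles \<Lambda>))}"

definition symbol_of :: "nat set \<Rightarrow> nat set \<Rightarrow> nat set \<Rightarrow> symbol" where
  "symbol_of D T v = (D \<union> {t \<in> T. (t \<in> v) \<noteq> (t \<in> alt T)}, D \<union> {t \<in> T. (t \<in> v) = (t \<in> alt T)})"

lemma symbol_of_flips: "symbol_of (doubles \<Lambda>) (singles \<Lambda>) (flips \<Lambda>) = \<Lambda>"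
  by (cases \<Lambda>) (auto simp: symbol_of_def doubles_def singles_def flips_def)

lemma symbol_of_inverse:
  assumes "D \<inter> T = {}" "v \<subseteq> T"
  shows "doubles (symbol_of D T v) = D" "singles (symbol_of D T v) = T" "flips (symbol_of D T v) = v"
proof -
  show "doubles (symbol_of D T v) = D" by (auto simp: doubles_def symbol_of_def)
  show T: "singles (symbol_of D T v) = T" using assms by (auto simp: singles_def symbol_of_def)
  show "flips (symbol_of D T v) = v" unfolding flips_def T using assms by (auto simp: symbol_of_def)
qed

lemma doubles_singles_disjoint: "doubles \<Lambda> \<inter> singles \<Lambda> = {}"
  by (auto simp: doubles_def singles_def)

lemma flips_subset: "flips \<Lambda> \<subseteq> singles \<Lambda>"
  by (auto simp: flips_def)

lemma tally_above:
  assumes "finite T" obtains b where "b \<ge> 0" "\<And>x. x \<ge> b \<Longrightarrow> tally T x = 0"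
proof
  fix x assume "x \<ge> int (Max (insert 0 T)) + 1"
  moreover have "t \<le> Max (insert 0 T)" if "t \<in> T" for t using that assms by simp
  ultimately have "{t \<in> T. x \<le> int t} = {}" by force
  then show "tally T x = 0" by (simp only: tally_def card.empty)
qed simp

lemma excess_above:
  assumes "finite (fst \<Lambda>)" "finite (snd \<Lambda>)"
  obtains b where "\<And>x. x \<ge> b \<Longrightarrow> excess \<Lambda> x = 0"
proof -
  obtain b c where "b \<ge> 0" "\<And>x. x \<ge> b \<Longrightarrow> tally (fst \<Lambda>) x = 0"
    "c \<ge> 0" "\<And>x. x \<ge> c \<Longrightarrow> tally (snd \<Lambda>) x = 0"
    using tally_above[OF assms(1)] tally_above[OF assms(2)] by metis
  then show ?thesis by (intro that[of "max b c"]) (simp add: excess_def cnt_def tally_def)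
qed

lemma excess_step:
  assumes "finite (fst \<Lambda>)" "finite (snd \<Lambda>)"
  shows "excess \<Lambda> x = excess \<Lambda> (x + 1) +
    (if x \<ge> 0 \<and> nat x \<in> singles \<Lambda> then (if nat x \<in> fst \<Lambda> then 1 else - 1) else 0)"
  unfolding excess_def cnt_step[OF assms(1), of x] cnt_step[OF assms(2), of x]
  by (auto simp: singles_def)

text \<open>In the special symbol the singles alternate between the rows, so that its excess is
the parity of the number of singles passed; moving a single to the other row changes the excess by
$2$ modulo $4$.\<close>

lemma excess_mod_4:
  assumes "finite (fst \<Lambda>)" "finite (snd \<Lambda>)"
  shows "4 dvd excess \<Lambda> x - int (tally (singles \<Lambda>) x mod 2) - 2 * int (tally (flips \<Lambda>) x)"
proof -
  have fin: "finite (singles \<Lambda>)" "finite (flips \<Lambda>)" using assms by (auto simp: singles_def flips_def)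
  obtain b where b: "\<And>x. x \<ge> b \<Longrightarrow> excess \<Lambda> x = 0" using excess_above[OF assms] by blast
  obtain c where c: "\<And>x. x \<ge> c \<Longrightarrow> tally (singles \<Lambda>) x = 0" using tally_above[OF fin(1)] by blast
  obtain d where d: "\<And>x. x \<ge> d \<Longrightarrow> tally (flips \<Lambda>) x = 0" using tally_above[OF fin(2)] by blast
  show ?thesis
  proof (induction x rule: int_downward_induct[of "max b (max c d)"])
    case (1 q)
    then show ?case by (simp add: b c d)
  next
    case (2 q)
    show ?case
    proof (cases "q \<ge> 0 \<and> nat q \<in> singles \<Lambda>")
      case False
      then have "\<not> (q \<ge> 0 \<and> nat q \<in> flips \<Lambda>)" using flips_subset by blast
      then show ?thesis using False 2
        using excess_step[OF assms, of q] tally_step[OF fin(1), of q] tally_step[OF fin(2), of q] by auto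
    next
      case True
      have "nat q \<in> flips \<Lambda> \<longleftrightarrow> (nat q \<in> fst \<Lambda>) \<noteq> odd (tally (singles \<Lambda>) q)"
        using True by (auto simp: flips_def alt_def)
      then show ?thesis using True 2
        using excess_step[OF assms, of q] tally_step[OF fin(1), of q] tally_step[OF fin(2), of q]
        by (auto split: if_splits) presburger+
    qed
  qed
qed

lemma alt_subset: "alt T \<subseteq> T"
  by (auto simp: alt_def)

lemma tally_0: "tally T 0 = card T"
  by (simp add: tally_def)

lemma excess_0: "excess \<Lambda> 0 = defect \<Lambda>"
  by (simp add: excess_def cnt_def defect_def)

lemma is_symbol_iff: "is_symbol \<Lambda> \<longleftrightarrow> finite (doubles \<Lambda>) \<and> finite (singles \<Lambda>) \<and> 0 \<notin> doubles \<Lambda>"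
proof -
  have "fst \<Lambda> \<union> snd \<Lambda> = doubles \<Lambda> \<union> singles \<Lambda>"
    by (auto simp: doubles_def singles_def)
  then have "finite (fst \<Lambda>) \<and> finite (snd \<Lambda>) \<longleftrightarrow> finite (doubles \<Lambda>) \<and> finite (singles \<Lambda>)"
    unfolding finite_Un[symmetric] by simp
  then show ?thesis unfolding is_symbol_def by (auto simp: doubles_def)
qed

lemma finite_rows:
  assumes "is_symbol \<Lambda>"
  shows "finite (fst \<Lambda>)" "finite (snd \<Lambda>)" "finite (singles \<Lambda>)" "finite (doubles \<Lambda>)" "finite (flips \<Lambda>)"
proof -
  show "finite (fst \<Lambda>)" "finite (snd \<Lambda>)" using assms by (simp_all add: is_symbol_def)
  show "finite (singles \<Lambda>)" "finite (doubles \<Lambda>)" using assms by (simp_all add: is_symbol_iff)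
  then show "finite (flips \<Lambda>)" using flips_subset finite_subset by blast
qed

lemma finite_row_split:
  assumes "is_symbol \<Lambda>"
  shows "card (fst \<Lambda>) = card (doubles \<Lambda>) + card (fst \<Lambda> - snd \<Lambda>)"
    "card (snd \<Lambda>) = card (doubles \<Lambda>) + card (snd \<Lambda> - fst \<Lambda>)"
    "\<Sum>(fst \<Lambda>) = \<Sum>(doubles \<Lambda>) + \<Sum>(fst \<Lambda> - snd \<Lambda>)"
    "\<Sum>(snd \<Lambda>) = \<Sum>(doubles \<Lambda>) + \<Sum>(snd \<Lambda> - fst \<Lambda>)"
    "card (singles \<Lambda>) = card (fst \<Lambda> - snd \<Lambda>) + card (snd \<Lambda> - fst \<Lambda>)"
    "\<Sum>(singles \<Lambda>) = \<Sum>(fst \<Lambda> - snd \<Lambda>) + \<Sum>(snd \<Lambda> - fst \<Lambda>)"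
proof -
  note fin = finite_rows[OF assms]
  have 1: "fst \<Lambda> = doubles \<Lambda> \<union> (fst \<Lambda> - snd \<Lambda>)" "doubles \<Lambda> \<inter> (fst \<Lambda> - snd \<Lambda>) = {}"
    and 2: "snd \<Lambda> = doubles \<Lambda> \<union> (snd \<Lambda> - fst \<Lambda>)" "doubles \<Lambda> \<inter> (snd \<Lambda> - fst \<Lambda>) = {}"
    and 3: "singles \<Lambda> = (fst \<Lambda> - snd \<Lambda>) \<union> (snd \<Lambda> - fst \<Lambda>)" "(fst \<Lambda> - snd \<Lambda>) \<inter> (snd \<Lambda> - fst \<Lambda>) = {}"
    by (auto simp: doubles_def singles_def)
  show "card (fst \<Lambda>) = card (doubles \<Lambda>) + card (fst \<Lambda> - snd \<Lambda>)"
    "\<Sum>(fst \<Lambda>) = \<Sum>(doubles \<Lambda>) + \<Sum>(fst \<Lambda> - snd \<Lambda>)"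
    using card_Un_disjoint[OF _ _ 1(2)] sum.union_disjoint[OF _ _ 1(2), of id] fin 1(1) by simp_all
  show "card (snd \<Lambda>) = card (doubles \<Lambda>) + card (snd \<Lambda> - fst \<Lambda>)"
    "\<Sum>(snd \<Lambda>) = \<Sum>(doubles \<Lambda>) + \<Sum>(snd \<Lambda> - fst \<Lambda>)"
    using card_Un_disjoint[OF _ _ 2(2)] sum.union_disjoint[OF _ _ 2(2), of id] fin 2(1) by simp_all
  show "card (singles \<Lambda>) = card (fst \<Lambda> - snd \<Lambda>) + card (snd \<Lambda> - fst \<Lambda>)"
    "\<Sum>(singles \<Lambda>) = \<Sum>(fst \<Lambda> - snd \<Lambda>) + \<Sum>(snd \<Lambda> - fst \<Lambda>)"
    using card_Un_disjoint[OF _ _ 3(2)] sum.union_disjoint[OF _ _ 3(2), of id] fin 3(1) by simp_all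
qed

lemma sym_card_eq:
  assumes "is_symbol \<Lambda>"
  shows "sym_card \<Lambda> = 2 * card (doubles \<Lambda>) + card (singles \<Lambda>)"
  using finite_row_split[OF assms] by (simp add: sym_card_def)

text \<open>The rank does not depend on the distribution of the singles over the rows.\<close>

lemma sym_rank_eq:
  assumes "is_symbol \<Lambda>"
  shows "sym_rank \<Lambda> = 2 * int (\<Sum>(doubles \<Lambda>)) + int (\<Sum>(singles \<Lambda>))
    - \<lfloor>((real (2 * card (doubles \<Lambda>) + card (singles \<Lambda>)) - 1) / 2) ^ 2\<rfloor>"
  unfolding sym_rank_def sym_card_eq[OF assms] using finite_row_split(3,4,6)[OF assms] by simp

lemma sym_rank_cong:
  assumes "is_symbol \<Lambda>" "is_symbol \<Lambda>'" "doubles \<Lambda> = doubles \<Lambda>'" "singles \<Lambda> = singles \<Lambda>'"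
  shows "sym_rank \<Lambda> = sym_rank \<Lambda>'"
  using assms by (simp add: sym_rank_eq)

text \<open>The defect conditions modulo $4$ in the definitions of the sets of symbols thereby
become parity conditions on the numbers of singles and of flips.\<close>

lemma defect_mod_4:
  assumes "is_symbol \<Lambda>"
  shows "4 dvd defect \<Lambda> - int (card (singles \<Lambda>) mod 2) - 2 * int (card (flips \<Lambda>))"
  using excess_mod_4[OF finite_rows(1,2)[OF assms], of 0] by (simp add: tally_0 excess_0)

lemma excess_unflipped:
  assumes sym: "is_symbol \<Lambda>" and fl: "flips \<Lambda> = {}"
  shows "excess \<Lambda> x = int (tally (singles \<Lambda>) x mod 2)"
proof -
  note fin = finite_rows[OF sym]
  obtain b where b: "\<And>x. x \<ge> b \<Longrightarrow> excess \<Lambda> x = 0" using excess_above[OF fin(1,2)] by blast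
  obtain c where c: "\<And>x. x \<ge> c \<Longrightarrow> tally (singles \<Lambda>) x = 0" using tally_above[OF fin(3)] by blast
  show ?thesis
  proof (induction x rule: int_downward_induct[of "max b c"])
    case (1 q)
    then show ?case by (simp add: b c)
  next
    case (2 q)
    show ?case
    proof (cases "q \<ge> 0 \<and> nat q \<in> singles \<Lambda>")
      case False
      then show ?thesis using 2 excess_step[OF fin(1,2), of q] tally_step[OF fin(3), of q] by auto
    next
      case True
      then have "nat q \<notin> flips \<Lambda>" using fl by simp
      then have "nat q \<in> fst \<Lambda> \<longleftrightarrow> odd (tally (singles \<Lambda>) q)"
        using True by (auto simp: flips_def alt_def)
      then show ?thesis using True 2 excess_step[OF fin(1,2), of q] tally_step[OF fin(3), of q]
        by (auto split: if_splits) presburger+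
    qed
  qed
qed

text \<open>The excess of a special symbol is always $0$ or $1$, hence is given by the parity of
the number of singles, and its jumps tell the row of each single.\<close>

lemma special_iff_unflipped: "special Z \<longleftrightarrow> is_symbol Z \<and> flips Z = {}"
proof safe
  assume sp: "special Z"
  then show sym: "is_symbol Z" by (simp add: special_iff)
  note fin = finite_rows[OF sym]
  have 01: "excess Z x \<in> {0, 1}" for x
  proof -
    have "cnt (snd Z) x \<le> cnt (fst Z) x" "cnt (fst Z) x \<le> Suc (cnt (snd Z) x)"
      using sp by (simp_all add: special_iff)
    then show ?thesis unfolding excess_def by simp linarith
  qed
  have ex: "excess Z x = int (tally (singles Z) x mod 2)" for x
    using excess_mod_4[OF fin(1,2), of x] 01[of x] by (simp; elim disjE; simp) presburger+
  fix t assume "t \<in> flips Z"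
  then have t: "t \<in> singles Z" "(t \<in> fst Z) \<noteq> odd (tally (singles Z) (int t))"
    by (auto simp: flips_def alt_def)
  show "t \<in> {}"
    using excess_step[OF fin(1,2), of "int t"] t ex[of "int t"] ex[of "int t + 1"]
    by (auto split: if_splits) presburger+
next
  assume sym: "is_symbol Z" and fl: "flips Z = {}"
  then have ex: "excess Z x \<in> {0, 1}" for x using excess_unflipped[OF sym fl, of x] by simp linarith
  have "cnt (snd Z) x \<le> cnt (fst Z) x \<and> cnt (fst Z) x \<le> Suc (cnt (snd Z) x)" for x
    using ex[of x] by (auto simp: excess_def)
  then show "special Z" using sym ex[of 0] by (simp add: special_iff excess_0)
qed

lemma is_symbol_symbol_of:
  assumes "is_symbol \<Lambda>" "v \<subseteq> singles \<Lambda>"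
  shows "is_symbol (symbol_of (doubles \<Lambda>) (singles \<Lambda>) v)"
  using assms symbol_of_inverse[OF doubles_singles_disjoint assms(2)] by (simp add: is_symbol_iff)

lemma special_eq_symbol_of:
  "special Z \<Longrightarrow> Z = symbol_of (doubles Z) (singles Z) {}"
  using special_iff_unflipped[of Z] symbol_of_flips[of Z] by simp

lemma special_symbol_of:
  assumes "is_symbol \<Lambda>"
  shows "special (symbol_of (doubles \<Lambda>) (singles \<Lambda>) {})"
  using is_symbol_symbol_of[OF assms, of "{}"] symbol_of_inverse(3)[OF doubles_singles_disjoint, of "{}" \<Lambda>]
  by (simp add: special_iff_unflipped)

lemma special_defect: "special Z \<Longrightarrow> defect Z = int (card (singles Z) mod 2)"
  using excess_unflipped[of Z 0] by (simp add: special_iff_unflipped tally_0 excess_0)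

section \<open>Families of symbols and their Fourier matrices\<close>

text \<open>The set \<open>v\<close> of singles as a pair of rows inside the special symbol.\<close>

definition swap_symbol :: "nat set \<Rightarrow> nat set \<Rightarrow> symbol" where
  "swap_symbol T v = (v \<inter> alt T, v - alt T)"

lemma special_rows:
  assumes "special Z"
  shows "fst Z - snd Z = alt (singles Z)" "snd Z - fst Z = singles Z - alt (singles Z)"
proof -
  have "flips Z = {}" using assms by (simp add: special_iff_unflipped)
  then have "(t \<in> fst Z) = (t \<in> alt (singles Z))" if "t \<in> singles Z" for t using that by (auto simp: flips_def)
  then show "fst Z - snd Z = alt (singles Z)" "snd Z - fst Z = singles Z - alt (singles Z)"
    using alt_subset[of "singles Z"] by (auto simp: singles_def)
qed

lemma card_swap_symbol: "finite v \<Longrightarrow> sym_card (swap_symbol T v) = card v"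
  using card_Int_Diff[of v "alt T"] by (simp add: sym_card_def swap_symbol_def)

lemma swaps_special:
  assumes "special Z"
  shows "swaps Z = swap_symbol (singles Z) ` swap_sets (singles Z)"
proof -
  let ?T = "singles Z"
  have fin: "finite ?T" using assms finite_rows[of Z] by (simp add: special_iff_unflipped)
  have def: "defect Z = 1 \<longleftrightarrow> odd (card ?T)" using special_defect[OF assms] by presburger
  show ?thesis
  proof (intro Set.set_eqI iffI)
    fix M assume M: "M \<in> swaps Z"
    define v where "v = fst M \<union> snd M"
    have sub: "fst M \<subseteq> alt ?T" "snd M \<subseteq> ?T - alt ?T"
      using M special_rows[OF assms] by (auto simp: swaps_def sym_singles_def)
    then have Mv: "M = swap_symbol ?T v" "v \<subseteq> ?T" using alt_subset[of ?T]
      by (auto simp: v_def swap_symbol_def prod_eq_iff)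
    then have "v \<in> swap_sets ?T" using M def finite_subset[OF Mv(2) fin] card_swap_symbol[of v ?T]
      by (auto simp: swap_sets_def swaps_def)
    then show "M \<in> swap_symbol ?T ` swap_sets ?T" using Mv by blast
  next
    fix M assume "M \<in> swap_symbol ?T ` swap_sets ?T"
    then obtain v where v: "v \<in> swap_sets ?T" "M = swap_symbol ?T v" by blast
    then have "finite v" using fin finite_subset by (auto simp: swap_sets_def)
    then show "M \<in> swaps Z" using v def card_swap_symbol[of v ?T] special_rows[OF assms]
      by (auto simp: swaps_def sym_singles_def swap_sets_def swap_symbol_def)
  qed
qed

lemma sym_swap_special:
  assumes "special Z" "v \<subseteq> singles Z"
  shows "sym_swap Z (swap_symbol (singles Z) v) = symbol_of (doubles Z) (singles Z) v"
proof -
  have "fst Z = doubles Z \<union> alt (singles Z)" "snd Z = doubles Z \<union> (singles Z - alt (singles Z))"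
    unfolding special_rows[OF assms(1), symmetric] by (auto simp: doubles_def singles_def)
  note rows = this
  have "(D \<union> A - v \<inter> A) \<union> (v - A) = D \<union> {t \<in> T. (t \<in> v) \<noteq> (t \<in> A)}"
    "(D \<union> (T - A) - (v - A)) \<union> (v \<inter> A) = D \<union> {t \<in> T. (t \<in> v) = (t \<in> A)}"
    if "v \<subseteq> T" "A \<subseteq> T" "D \<inter> T = {}" for D A T :: "nat set" using that by auto
  note this[OF assms(2) alt_subset[of "singles Z"] doubles_singles_disjoint[of Z]]
  then show ?thesis
    unfolding sym_swap_def swap_symbol_def symbol_of_def fst_conv snd_conv
    by (simp only: rows[symmetric])
qed

lemma sym_family_special:
  assumes "special Z"
  shows "sym_family Z = symbol_of (doubles Z) (singles Z) ` swap_sets (singles Z)"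
proof -
  have "sym_family Z = (\<lambda>v. sym_swap Z (swap_symbol (singles Z) v)) ` swap_sets (singles Z)"
    by (simp add: sym_family_def swaps_special[OF assms] image_image)
  also have "\<dots> = symbol_of (doubles Z) (singles Z) ` swap_sets (singles Z)"
    by (rule image_cong[OF refl]) (simp add: sym_swap_special[OF assms] swap_sets_def)
  finally show ?thesis .
qed

text \<open>The symbols that belong to the family of a special symbol.\<close>

definition admissible :: "symbol \<Rightarrow> bool" where
  "admissible \<Lambda> \<longleftrightarrow> is_symbol \<Lambda> \<and> flips \<Lambda> \<in> swap_sets (singles \<Lambda>)"

lemma special_of_eq:
  assumes "admissible \<Lambda>"
  shows "special_of \<Lambda> = symbol_of (doubles \<Lambda>) (singles \<Lambda>) {}" (is "_ = ?Z")
  unfolding special_of_def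
proof (rule the_equality)
  note inv = symbol_of_inverse[OF doubles_singles_disjoint[of \<Lambda>], of "{}", simplified]
  have sp: "special ?Z" using assms special_symbol_of by (simp add: admissible_def)
  have "\<Lambda> \<in> sym_family ?Z" unfolding sym_family_special[OF sp] inv
    using assms symbol_of_flips[of \<Lambda>] by (force simp: admissible_def)
  with sp show "special ?Z \<and> \<Lambda> \<in> sym_family ?Z" by simp
next
  fix Z assume Z: "special Z \<and> \<Lambda> \<in> sym_family Z"
  then obtain v where v: "v \<subseteq> singles Z" "\<Lambda> = symbol_of (doubles Z) (singles Z) v"
    using sym_family_special[of Z] by (auto simp: swap_sets_def)
  then have "doubles \<Lambda> = doubles Z" "singles \<Lambda> = singles Z"
    using symbol_of_inverse[OF doubles_singles_disjoint v(1)] by auto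
  then show "Z = ?Z" using special_eq_symbol_of Z by simp
qed

lemma special_of_props:
  assumes "admissible \<Lambda>"
  shows "special (special_of \<Lambda>)" "doubles (special_of \<Lambda>) = doubles \<Lambda>" "singles (special_of \<Lambda>) = singles \<Lambda>"
  using assms special_symbol_of symbol_of_inverse[OF doubles_singles_disjoint[of \<Lambda>], of "{}"]
  by (simp_all add: special_of_eq admissible_def)

lemma swap_of_eq:
  assumes "admissible \<Lambda>"
  shows "swap_of \<Lambda> = swap_symbol (singles \<Lambda>) (flips \<Lambda>)"
  unfolding swap_of_def
proof (rule the_equality)
  note sp = special_of_props[OF assms]
  have fl: "flips \<Lambda> \<in> swap_sets (singles \<Lambda>)" using assms by (simp add: admissible_def)
  show "swap_symbol (singles \<Lambda>) (flips \<Lambda>) \<in> swaps (special_of \<Lambda>) \<and>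
      sym_swap (special_of \<Lambda>) (swap_symbol (singles \<Lambda>) (flips \<Lambda>)) = \<Lambda>"
    using swaps_special[OF sp(1)] sym_swap_special[OF sp(1), of "flips \<Lambda>"] fl sp(2,3)
      symbol_of_flips[of \<Lambda>] flips_subset[of \<Lambda>] by simp
  fix M assume M: "M \<in> swaps (special_of \<Lambda>) \<and> sym_swap (special_of \<Lambda>) M = \<Lambda>"
  then obtain v where v: "v \<subseteq> singles \<Lambda>" "M = swap_symbol (singles \<Lambda>) v"
    using swaps_special[OF sp(1)] sp(3) by (auto simp: swap_sets_def)
  then have "\<Lambda> = symbol_of (doubles \<Lambda>) (singles \<Lambda>) v" using M sym_swap_special[OF sp(1), of v] sp(2,3) by simp
  then have "flips \<Lambda> = v" using symbol_of_inverse(3)[OF doubles_singles_disjoint[of \<Lambda>] v(1)] by metis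
  then show "M = swap_symbol (singles \<Lambda>) (flips \<Lambda>)" using v by simp
qed

lemma sym_pairing_eq:
  assumes "admissible \<Lambda>" "admissible \<Lambda>'" "singles \<Lambda>' = singles \<Lambda>"
  shows "sym_pairing \<Lambda> \<Lambda>' = pairing (flips \<Lambda>) (flips \<Lambda>')"
proof -
  have fin: "finite (flips \<Lambda>)" "finite (flips \<Lambda>')" using assms finite_rows by (auto simp: admissible_def)
  have "sym_card (flips \<Lambda> \<inter> alt T \<inter> (flips \<Lambda>' \<inter> alt T), (flips \<Lambda> - alt T) \<inter> (flips \<Lambda>' - alt T))
      = card (flips \<Lambda> \<inter> flips \<Lambda>')" for T
  proof -
    have "flips \<Lambda> \<inter> alt T \<inter> (flips \<Lambda>' \<inter> alt T) = (flips \<Lambda> \<inter> flips \<Lambda>') \<inter> alt T"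
      "(flips \<Lambda> - alt T) \<inter> (flips \<Lambda>' - alt T) = (flips \<Lambda> \<inter> flips \<Lambda>') - alt T" by auto
    then show ?thesis using card_Int_Diff[of "flips \<Lambda> \<inter> flips \<Lambda>'" "alt T"] fin by (simp add: sym_card_def)
  qed
  then show ?thesis using card_swap_symbol fin assms
    by (simp add: sym_pairing_def swap_of_eq Let_def pairing_def) (simp add: swap_symbol_def)
qed

lemma sym_degree_eq: "sym_degree Z = card (singles Z) div 2" if "is_symbol Z"
  using finite_row_split(5)[OF that] by (simp add: sym_degree_def sym_card_def sym_singles_def)

text \<open>The matrix that takes unipotent characters to unipotent almost characters.\<close>

definition fourier :: "symbol \<Rightarrow> symbol \<Rightarrow> complex" where
  "fourier \<Lambda> \<Lambda>1 = (if \<Lambda>1 \<in> sym_family (special_of \<Lambda>)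
     then (- 1) ^ sym_pairing \<Lambda> \<Lambda>1 / 2 ^ sym_degree (special_of \<Lambda>) else 0)"

lemma sym_family_eq:
  assumes "admissible \<Lambda>"
  shows "sym_family (special_of \<Lambda>) = symbol_of (doubles \<Lambda>) (singles \<Lambda>) ` swap_sets (singles \<Lambda>)"
  using sym_family_special[OF special_of_props(1)[OF assms]] special_of_props[OF assms] by simp

lemma admissible_symbol_of:
  assumes "admissible \<Lambda>" "v \<in> swap_sets (singles \<Lambda>)"
  shows "admissible (symbol_of (doubles \<Lambda>) (singles \<Lambda>) v)"
  using assms is_symbol_symbol_of symbol_of_inverse[OF doubles_singles_disjoint, of v \<Lambda>]
  by (auto simp: admissible_def swap_sets_def)

lemma fourier_symbol_of:
  assumes "admissible \<Lambda>" "v \<in> swap_sets (singles \<Lambda>)"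
  shows "fourier \<Lambda> (symbol_of (doubles \<Lambda>) (singles \<Lambda>) v)
    = (- 1) ^ pairing (flips \<Lambda>) v / 2 ^ (card (singles \<Lambda>) div 2)"
proof -
  have "v \<subseteq> singles \<Lambda>" using assms by (simp add: swap_sets_def)
  note inv = symbol_of_inverse[OF doubles_singles_disjoint this]
  have "is_symbol (special_of \<Lambda>)" using special_of_props[OF assms(1)] by (simp add: special_iff_unflipped)
  then show ?thesis
    using assms inv sym_pairing_eq[OF assms(1) admissible_symbol_of[OF assms]] special_of_props[OF assms(1)]
    by (simp add: fourier_def sym_family_eq sym_degree_eq)
qed

text \<open>The unified form of \<open>S_Sp n\<close> (odd number of singles) and of the union of
\<open>S_O Plus n\<close> and \<open>S_O Minus n\<close> (even number of singles).\<close>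

definition symbol_class :: "bool \<Rightarrow> nat \<Rightarrow> symbol set" where
  "symbol_class b n = {\<Lambda>. admissible \<Lambda> \<and> sym_rank \<Lambda> = int n \<and> odd (card (singles \<Lambda>)) = b}"

lemma S_Sp_eq: "S_Sp n = symbol_class True n"
proof -
  have "defect \<Lambda> mod 4 = 1 \<longleftrightarrow> odd (card (singles \<Lambda>)) \<and> flips \<Lambda> \<in> swap_sets (singles \<Lambda>)" if "is_symbol \<Lambda>" for \<Lambda>
  proof -
    have "defect \<Lambda> mod 4 = 1 \<longleftrightarrow> odd (card (singles \<Lambda>)) \<and> even (card (flips \<Lambda>))"
      using defect_mod_4[OF that] by presburger
    then show ?thesis using flips_subset[of \<Lambda>] by (auto simp: swap_sets_def)
  qed
  then show ?thesis unfolding S_Sp_def symbol_class_def admissible_def by blast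
qed

lemma S_O_eq: "S_O Plus n \<union> S_O Minus n = symbol_class False n"
proof -
  have "defect \<Lambda> mod 4 = 0 \<or> defect \<Lambda> mod 4 = 2 \<longleftrightarrow>
      \<not> odd (card (singles \<Lambda>)) \<and> flips \<Lambda> \<in> swap_sets (singles \<Lambda>)" if "is_symbol \<Lambda>" for \<Lambda>
  proof -
    have "defect \<Lambda> mod 4 = 0 \<or> defect \<Lambda> mod 4 = 2 \<longleftrightarrow> even (card (singles \<Lambda>))"
      using defect_mod_4[OF that] by presburger
    then show ?thesis using flips_subset[of \<Lambda>] by (auto simp: swap_sets_def)
  qed
  moreover have "S_O Plus n \<union> S_O Minus n
      = {\<Lambda>. is_symbol \<Lambda> \<and> sym_rank \<Lambda> = int n \<and> (defect \<Lambda> mod 4 = 0 \<or> defect \<Lambda> mod 4 = 2)}"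
    unfolding S_O_def sgn_type.case by blast
  ultimately show ?thesis unfolding symbol_class_def admissible_def by blast
qed

lemma symbol_of_class:
  assumes "\<Lambda> \<in> symbol_class b n" "v \<in> swap_sets (singles \<Lambda>)"
  shows "symbol_of (doubles \<Lambda>) (singles \<Lambda>) v \<in> symbol_class b n"
proof -
  have "v \<subseteq> singles \<Lambda>" using assms by (simp add: swap_sets_def)
  note inv = symbol_of_inverse[OF doubles_singles_disjoint this]
  have ad: "admissible \<Lambda>" using assms by (simp add: symbol_class_def)
  note ad' = admissible_symbol_of[OF ad assms(2)]
  have "sym_rank (symbol_of (doubles \<Lambda>) (singles \<Lambda>) v) = sym_rank \<Lambda>"
    by (rule sym_rank_cong) (use ad ad' inv in \<open>auto simp: admissible_def\<close>)
  then show ?thesis using assms ad' inv by (simp add: symbol_class_def)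
qed

text \<open>A row of the Fourier matrix is supported on one family, which is parametrized by the
sets of flips.\<close>

lemma sum_fourier:
  assumes fin: "finite (symbol_class b n)" and L: "\<Lambda> \<in> symbol_class b n"
  shows "(\<Sum>\<Lambda>1\<in>symbol_class b n. fourier \<Lambda> \<Lambda>1 * g \<Lambda>1)
    = (\<Sum>v\<in>swap_sets (singles \<Lambda>). (- 1) ^ pairing (flips \<Lambda>) v / 2 ^ (card (singles \<Lambda>) div 2)
         * g (symbol_of (doubles \<Lambda>) (singles \<Lambda>) v))"
proof -
  let ?s = "symbol_of (doubles \<Lambda>) (singles \<Lambda>)" and ?V = "swap_sets (singles \<Lambda>)"
  have ad: "admissible \<Lambda>" using L by (simp add: symbol_class_def)
  have inj: "inj_on ?s ?V"
    by (rule inj_onI) (metis (no_types, lifting) symbol_of_inverse(3) doubles_singles_disjoint mem_Collect_eq swap_sets_def)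
  have "(\<Sum>\<Lambda>1\<in>symbol_class b n. fourier \<Lambda> \<Lambda>1 * g \<Lambda>1) = (\<Sum>\<Lambda>1\<in>?s ` ?V. fourier \<Lambda> \<Lambda>1 * g \<Lambda>1)"
    by (rule sum.mono_neutral_right[OF fin])
      (use symbol_of_class[OF L] in \<open>auto simp: fourier_def sym_family_eq[OF ad]\<close>)
  also have "\<dots> = (\<Sum>v\<in>?V. fourier \<Lambda> (?s v) * g (?s v))" by (simp add: sum.reindex[OF inj])
  also have "\<dots> = (\<Sum>v\<in>?V. (- 1) ^ pairing (flips \<Lambda>) v / 2 ^ (card (singles \<Lambda>) div 2) * g (?s v))"
    by (rule sum.cong[OF refl]) (simp add: fourier_symbol_of[OF ad])
  finally show ?thesis .
qed

lemma fourier_orthonormal: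
  assumes fin: "finite (symbol_class b n)"
    and L: "\<Lambda> \<in> symbol_class b n" and L': "\<Lambda>' \<in> symbol_class b n"
  shows "(\<Sum>\<Lambda>1\<in>symbol_class b n. fourier \<Lambda> \<Lambda>1 * fourier \<Lambda>' \<Lambda>1) = (if \<Lambda> = \<Lambda>' then 1 else 0)"
proof -
  let ?T = "singles \<Lambda>" and ?D = "doubles \<Lambda>"
  have ad: "admissible \<Lambda>" "admissible \<Lambda>'" using L L' by (simp_all add: symbol_class_def)
  have T: "finite ?T" using ad finite_rows by (simp add: admissible_def)
  show ?thesis
  proof (cases "doubles \<Lambda>' = ?D \<and> singles \<Lambda>' = ?T")
    case True
    have fl: "flips \<Lambda> \<in> swap_sets ?T" "flips \<Lambda>' \<in> swap_sets ?T" using ad True by (auto simp: admissible_def)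
    have "(\<Sum>\<Lambda>1\<in>symbol_class b n. fourier \<Lambda> \<Lambda>1 * fourier \<Lambda>' \<Lambda>1)
      = (\<Sum>v\<in>swap_sets ?T. (- 1) ^ pairing (flips \<Lambda>) v / 2 ^ (card ?T div 2) *
           ((- 1) ^ pairing (flips \<Lambda>') v / 2 ^ (card ?T div 2)))"
      unfolding sum_fourier[OF fin L]
      by (rule sum.cong[OF refl]) (use fourier_symbol_of[OF ad(2)] True in simp)
    also have "\<dots> = (\<Sum>v\<in>swap_sets ?T. (- 1) ^ pairing (flips \<Lambda>) v * (- 1) ^ pairing (flips \<Lambda>') v) / 4 ^ (card ?T div 2)"
      unfolding sum_divide_distrib by (rule sum.cong[OF refl]) (simp add: power_mult_distrib[symmetric])
    also have "\<dots> = (if flips \<Lambda> = flips \<Lambda>' then 1 else 0)"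
      unfolding pairing_orthogonality[OF T fl] by simp
    also have "flips \<Lambda> = flips \<Lambda>' \<longleftrightarrow> \<Lambda> = \<Lambda>'"
      using True symbol_of_flips by metis
    finally show ?thesis .
  next
    case False
    have zero: "fourier \<Lambda> \<Lambda>1 * fourier \<Lambda>' \<Lambda>1 = 0" for \<Lambda>1
    proof (rule ccontr)
      assume "\<not> ?thesis"
      then have "\<Lambda>1 \<in> sym_family (special_of \<Lambda>)" "\<Lambda>1 \<in> sym_family (special_of \<Lambda>')"
        by (auto simp: fourier_def split: if_splits)
      then obtain v v' where "v \<subseteq> ?T" "\<Lambda>1 = symbol_of ?D ?T v" "v' \<subseteq> singles \<Lambda>'"
        "\<Lambda>1 = symbol_of (doubles \<Lambda>') (singles \<Lambda>') v'"
        unfolding sym_family_eq[OF ad(1)] sym_family_eq[OF ad(2)] swap_sets_def by blast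
      then have "doubles \<Lambda>1 = ?D" "singles \<Lambda>1 = ?T" "doubles \<Lambda>1 = doubles \<Lambda>'" "singles \<Lambda>1 = singles \<Lambda>'"
        using symbol_of_inverse(1,2)[OF doubles_singles_disjoint, of v \<Lambda>]
          symbol_of_inverse(1,2)[OF doubles_singles_disjoint, of v' \<Lambda>'] by simp_all
      then show False using False by simp
    qed
    have "\<Lambda> \<noteq> \<Lambda>'" using False by auto
    then show ?thesis by (simp only: zero sum.neutral_const if_False)
  qed
qed

section \<open>Interlacing as alternation on a line\<close>

lemma cnt_antimono: "finite A \<Longrightarrow> x \<le> y \<Longrightarrow> cnt A y \<le> cnt A x"
  unfolding cnt_def by (intro add_mono card_mono) auto

lemma cnt_nonpos: "x \<le> 0 \<Longrightarrow> int (cnt A x) = int (card A) - x"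
proof -
  assume x: "x \<le> 0"
  then have "{a \<in> A. x \<le> int a} = A" by auto
  then show ?thesis using x by (simp add: cnt_def)
qed

text \<open>The entries of the symplectic symbol sit at the even positions \<open>2 * a\<close> of
the line and those of the orthogonal symbol at the odd positions \<open>2 * (a + c) + 1\<close>.
Both functions count the entries of a row at positions at least \<open>p\<close>.\<close>

definition count_left :: "nat set \<Rightarrow> int \<Rightarrow> int" where
  "count_left K p = int (cnt K ((p + 1) div 2))"

definition count_right :: "int \<Rightarrow> nat set \<Rightarrow> int \<Rightarrow> int" where
  "count_right c K p = int (cnt K (p div 2 - c))"

lemma count_even_odd:
  "count_left K (2 * y) = int (cnt K y)" "count_left K (2 * y - 1) = int (cnt K y)"
  "count_right c Y (2 * y) = int (cnt Y (y - c))" "count_right c Y (2 * y - 1) = int (cnt Y (y - 1 - c))"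
proof -
  have "(2 * y + 1) div 2 = y" "(2 * y - 1 + 1) div 2 = y" "(2 * y) div 2 = y" "(2 * y - 1) div 2 = y - 1"
    by presburger+
  then show "count_left K (2 * y) = int (cnt K y)" "count_left K (2 * y - 1) = int (cnt K y)"
    "count_right c Y (2 * y) = int (cnt Y (y - c))" "count_right c Y (2 * y - 1) = int (cnt Y (y - 1 - c))"
    by (simp_all add: count_left_def count_right_def)
qed

lemma all_int_iff:
  fixes P :: "int \<Rightarrow> bool"
  shows "(\<forall>p. P p) \<longleftrightarrow> (\<forall>y. P (2 * y) \<and> P (2 * y - 1))"
proof safe
  fix p :: int
  assume *: "\<forall>y. P (2 * y) \<and> P (2 * y - 1)"
  have "p = 2 * (p div 2) \<or> p = 2 * (p div 2 + 1) - 1" by presburger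
  then show "P p" using * by metis
qed auto

lemma diff_mem_01_iff: "int a - int b \<in> {0, 1} \<longleftrightarrow> b \<le> a \<and> a \<le> Suc b"
  by auto

text \<open>Two decreasing sequences alternate, beginning with an element of the first one,
exactly if their counting functions differ by $0$ or $1$ everywhere. Far below all entries this
forces the relation between the lengths of the rows.\<close>

lemma alternating_left_iff:
  assumes "finite K" "finite Y"
  shows "(\<forall>p. count_left K p - count_right c Y p \<in> {0, 1}) \<longleftrightarrow>
    row_partition Y \<preceq>\<^sub>p row_partition K \<and> int (card K) - int (card Y) = c + 1"
    (is "?l \<longleftrightarrow> ?i \<and> ?d")
proof -
  have l: "?l \<longleftrightarrow> (\<forall>y. cnt Y (y - c) \<le> cnt K y \<and> cnt K y \<le> Suc (cnt Y (y - c)) \<and>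
      cnt Y (y - 1 - c) \<le> cnt K y \<and> cnt K y \<le> Suc (cnt Y (y - 1 - c)))"
    unfolding all_int_iff[of "\<lambda>p. _ p - _ p \<in> _"] count_even_odd diff_mem_01_iff by blast
  \<comment> \<open>At \<open>- \<bar>c\<bar>\<close> all counts are taken in the range of negative numbers, where they are linear.\<close>
  have d: ?d if ?l
  proof -
    note that[unfolded l, rule_format, of "- \<bar>c\<bar>"]
    then show ?d using cnt_nonpos[of "- \<bar>c\<bar>" K] cnt_nonpos[of "- \<bar>c\<bar> - c" Y]
      cnt_nonpos[of "- \<bar>c\<bar> - 1 - c" Y] by linarith
  qed
  have i: "?i \<longleftrightarrow> (\<forall>y. cnt Y (y - 1 - c) \<le> cnt K y \<and> cnt K y \<le> Suc (cnt Y (y - c)))" if ?d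
  proof -
    have e: "x + (int (card Y) - int (card K) + 1) = x - c" "x + (int (card K) - int (card Y)) = x + c + 1" for x
      using that by simp_all
    have "(\<forall>x. cnt Y x \<le> cnt K (x + c + 1)) \<longleftrightarrow> (\<forall>y. cnt Y (y - 1 - c) \<le> cnt K y)"
    proof safe
      fix x assume "\<forall>y. cnt Y (y - 1 - c) \<le> cnt K y"
      from this[rule_format, of "x + c + 1"] show "cnt Y x \<le> cnt K (x + c + 1)" by simp
    next
      fix y assume "\<forall>x. cnt Y x \<le> cnt K (x + c + 1)"
      from this[rule_format, of "y - 1 - c"] show "cnt Y (y - 1 - c) \<le> cnt K y" by simp
    qed
    then show ?thesis unfolding interlaced_iff_cnt[OF assms(2,1)] e by blast
  qed
  have "?l" if "?i" ?d unfolding l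
  proof (intro allI conjI)
    fix y
    note * = i[OF that(2), THEN iffD1, OF that(1), rule_format]
    show "cnt K y \<le> Suc (cnt Y (y - c))" "cnt Y (y - 1 - c) \<le> cnt K y" using *[of y] by auto
    have "cnt Y (y - c) \<le> cnt K (y + 1)" using *[of "y + 1"] by simp
    then show "cnt Y (y - c) \<le> cnt K y" using cnt_antimono[OF assms(1), of y "y + 1"] by linarith
    show "cnt K y \<le> Suc (cnt Y (y - 1 - c))"
      using *[of y] cnt_antimono[OF assms(2), of "y - 1 - c" "y - c"] by linarith
  qed
  moreover have ?i if ?l using i[OF d[OF that]] that unfolding l by blast
  ultimately show ?thesis using d by blast
qed

lemma alternating_right_iff:
  assumes "finite K" "finite Y"
  shows "(\<forall>p. count_right c Y p - count_left K p \<in> {0, 1}) \<longleftrightarrow>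
    row_partition K \<preceq>\<^sub>p row_partition Y \<and> int (card K) - int (card Y) = c" (is "?l \<longleftrightarrow> ?i \<and> ?d")
proof -
  have l: "?l \<longleftrightarrow> (\<forall>y. cnt K y \<le> cnt Y (y - c) \<and> cnt Y (y - c) \<le> Suc (cnt K y) \<and>
      cnt K y \<le> cnt Y (y - 1 - c) \<and> cnt Y (y - 1 - c) \<le> Suc (cnt K y))"
    unfolding all_int_iff[of "\<lambda>p. _ p - _ p \<in> _"] count_even_odd diff_mem_01_iff by blast
  have d: ?d if ?l
  proof -
    note that[unfolded l, rule_format, of "- \<bar>c\<bar>"]
    then show ?d using cnt_nonpos[of "- \<bar>c\<bar>" K] cnt_nonpos[of "- \<bar>c\<bar> - c" Y]
      cnt_nonpos[of "- \<bar>c\<bar> - 1 - c" Y] by linarith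
  qed
  have i: "?i \<longleftrightarrow> (\<forall>y. cnt K y \<le> cnt Y (y - c) \<and> cnt Y (y - 1 - c) \<le> Suc (cnt K y))" if ?d
  proof -
    have e: "x + (int (card Y) - int (card K)) = x - c" "x + (int (card K) - int (card Y) + 1) = x + c + 1" for x
      using that by simp_all
    have "(\<forall>x. cnt Y x \<le> Suc (cnt K (x + c + 1))) \<longleftrightarrow> (\<forall>y. cnt Y (y - 1 - c) \<le> Suc (cnt K y))"
    proof safe
      fix x assume "\<forall>y. cnt Y (y - 1 - c) \<le> Suc (cnt K y)"
      from this[rule_format, of "x + c + 1"] show "cnt Y x \<le> Suc (cnt K (x + c + 1))" by simp
    next
      fix y assume "\<forall>x. cnt Y x \<le> Suc (cnt K (x + c + 1))"
      from this[rule_format, of "y - 1 - c"] show "cnt Y (y - 1 - c) \<le> Suc (cnt K y)" by simp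
    qed
    then show ?thesis unfolding interlaced_iff_cnt[OF assms] e by blast
  qed
  have "?l" if "?i" ?d unfolding l
  proof (intro allI conjI)
    fix y
    note * = i[OF that(2), THEN iffD1, OF that(1), rule_format]
    show "cnt K y \<le> cnt Y (y - c)" "cnt Y (y - 1 - c) \<le> Suc (cnt K y)" using *[of y] by auto
    have "cnt Y (y - c) \<le> Suc (cnt K (y + 1))" using *[of "y + 1"] by simp
    then show "cnt Y (y - c) \<le> Suc (cnt K y)" using cnt_antimono[OF assms(1), of y "y + 1"] by linarith
    show "cnt K y \<le> cnt Y (y - 1 - c)"
      using *[of y] cnt_antimono[OF assms(2), of "y - 1 - c" "y - c"] by linarith
  qed
  moreover have ?i if ?l using i[OF d[OF that]] that unfolding l by blast
  ultimately show ?thesis using d by blast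
qed

definition balance :: "int \<Rightarrow> symbol \<Rightarrow> symbol \<Rightarrow> int \<Rightarrow> int" where
  "balance c \<Lambda> \<Lambda>' p = count_left (fst \<Lambda>) p + count_left (snd \<Lambda>) p
     - count_right c (fst \<Lambda>') p - count_right c (snd \<Lambda>') p"

text \<open>If \<open>d1\<close> and \<open>d2\<close> are the differences of the counting
functions for the two alternating pairs of rows (lower row of \<open>\<Lambda>\<close> and upper
row of \<open>\<Lambda>'\<close>, upper row of \<open>\<Lambda>\<close> and lower row of
\<open>\<Lambda>'\<close>), then \<open>balance\<close> is \<open>d1 + d2\<close> and
\<open>skew\<close> is \<open>d2 - d1\<close>.\<close>

definition skew :: "int \<Rightarrow> symbol \<Rightarrow> symbol \<Rightarrow> int \<Rightarrow> int" where
  "skew c \<Lambda> \<Lambda>' p = excess \<Lambda> ((p + 1) div 2) + excess \<Lambda>' (p div 2 - c)"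

lemma skew_eq: "skew c \<Lambda> \<Lambda>' p = (count_left (fst \<Lambda>) p - count_left (snd \<Lambda>) p)
   + (count_right c (fst \<Lambda>') p - count_right c (snd \<Lambda>') p)"
  by (simp add: skew_def excess_def count_left_def count_right_def)

text \<open>The translation for which the part of the line above any position far below contains
one more entry of \<open>\<Lambda>\<close> than of \<open>\<Lambda>'\<close>, if this position is
even.\<close>

definition offset :: "symbol \<Rightarrow> symbol \<Rightarrow> int" where
  "offset \<Lambda> \<Lambda>' = (int (sym_card \<Lambda>) - int (sym_card \<Lambda>') - 1) div 2"

text \<open>In terms of sum and difference, the unit square becomes a ball for the $\ell^1$ norm.\<close>

lemma unit_square_iff:
  fixes a b :: int
  shows "\<bar>b - a\<bar> + \<bar>a + b - 1\<bar> \<le> 1 \<longleftrightarrow> a \<in> {0, 1} \<and> b \<in> {0, 1}"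
  by auto

text \<open>The two pairs of rows alternate, and the two signs \<open>s\<close> correspond to the
two ways to choose which pair begins with an entry of \<open>\<Lambda>\<close> and which with an
entry of \<open>\<Lambda>'\<close>. The conditions on the defects are contained in the behaviour
of the counting functions far below.\<close>

lemma B_pm_iff:
  assumes L: "\<Lambda> \<in> symbol_class True n" and L': "\<Lambda>' \<in> symbol_class False n'"
  shows "(\<Lambda>, \<Lambda>') \<in> B_pm n n' \<longleftrightarrow> (\<exists>s\<in>{1, - 1}. \<forall>p.
     \<bar>balance (offset \<Lambda> \<Lambda>') \<Lambda> \<Lambda>' p\<bar> + \<bar>skew (offset \<Lambda> \<Lambda>') \<Lambda> \<Lambda>' p - s\<bar> \<le> 1)"
proof -
  define c where "c = offset \<Lambda> \<Lambda>'"
  have sym: "is_symbol \<Lambda>" "is_symbol \<Lambda>'" using L L' by (auto simp: symbol_class_def admissible_def)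
  note fin = finite_rows(1,2)[OF sym(1)] finite_rows(1,2)[OF sym(2)]
  have "odd (sym_card \<Lambda>)" "even (sym_card \<Lambda>')" using L L' sym_card_eq[OF sym(1)] sym_card_eq[OF sym(2)]
    by (auto simp: symbol_class_def)
  then have "int (sym_card \<Lambda>) - int (sym_card \<Lambda>') = 2 * c + 1" unfolding c_def offset_def by presburger
  then have c: "int (card (fst \<Lambda>)) + int (card (snd \<Lambda>)) - int (card (fst \<Lambda>')) - int (card (snd \<Lambda>')) = 2 * c + 1"
    by (simp add: sym_card_def)
  have Sp: "\<Lambda> \<in> S_Sp n" and O: "\<Lambda>' \<in> S_O Plus n' \<union> S_O Minus n'" using L L' S_Sp_eq S_O_eq by auto
  have "(\<Lambda>, \<Lambda>') \<in> B_eps Plus n n' \<longleftrightarrow>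
     row_partition (snd \<Lambda>) \<preceq>\<^sub>p row_partition (fst \<Lambda>') \<and>
     row_partition (snd \<Lambda>') \<preceq>\<^sub>p row_partition (fst \<Lambda>) \<and> defect \<Lambda>' = - defect \<Lambda> + 1"
  proof -
    have "\<Lambda>' \<in> S_O Plus n'" if "defect \<Lambda>' = - defect \<Lambda> + 1"
    proof -
      have "defect \<Lambda>' mod 4 = 0" using that Sp unfolding S_Sp_def by clarify presburger
      then show ?thesis using O by (auto simp: S_O_def)
    qed
    then show ?thesis using Sp by auto
  qed
  also have "\<dots> \<longleftrightarrow> (row_partition (snd \<Lambda>) \<preceq>\<^sub>p row_partition (fst \<Lambda>') \<and> int (card (snd \<Lambda>)) - int (card (fst \<Lambda>')) = c) \<and>
     (row_partition (snd \<Lambda>') \<preceq>\<^sub>p row_partition (fst \<Lambda>) \<and> int (card (fst \<Lambda>)) - int (card (snd \<Lambda>')) = c + 1)"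
    using c by (auto simp: defect_def)
  also have "\<dots> \<longleftrightarrow> (\<forall>p. count_right c (fst \<Lambda>') p - count_left (snd \<Lambda>) p \<in> {0, 1} \<and>
      count_left (fst \<Lambda>) p - count_right c (snd \<Lambda>') p \<in> {0, 1})"
    using alternating_right_iff[OF fin(2,3), of c] alternating_left_iff[OF fin(1,4), of c] by blast
  also have "\<dots> \<longleftrightarrow> (\<forall>p. \<bar>balance c \<Lambda> \<Lambda>' p\<bar> + \<bar>skew c \<Lambda> \<Lambda>' p - 1\<bar> \<le> 1)"
    unfolding unit_square_iff[symmetric] balance_def skew_eq by (simp add: algebra_simps)
  finally have plus: "(\<Lambda>, \<Lambda>') \<in> B_eps Plus n n' \<longleftrightarrow> (\<forall>p. \<bar>balance c \<Lambda> \<Lambda>' p\<bar> + \<bar>skew c \<Lambda> \<Lambda>' p - 1\<bar> \<le> 1)" .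
  have "(\<Lambda>, \<Lambda>') \<in> B_eps Minus n n' \<longleftrightarrow>
     row_partition (fst \<Lambda>') \<preceq>\<^sub>p row_partition (snd \<Lambda>) \<and>
     row_partition (fst \<Lambda>) \<preceq>\<^sub>p row_partition (snd \<Lambda>') \<and> defect \<Lambda>' = - defect \<Lambda> - 1"
  proof -
    have "\<Lambda>' \<in> S_O Minus n'" if "defect \<Lambda>' = - defect \<Lambda> - 1"
    proof -
      have "defect \<Lambda>' mod 4 = 2" using that Sp unfolding S_Sp_def by clarify presburger
      then show ?thesis using O by (auto simp: S_O_def)
    qed
    then show ?thesis using Sp by auto
  qed
  also have "\<dots> \<longleftrightarrow> (row_partition (fst \<Lambda>) \<preceq>\<^sub>p row_partition (snd \<Lambda>') \<and> int (card (fst \<Lambda>)) - int (card (snd \<Lambda>')) = c) \<and>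
     (row_partition (fst \<Lambda>') \<preceq>\<^sub>p row_partition (snd \<Lambda>) \<and> int (card (snd \<Lambda>)) - int (card (fst \<Lambda>')) = c + 1)"
    using c by (auto simp: defect_def)
  also have "\<dots> \<longleftrightarrow> (\<forall>p. count_right c (snd \<Lambda>') p - count_left (fst \<Lambda>) p \<in> {0, 1} \<and>
      count_left (snd \<Lambda>) p - count_right c (fst \<Lambda>') p \<in> {0, 1})"
    using alternating_right_iff[OF fin(1,4), of c] alternating_left_iff[OF fin(2,3), of c] by blast
  also have "\<dots> \<longleftrightarrow> (\<forall>p. \<bar>balance c \<Lambda> \<Lambda>' p\<bar> + \<bar>skew c \<Lambda> \<Lambda>' p - (- 1)\<bar> \<le> 1)"
  proof -
    have "\<bar>balance c \<Lambda> \<Lambda>' p\<bar> + \<bar>skew c \<Lambda> \<Lambda>' p - (- 1)\<bar> \<le> 1 \<longleftrightarrow>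
       count_right c (snd \<Lambda>') p - count_left (fst \<Lambda>) p \<in> {0, 1} \<and>
       count_left (snd \<Lambda>) p - count_right c (fst \<Lambda>') p \<in> {0, 1}" for p
      unfolding unit_square_iff[symmetric] balance_def skew_eq by (simp add: algebra_simps) linarith
    then show ?thesis by blast
  qed
  finally have minus: "(\<Lambda>, \<Lambda>') \<in> B_eps Minus n n' \<longleftrightarrow> (\<forall>p. \<bar>balance c \<Lambda> \<Lambda>' p\<bar> + \<bar>skew c \<Lambda> \<Lambda>' p - (- 1)\<bar> \<le> 1)" .
  show ?thesis using plus minus unfolding c_def[symmetric] B_pm_def by blast
qed

section \<open>Interlacing as a condition on flips\<close>

text \<open>The positions on the line of the elements of two sets of singles.\<close>

definition join :: "int \<Rightarrow> nat set \<Rightarrow> nat set \<Rightarrow> int set" where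
  "join c v v' = (\<lambda>t. 2 * int t) ` v \<union> (\<lambda>t. 2 * (int t + c) + 1) ` v'"

lemma card_join_filter:
  assumes "finite v" "finite v'"
  shows "card {u \<in> join c v v'. P u}
    = card {t \<in> v. P (2 * int t)} + card {t \<in> v'. P (2 * (int t + c) + 1)}"
proof -
  have eq: "{u \<in> join c v v'. P u} = (\<lambda>t. 2 * int t) ` {t \<in> v. P (2 * int t)} \<union>
     (\<lambda>t. 2 * (int t + c) + 1) ` {t \<in> v'. P (2 * (int t + c) + 1)}" by (auto simp: join_def)
  have "card {u \<in> join c v v'. P u} = card ((\<lambda>t. 2 * int t) ` {t \<in> v. P (2 * int t)}) +
     card ((\<lambda>t. 2 * (int t + c) + 1) ` {t \<in> v'. P (2 * (int t + c) + 1)})" unfolding eq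
    using assms by (intro card_Un_disjoint) (auto, presburger)
  also have "\<dots> = card {t \<in> v. P (2 * int t)} + card {t \<in> v'. P (2 * (int t + c) + 1)}"
    by (intro arg_cong2[of _ _ _ _ "(+)"] card_image inj_onI) auto
  finally show ?thesis .
qed

lemma finite_join: "finite v \<Longrightarrow> finite v' \<Longrightarrow> finite (join c v v')"
  by (simp add: join_def)

lemma card_join: "finite v \<Longrightarrow> finite v' \<Longrightarrow> card (join c v v') = card v + card v'"
  using card_join_filter[of v v' c "\<lambda>_. True"] by simp

lemma card_join_even: "finite v \<Longrightarrow> finite v' \<Longrightarrow> card {u \<in> join c v v'. even u} = card v"
  using card_join_filter[of v v' c even] by simp

lemma card_join_odd: "finite v \<Longrightarrow> finite v' \<Longrightarrow> card {u \<in> join c v v'. odd u} = card v'"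
  using card_join_filter[of v v' c odd] by simp

lemma card_upper_join:
  assumes "finite v" "finite v'"
  shows "card (upper (join c v v') p) = tally v ((p + 1) div 2) + tally v' (p div 2 - c)"
proof -
  have "p \<le> 2 * int t \<longleftrightarrow> (p + 1) div 2 \<le> int t" "p \<le> 2 * (int t + c) + 1 \<longleftrightarrow> p div 2 - c \<le> int t" for t
    by presburger+
  then show ?thesis unfolding upper_def card_join_filter[OF assms] tally_def by simp
qed

lemma join_mem:
  "2 * int t \<in> join c v v' \<longleftrightarrow> t \<in> v" "2 * (int t + c) + 1 \<in> join c v v' \<longleftrightarrow> t \<in> v'"
  by (auto simp: join_def) presburger+

lemma join_Int: "join c v v' \<inter> join c w w' = join c (v \<inter> w) (v' \<inter> w')"
proof -
  have "x \<in> join c w w' \<longleftrightarrow> x \<in> join c (v \<inter> w) (v' \<inter> w')" if "x \<in> join c v v'" for x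
  proof -
    from that consider t where "t \<in> v" "x = 2 * int t" | t where "t \<in> v'" "x = 2 * (int t + c) + 1"
      by (auto simp: join_def)
    then show ?thesis by cases (simp_all only: join_mem Int_iff, simp_all)
  qed
  moreover have "join c (v \<inter> w) (v' \<inter> w') \<subseteq> join c v v'" by (auto simp: join_def)
  ultimately show ?thesis by blast
qed

lemma join_subset_iff: "join c v v' \<subseteq> join c w w' \<longleftrightarrow> v \<subseteq> w \<and> v' \<subseteq> w'"
proof
  assume s: "join c v v' \<subseteq> join c w w'"
  show "v \<subseteq> w \<and> v' \<subseteq> w'"
  proof (intro conjI subsetI)
    fix t assume "t \<in> v" then show "t \<in> w" using s join_mem(1)[of t c] by blast
  next
    fix t assume "t \<in> v'" then show "t \<in> w'" using s join_mem(2)[of t c] by blast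
  qed
qed (auto simp: join_def)

lemma balance_eq:
  assumes "is_symbol \<Lambda>" "is_symbol \<Lambda>'"
  shows "balance c \<Lambda> \<Lambda>' p = 2 * count_left (doubles \<Lambda>) p - 2 * count_right c (doubles \<Lambda>') p
     + int (tally (singles \<Lambda>) ((p + 1) div 2)) - int (tally (singles \<Lambda>') (p div 2 - c))"
proof -
  have "cnt (fst L) x + cnt (snd L) x = 2 * cnt (doubles L) x + tally (singles L) x" if "is_symbol L" for L x
  proof -
    note fin = finite_rows[OF that]
    have 1: "{a \<in> fst L. x \<le> int a} \<inter> {a \<in> snd L. x \<le> int a} = {a \<in> doubles L. x \<le> int a}"
      and 2: "sym_diff {a \<in> fst L. x \<le> int a} {a \<in> snd L. x \<le> int a} = {a \<in> singles L. x \<le> int a}"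
      by (auto simp: doubles_def singles_def)
    show ?thesis using card_sym_diff[of "{a \<in> fst L. x \<le> int a}" "{a \<in> snd L. x \<le> int a}"] fin
      unfolding 1 2 by (simp add: cnt_def tally_def)
  qed
  from this[OF assms(1), of "(p + 1) div 2"] this[OF assms(2), of "p div 2 - c"]
  show ?thesis unfolding balance_def count_left_def count_right_def by linarith
qed

lemma balance_cong:
  assumes "is_symbol \<Lambda>" "is_symbol \<Lambda>'" "is_symbol \<Lambda>1" "is_symbol \<Lambda>1'"
    "doubles \<Lambda>1 = doubles \<Lambda>" "singles \<Lambda>1 = singles \<Lambda>" "doubles \<Lambda>1' = doubles \<Lambda>'" "singles \<Lambda>1' = singles \<Lambda>'"
  shows "balance c \<Lambda>1 \<Lambda>1' = balance c \<Lambda> \<Lambda>'"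
  using assms by (simp add: balance_eq fun_eq_iff)

lemma skew_mod_4:
  assumes "is_symbol \<Lambda>" "is_symbol \<Lambda>'"
  shows "4 dvd skew c \<Lambda> \<Lambda>' p - int (tally (singles \<Lambda>) ((p + 1) div 2) mod 2)
     - int (tally (singles \<Lambda>') (p div 2 - c) mod 2)
     - 2 * int (card (upper (join c (flips \<Lambda>) (flips \<Lambda>')) p))"
proof -
  have "card (upper (join c (flips \<Lambda>) (flips \<Lambda>')) p)
      = tally (flips \<Lambda>) ((p + 1) div 2) + tally (flips \<Lambda>') (p div 2 - c)"
    using finite_rows[OF assms(1)] finite_rows[OF assms(2)] by (simp add: card_upper_join)
  moreover note dvd_add[OF excess_mod_4[OF finite_rows(1,2)[OF assms(1)], of "(p + 1) div 2"]
    excess_mod_4[OF finite_rows(1,2)[OF assms(2)], of "p div 2 - c"]]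
  ultimately show ?thesis by (simp add: skew_def algebra_simps)
qed

lemma balance_skew_step:
  assumes "is_symbol \<Lambda>" "is_symbol \<Lambda>'"
  obtains (none) "balance c \<Lambda> \<Lambda>' p = balance c \<Lambda> \<Lambda>' (p + 1)" "skew c \<Lambda> \<Lambda>' p = skew c \<Lambda> \<Lambda>' (p + 1)"
  | (single) "\<bar>balance c \<Lambda> \<Lambda>' p - balance c \<Lambda> \<Lambda>' (p + 1)\<bar> = 1" "\<bar>skew c \<Lambda> \<Lambda>' p - skew c \<Lambda> \<Lambda>' (p + 1)\<bar> = 1"
  | (double) "\<bar>balance c \<Lambda> \<Lambda>' p - balance c \<Lambda> \<Lambda>' (p + 1)\<bar> = 2" "skew c \<Lambda> \<Lambda>' p = skew c \<Lambda> \<Lambda>' (p + 1)"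
proof -
  let ?D = "balance c \<Lambda> \<Lambda>'" and ?E = "skew c \<Lambda> \<Lambda>'"
  note fin = finite_rows(1,2)[OF assms(1)] finite_rows(1,2)[OF assms(2)]
  have st: "int (cnt K x) - int (cnt K (x + 1)) \<in> {0, 1}" if "finite K" for K x
    using cnt_step[OF that, of x] by auto
  have *: thesis if "D - D' = \<sigma> * (a + b)" "E - E' = a - b" "a \<in> {0, 1}" "b \<in> {0, 1}" "\<bar>\<sigma>\<bar> = 1"
    "D = ?D p" "D' = ?D (p + 1)" "E = ?E p" "E' = ?E (p + 1)"
    for D D' E E' \<sigma> a b :: int
  proof -
    have "(D = D' \<and> E = E') \<or> (\<bar>D - D'\<bar> = 1 \<and> \<bar>E - E'\<bar> = 1) \<or> (\<bar>D - D'\<bar> = 2 \<and> E = E')"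
      using that(1-5) by auto
    then show thesis using that(6-9) none single double by blast
  qed
  show ?thesis
  proof (cases "even p")
    case True
    then have l: "count_left K (p + 1) = int (cnt K ((p + 1) div 2 + 1))"
      and r: "count_right c K (p + 1) = count_right c K p" for K
    proof -
      have "(p + 1 + 1) div 2 = (p + 1) div 2 + 1" "(p + 1) div 2 = p div 2" using True by presburger+
      then show "count_left K (p + 1) = int (cnt K ((p + 1) div 2 + 1))"
        "count_right c K (p + 1) = count_right c K p" by (simp_all only: count_left_def count_right_def)
    qed
    show thesis
    proof (rule *[where \<sigma> = "1"
          and a = "int (cnt (fst \<Lambda>) ((p + 1) div 2)) - int (cnt (fst \<Lambda>) ((p + 1) div 2 + 1))"
          and b = "int (cnt (snd \<Lambda>) ((p + 1) div 2)) - int (cnt (snd \<Lambda>) ((p + 1) div 2 + 1))"])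
      show "?D p - ?D (p + 1) = 1 *
          (int (cnt (fst \<Lambda>) ((p + 1) div 2)) - int (cnt (fst \<Lambda>) ((p + 1) div 2 + 1)) + (int (cnt (snd \<Lambda>) ((p + 1) div 2)) - int (cnt (snd \<Lambda>) ((p + 1) div 2 + 1))))"
        unfolding balance_def skew_eq l r count_left_def[of _ p] by simp
      show "?E p - ?E (p + 1) =
          int (cnt (fst \<Lambda>) ((p + 1) div 2)) - int (cnt (fst \<Lambda>) ((p + 1) div 2 + 1)) - (int (cnt (snd \<Lambda>) ((p + 1) div 2)) - int (cnt (snd \<Lambda>) ((p + 1) div 2 + 1)))"
        unfolding balance_def skew_eq l r count_left_def[of _ p] by simp
    qed (use st fin in simp_all)
  next
    case False
    have l: "count_left K (p + 1) = count_left K p"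
      and r: "count_right c K (p + 1) = int (cnt K (p div 2 - c + 1))" for K
    proof -
      have "(p + 1 + 1) div 2 = (p + 1) div 2" "(p + 1) div 2 - c = p div 2 - c + 1" using False by presburger+
      then show "count_left K (p + 1) = count_left K p"
        "count_right c K (p + 1) = int (cnt K (p div 2 - c + 1))" by (simp_all only: count_left_def count_right_def)
    qed
    show thesis
    proof (rule *[where \<sigma> = "- 1"
          and a = "int (cnt (fst \<Lambda>') (p div 2 - c)) - int (cnt (fst \<Lambda>') (p div 2 - c + 1))"
          and b = "int (cnt (snd \<Lambda>') (p div 2 - c)) - int (cnt (snd \<Lambda>') (p div 2 - c + 1))"])
      show "?D p - ?D (p + 1) = - 1 *
          (int (cnt (fst \<Lambda>') (p div 2 - c)) - int (cnt (fst \<Lambda>') (p div 2 - c + 1)) + (int (cnt (snd \<Lambda>') (p div 2 - c)) - int (cnt (snd \<Lambda>') (p div 2 - c + 1))))"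
        unfolding balance_def skew_eq l r count_right_def[of _ _ p] by simp
      show "?E p - ?E (p + 1) =
          int (cnt (fst \<Lambda>') (p div 2 - c)) - int (cnt (fst \<Lambda>') (p div 2 - c + 1)) - (int (cnt (snd \<Lambda>') (p div 2 - c)) - int (cnt (snd \<Lambda>') (p div 2 - c + 1)))"
        unfolding balance_def skew_eq l r count_right_def[of _ _ p] by simp
    qed (use st fin in simp_all)
  qed
qed

lemma balance_skew_above:
  assumes "is_symbol \<Lambda>" "is_symbol \<Lambda>'"
  obtains b where "\<And>p. p \<ge> b \<Longrightarrow> balance c \<Lambda> \<Lambda>' p = 0 \<and> skew c \<Lambda> \<Lambda>' p = 0"
proof -
  have "\<exists>b. \<forall>x\<ge>b. cnt K x = 0" if fX: "finite K" for K
  proof -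
    obtain b where "b \<ge> 0" "\<And>x. x \<ge> b \<Longrightarrow> tally K x = 0" using tally_above[OF fX] by blast
    then show ?thesis by (intro exI[of _ b]) (simp add: cnt_def tally_def)
  qed
  note z = this
  note fin = finite_rows(1,2)[OF assms(1)] finite_rows(1,2)[OF assms(2)]
  obtain b1 b2 b3 b4 where b: "\<And>x. x \<ge> b1 \<Longrightarrow> cnt (fst \<Lambda>) x = 0" "\<And>x. x \<ge> b2 \<Longrightarrow> cnt (snd \<Lambda>) x = 0"
    "\<And>x. x \<ge> b3 \<Longrightarrow> cnt (fst \<Lambda>') x = 0" "\<And>x. x \<ge> b4 \<Longrightarrow> cnt (snd \<Lambda>') x = 0"
    using z[OF fin(1)] z[OF fin(2)] z[OF fin(3)] z[OF fin(4)] by blast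
  define m where "m = max (max b1 b2) (max (b3 + c) (b4 + c))"
  have "balance c \<Lambda> \<Lambda>' p = 0 \<and> skew c \<Lambda> \<Lambda>' p = 0" if "p \<ge> 2 * m" for p
  proof -
    have "(p + 1) div 2 \<ge> m" "p div 2 \<ge> m" using that by presburger+
    then have "(p + 1) div 2 \<ge> b1" "(p + 1) div 2 \<ge> b2" "p div 2 - c \<ge> b3" "p div 2 - c \<ge> b4"
      unfolding m_def by linarith+
    then show ?thesis using b by (simp add: balance_def skew_eq count_left_def count_right_def)
  qed
  then show ?thesis using that by blast
qed

text \<open>Where the balance is odd, the bound says \<open>skew = s\<close>, and modulo $4$ this
fixes the parity of the number of flips above; hence the parities at all such positions agree.
Conversely, congruence modulo $4$ is enough: going down the line, a single changes balance and
skew by $1$, and a double changes only the balance, by $2$. So when the balance becomes odd, the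
skew is congruent to \<open>s\<close> and within distance $2$ of it.\<close>

lemma skew_bound_iff_lagrangian:
  assumes L: "\<Lambda> \<in> symbol_class True n" and L': "\<Lambda>' \<in> symbol_class False n'"
  shows "(\<exists>s\<in>{1, - 1}. \<forall>p. \<bar>balance c \<Lambda> \<Lambda>' p\<bar> + \<bar>skew c \<Lambda> \<Lambda>' p - s\<bar> \<le> 1) \<longleftrightarrow>
    (\<forall>p. \<bar>balance c \<Lambda> \<Lambda>' p\<bar> \<le> 1) \<and>
    join c (flips \<Lambda>) (flips \<Lambda>') \<in> lagrangian (join c (singles \<Lambda>) (singles \<Lambda>'))"
proof -
  let ?U = "join c (singles \<Lambda>) (singles \<Lambda>')" and ?W = "join c (flips \<Lambda>) (flips \<Lambda>')"
  let ?D = "balance c \<Lambda> \<Lambda>'" and ?E = "skew c \<Lambda> \<Lambda>'"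
  have sym: "is_symbol \<Lambda>" "is_symbol \<Lambda>'" using L L' by (auto simp: symbol_class_def admissible_def)
  note fin = finite_rows(3,5)[OF sym(1)] finite_rows(3,5)[OF sym(2)]
  have cards: "odd (card (singles \<Lambda>))" "even (card (singles \<Lambda>'))" "even (card (flips \<Lambda>))"
    using L L' by (auto simp: symbol_class_def admissible_def swap_sets_def)
  have U: "finite ?U" "odd (card ?U)" using finite_join card_join fin cards by auto
  have parity: "odd (card (upper ?U p)) \<longleftrightarrow> odd (?D p)" for p
    using fin by (simp add: card_upper_join balance_eq[OF sym])
  \<comment> \<open>At an odd position exactly one of the two special symbols has excess 1.\<close>
  have mod4: "4 dvd ?E p - 1 - 2 * int (card (upper ?W p))" if "odd (card (upper ?U p))" for p
  proof -
    have "odd (tally (singles \<Lambda>) ((p + 1) div 2) + tally (singles \<Lambda>') (p div 2 - c))"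
      using that fin by (simp add: card_upper_join)
    then have "int (tally (singles \<Lambda>) ((p + 1) div 2) mod 2) + int (tally (singles \<Lambda>') (p div 2 - c) mod 2) = 1"
      by presburger
    then show ?thesis using skew_mod_4[OF sym, of c p] by (simp add: algebra_simps)
  qed
  have WU: "?W \<subseteq> ?U" "even (card {u \<in> ?W. even u})"
    using flips_subset fin cards by (simp_all add: join_subset_iff card_join_even)
  show ?thesis
  proof
    assume "\<exists>s\<in>{1, - 1}. \<forall>p. \<bar>?D p\<bar> + \<bar>?E p - s\<bar> \<le> 1"
    then obtain s where s: "s \<in> {1, -1}" "\<And>p. \<bar>?D p\<bar> + \<bar>?E p - s\<bar> \<le> 1" by blast
    have D: "\<bar>?D p\<bar> \<le> 1" for p using s(2)[of p] by linarith
    have "even (card (upper ?W p)) \<longleftrightarrow> s = 1" if "odd (card (upper ?U p))" for p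
    proof -
      have "odd (?D p)" using that parity by blast
      then have "?D p \<noteq> 0" by (metis dvd_0_right)
      then have "?E p = s" using s(2)[of p] by linarith
      then have "4 dvd s - 1 - 2 * int (card (upper ?W p))" using mod4[OF that] by (simp only:)
      moreover have "s = 1 \<or> s = - 1" using s(1) by blast
      ultimately show ?thesis by presburger
    qed
    then have "?W \<in> lagrangian ?U" using WU by (simp add: lagrangian_def)
    then show "(\<forall>p. \<bar>?D p\<bar> \<le> 1) \<and> ?W \<in> lagrangian ?U" using D by blast
  next
    assume r: "(\<forall>p. \<bar>?D p\<bar> \<le> 1) \<and> ?W \<in> lagrangian ?U"
    define s :: int where "s = (if even (card ?W) then 1 else - 1)"
    have odd4: "4 dvd ?E p - s" if "odd (?D p)" for p
    proof -
      have "odd (card (upper ?W p)) \<longleftrightarrow> odd (card ?W)" using lagrangian_odd_card[OF U] r that parity by blast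
      moreover have m: "4 dvd ?E p - 1 - 2 * int (card (upper ?W p))" using mod4 that parity by blast
      ultimately show ?thesis
      proof (cases "even (card ?W)")
        case True
        then have "even (card (upper ?W p))" using \<open>odd (card (upper ?W p)) \<longleftrightarrow> odd (card ?W)\<close> by blast
        then obtain k where k: "card (upper ?W p) = 2 * k" by blast
        have "4 dvd (?E p - 1 - 2 * int (card (upper ?W p))) + 4 * int k" by (intro dvd_add m) simp
        then show ?thesis using True by (simp add: s_def k)
      next
        case False
        then have "odd (card (upper ?W p))" using \<open>odd (card (upper ?W p)) \<longleftrightarrow> odd (card ?W)\<close> by blast
        then obtain k where k: "card (upper ?W p) = 2 * k + 1" using oddE by blast
        have "4 dvd (?E p - 1 - 2 * int (card (upper ?W p))) + 4 * (int k + 1)" by (intro dvd_add m) simp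
        then show ?thesis using False by (simp add: s_def k algebra_simps)
      qed
    qed
    obtain b where b: "\<And>p. p \<ge> b \<Longrightarrow> ?D p = 0 \<and> ?E p = 0" using balance_skew_above[OF sym] by blast
    have "\<bar>?D p\<bar> + \<bar>?E p - s\<bar> \<le> 1" for p
    proof (induction p rule: int_downward_induct[of b])
      case (1 q)
      then show ?case using b by (simp add: s_def)
    next
      case (2 q)
      have Dq: "\<bar>?D q\<bar> \<le> 1" using r by blast
      note IH = 2
      show ?case
      proof (cases rule: balance_skew_step[OF sym, of c q])
        case 1
        then show ?thesis using IH by simp
      next
        case step: 2
        show ?thesis
        proof (cases "?D (q + 1) = 0")
          case True
          then have "odd (?D q)" using step(1) by presburger
          then obtain k where k: "?E q - s = 4 * k" using odd4[of q] by blast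
          have "\<bar>?E q - s\<bar> \<le> 2" using step(2) IH True by linarith
          then have "k = 0" using k by linarith
          then show ?thesis using k Dq by simp
        next
          case False
          then show ?thesis using step IH Dq by linarith
        qed
      next
        case 3
        then show ?thesis using IH Dq by linarith
      qed
    qed
    then show "\<exists>s\<in>{1, - 1}. \<forall>p. \<bar>?D p\<bar> + \<bar>?E p - s\<bar> \<le> 1" by (intro bexI[of _ s]) (auto simp: s_def)
  qed
qed

section \<open>Fourier invariance of the relation between symbols\<close>

text \<open>The mixed terms of the product of cardinalities vanish modulo $2$ because the number
of flips is even on the symplectic side.\<close>

lemma pairing_join:
  assumes fin: "finite v" "finite v'" "finite w" "finite w'" and ev: "even (card v)" "even (card w)"
  shows "even (pairing (join c v v') (join c w w')) \<longleftrightarrow> even (pairing v w + pairing v' w')"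
  using fin ev by (simp add: pairing_def card_join join_Int algebra_simps)

lemma bij_betw_join:
  assumes fin: "finite T" "finite T'" and T: "odd (card T)" "even (card T')"
  shows "bij_betw (\<lambda>(w, w'). join c w w') (swap_sets T \<times> swap_sets T') (even_sets (join c T T'))"
proof -
  let ?g = "\<lambda>W. ({t. 2 * int t \<in> W}, {t. 2 * (int t + c) + 1 \<in> W})"
  show ?thesis
  proof (rule bij_betw_byWitness[where f' = ?g])
  have inv: "W = join c {t. 2 * int t \<in> W} {t. 2 * (int t + c) + 1 \<in> W}" if "W \<subseteq> join c T T'" for W
    using that by (auto simp: join_def)
  have finw: "finite w" "finite w'" if "w \<subseteq> T" "w' \<subseteq> T'" for w w' using fin that finite_subset by auto
  show "\<forall>a\<in>swap_sets T \<times> swap_sets T'.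
      ?g (case a of (w, w') \<Rightarrow> join c w w') = a"
    by (rule ballI, erule SigmaE) (simp only: prod.case join_mem Collect_mem_eq)
  show "\<forall>W\<in>even_sets (join c T T').
      (case ({t. 2 * int t \<in> W}, {t. 2 * (int t + c) + 1 \<in> W}) of (w, w') \<Rightarrow> join c w w') = W"
    using inv by (auto simp: even_sets_def)
  show "(\<lambda>(w, w'). join c w w') ` (swap_sets T \<times> swap_sets T') \<subseteq> even_sets (join c T T')"
  proof (intro subsetI, elim imageE SigmaE)
    fix x a w w' assume x: "x = (case a of (w, w') \<Rightarrow> join c w w')" "a = (w, w')"
      and w: "w \<in> swap_sets T" "w' \<in> swap_sets T'"
    have "w \<subseteq> T" "w' \<subseteq> T'" "even (card w)" using w T by (auto simp: swap_sets_def)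
    then show "x \<in> even_sets (join c T T')"
      using finw[of w w'] by (simp add: x even_sets_def join_subset_iff card_join_even)
  qed
  show "?g ` even_sets (join c T T')
      \<subseteq> swap_sets T \<times> swap_sets T'"
  proof (intro subsetI, elim imageE)
    fix x W assume W: "W \<in> even_sets (join c T T')" and x: "x = ({t. 2 * int t \<in> W}, {t. 2 * (int t + c) + 1 \<in> W})"
    let ?w = "{t. 2 * int t \<in> W}" and ?w' = "{t. 2 * (int t + c) + 1 \<in> W}"
    have WU: "W \<subseteq> join c T T'" using W by (simp add: even_sets_def)
    have sub: "?w \<subseteq> T" "?w' \<subseteq> T'" using subsetD[OF WU] join_mem[of _ c T T'] by blast+
    have "even (card ?w)" using W card_join_even[OF finw[OF sub], of c] inv[OF WU]
      unfolding even_sets_def by simp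
    then show "x \<in> swap_sets T \<times> swap_sets T'" using sub T unfolding x swap_sets_def by simp
  qed
qed
qed

text \<open>On a pair of families the relation is the condition that the flips lie in the
self-dual space \<open>lagrangian\<close>, unless the balance exceeds $1$ somewhere and the
relation is empty. The normalizing factor is the cardinality of the self-dual space, so that the
indicator function is reproduced exactly.\<close>

theorem B_pm_fourier:
  assumes fin: "finite (symbol_class True n)" "finite (symbol_class False n')"
    and L: "\<Lambda> \<in> symbol_class True n" and L': "\<Lambda>' \<in> symbol_class False n'"
  shows "(\<Sum>\<Lambda>1\<in>symbol_class True n. \<Sum>\<Lambda>1'\<in>symbol_class False n'.
      fourier \<Lambda> \<Lambda>1 * (fourier \<Lambda>' \<Lambda>1' * of_bool ((\<Lambda>1, \<Lambda>1') \<in> B_pm n n')))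
    = of_bool ((\<Lambda>, \<Lambda>') \<in> B_pm n n')"
proof -
  let ?T = "singles \<Lambda>" and ?T' = "singles \<Lambda>'" and ?v = "flips \<Lambda>" and ?v' = "flips \<Lambda>'"
  let ?s = "symbol_of (doubles \<Lambda>) ?T" and ?s' = "symbol_of (doubles \<Lambda>') ?T'"
  define c where "c = offset \<Lambda> \<Lambda>'"
  let ?U = "join c ?T ?T'"
  define bal where "bal \<longleftrightarrow> (\<forall>p. \<bar>balance c \<Lambda> \<Lambda>' p\<bar> \<le> 1)"
  have ad: "admissible \<Lambda>" "admissible \<Lambda>'" and odd: "odd (card ?T)" "even (card ?T')"
    using L L' by (auto simp: symbol_class_def)
  then have sym: "is_symbol \<Lambda>" "is_symbol \<Lambda>'" by (auto simp: admissible_def)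
  note finT = finite_rows(3)[OF sym(1)] finite_rows(3)[OF sym(2)]
  have v: "?v \<in> swap_sets ?T" "?v' \<in> swap_sets ?T'" using ad by (auto simp: admissible_def)
  have U: "finite ?U" "odd (card {u \<in> ?U. even u})" "even (card {u \<in> ?U. odd u})"
    using finT odd by (simp_all add: finite_join card_join_even card_join_odd)
  define N :: complex where "N = 2 ^ (card ?T div 2) * 2 ^ (card ?T' div 2)"
  have N: "N \<noteq> 0" by (simp add: N_def)
  have mem: "(?s w, ?s' w') \<in> B_pm n n' \<longleftrightarrow> bal \<and> join c w w' \<in> lagrangian ?U"
    if w: "w \<in> swap_sets ?T" "w' \<in> swap_sets ?T'" for w w'
  proof -
    have sub: "w \<subseteq> ?T" "w' \<subseteq> ?T'" using w by (auto simp: swap_sets_def)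
    note inv = symbol_of_inverse[OF doubles_singles_disjoint sub(1)] symbol_of_inverse[OF doubles_singles_disjoint sub(2)]
    have sym': "is_symbol (?s w)" "is_symbol (?s' w')" using is_symbol_symbol_of sym sub by auto
    have "offset (?s w) (?s' w') = c"
      unfolding c_def offset_def using sym sym' inv by (simp add: sym_card_eq)
    moreover have "balance c (?s w) (?s' w') = balance c \<Lambda> \<Lambda>'"
      by (rule balance_cong) (use sym sym' inv in auto)
    ultimately show ?thesis
      using B_pm_iff[OF symbol_of_class[OF L w(1)] symbol_of_class[OF L' w(2)]]
        skew_bound_iff_lagrangian[OF symbol_of_class[OF L w(1)] symbol_of_class[OF L' w(2)], of c] inv
      by (simp add: bal_def)
  qed
  have main: "(\<Lambda>, \<Lambda>') \<in> B_pm n n' \<longleftrightarrow> bal \<and> join c ?v ?v' \<in> lagrangian ?U"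
    using mem[OF v] by (simp add: symbol_of_flips)
  have sign: "(- 1) ^ pairing ?v w * (- 1) ^ pairing ?v' w' = (- 1 :: complex) ^ pairing (join c ?v ?v') (join c w w')"
    if w: "w \<in> swap_sets ?T" "w' \<in> swap_sets ?T'" for w w'
  proof -
    have "finite w" "finite w'" "even (card w)" "even (card ?v)"
      using w v odd finT finite_subset by (auto simp: swap_sets_def)
    moreover have "finite ?v" "finite ?v'" using finite_rows sym by blast+
    ultimately have "even (pairing (join c ?v ?v') (join c w w')) \<longleftrightarrow> even (pairing ?v w + pairing ?v' w')"
      by (intro pairing_join)
    then show ?thesis by (simp add: minus_one_power_iff)
  qed
  have vU: "join c ?v ?v' \<in> even_sets ?U"
    using bij_betwE[OF bij_betw_join[OF finT odd, of c], rule_format, of "(?v, ?v')"] v by simp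
  have cardL: "of_nat (card (lagrangian ?U)) = N"
  proof -
    have "card (lagrangian ?U) * card (lagrangian ?U) = card (even_sets ?U)" by (rule card_lagrangian[OF U])
    also have "\<dots> = card (swap_sets ?T \<times> swap_sets ?T')"
      using bij_betw_same_card[OF bij_betw_join[OF finT odd, of c]] by simp
    also have "\<dots> = 4 ^ (card ?T div 2) * 4 ^ (card ?T' div 2)"
      by (simp add: card_cartesian_product card_swap_sets finT)
    also have "\<dots> = (2 ^ (card ?T div 2) * 2 ^ (card ?T' div 2)) ^ 2"
      by (simp add: power_mult_distrib flip: power_mult) (simp add: mult.commute power_mult)
    finally have "card (lagrangian ?U) ^ 2 = (2 ^ (card ?T div 2) * 2 ^ (card ?T' div 2)) ^ 2" by (simp add: power2_eq_square)
    then have "card (lagrangian ?U) = 2 ^ (card ?T div 2) * 2 ^ (card ?T' div 2)" by (simp only: power2_eq_iff_nonneg zero_le)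
    then show ?thesis by (simp add: N_def)
  qed
  have "(\<Sum>\<Lambda>1\<in>symbol_class True n. \<Sum>\<Lambda>1'\<in>symbol_class False n'.
      fourier \<Lambda> \<Lambda>1 * (fourier \<Lambda>' \<Lambda>1' * of_bool ((\<Lambda>1, \<Lambda>1') \<in> B_pm n n')))
    = (\<Sum>w\<in>swap_sets ?T. (- 1) ^ pairing ?v w / 2 ^ (card ?T div 2) *
        (\<Sum>w'\<in>swap_sets ?T'. (- 1) ^ pairing ?v' w' / 2 ^ (card ?T' div 2) * of_bool ((?s w, ?s' w') \<in> B_pm n n')))"
    by (simp only: sum_distrib_left[symmetric] sum_fourier[OF fin(1) L] sum_fourier[OF fin(2) L'])
  also have "\<dots> = (\<Sum>w\<in>swap_sets ?T. \<Sum>w'\<in>swap_sets ?T'.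
       (- 1) ^ pairing (join c ?v ?v') (join c w w') * of_bool (bal \<and> join c w w' \<in> lagrangian ?U) / N)"
    unfolding sum_distrib_left
  proof (intro sum.cong refl)
    fix w w' assume w: "w \<in> swap_sets ?T" "w' \<in> swap_sets ?T'"
    show "(- 1) ^ pairing ?v w / 2 ^ (card ?T div 2) * ((- 1) ^ pairing ?v' w' / 2 ^ (card ?T' div 2) *
         of_bool ((?s w, ?s' w') \<in> B_pm n n'))
       = (- 1) ^ pairing (join c ?v ?v') (join c w w') * of_bool (bal \<and> join c w w' \<in> lagrangian ?U) / N"
      unfolding mem[OF w] sign[OF w, symmetric] N_def by simp
  qed
  also have "\<dots> = (\<Sum>W\<in>even_sets ?U. (- 1) ^ pairing (join c ?v ?v') W * of_bool (bal \<and> W \<in> lagrangian ?U) / N)"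
    unfolding sum.cartesian_product
    using sum.reindex_bij_betw[OF bij_betw_join[OF finT odd, of c],
      of "\<lambda>W. (- 1) ^ pairing (join c ?v ?v') W * of_bool (bal \<and> W \<in> lagrangian ?U) / N"]
    by (simp add: case_prod_beta)
  also have "\<dots> = (\<Sum>W\<in>lagrangian ?U. (- 1) ^ pairing (join c ?v ?v') W * of_bool bal / N)"
  proof (rule sum.mono_neutral_cong_right)
    show "finite (even_sets ?U)" by (rule finite_subset[of _ "Pow ?U"]) (use U(1) in \<open>auto simp: even_sets_def\<close>)
  qed (use lagrangian_subset in auto)
  also have "\<dots> = (\<Sum>W\<in>lagrangian ?U. (- 1) ^ pairing (join c ?v ?v') W) * (of_bool bal / N)"
    by (simp add: sum_divide_distrib)
  also have "\<dots> = of_bool (bal \<and> join c ?v ?v' \<in> lagrangian ?U)"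
    unfolding fourier_lagrangian_card[OF U vU] cardL using N by simp
  finally show ?thesis unfolding main .
qed

section \<open>Orthogonality of irreducible characters\<close>

lemma mat_trace_mult_commute:
  fixes A B :: "complex mat"
  assumes "A \<in> carrier_mat m n" "B \<in> carrier_mat n m"
  shows "mat_trace (A * B) = mat_trace (B * A)"
proof -
  have "mat_trace (A * B) = (\<Sum>i<m. \<Sum>j<n. A $$ (i, j) * B $$ (j, i))"
    using assms by (auto simp: mat_trace_def scalar_prod_def lessThan_atLeast0 intro!: sum.cong)
  also have "\<dots> = (\<Sum>j<n. \<Sum>i<m. A $$ (i, j) * B $$ (j, i))" by (rule sum.swap)
  also have "\<dots> = mat_trace (B * A)"
    using assms by (auto simp: mat_trace_def scalar_prod_def lessThan_atLeast0 mult.commute intro!: sum.cong)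
  finally show ?thesis .
qed

lemma mat_eqI_mult_vec:
  fixes A B :: "complex mat"
  assumes A: "A \<in> carrier_mat m n" and B: "B \<in> carrier_mat m n"
    and eq: "\<And>v. v \<in> carrier_vec n \<Longrightarrow> A *\<^sub>v v = B *\<^sub>v v"
  shows "A = B"
proof (rule mat_col_eqI)
  fix j assume "j < dim_col B"
  then have j: "j < n" using B by simp
  have "col M j = M *\<^sub>v unit_vec n j" if "M \<in> carrier_mat m n" for M :: "complex mat"
    using that j by (intro eq_vecI) (auto simp: scalar_prod_right_unit)
  then show "col A j = col B j" using A B eq[of "unit_vec n j"] by simp
qed (use A B in auto)

text \<open>Kernel and image of the intertwiner are invariant subspaces. A right inverse is built
from preimages of the unit vectors, and it is a left inverse since the kernel is zero.\<close>

lemma schur_intertwiner_invertible: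
  assumes \<rho>: "irreducible_rep G d \<rho>" and \<sigma>: "irreducible_rep G e \<sigma>"
    and P: "P \<in> carrier_mat e d" "P \<noteq> 0\<^sub>m e d"
    and com: "\<And>x. x \<in> carrier G \<Longrightarrow> \<sigma> x * P = P * \<rho> x"
  obtains Q where "Q \<in> carrier_mat d e" "P * Q = 1\<^sub>m e" "Q * P = 1\<^sub>m d"
proof -
  have rc: "\<rho> x \<in> carrier_mat d d" and sc: "\<sigma> x \<in> carrier_mat e e" if "x \<in> carrier G" for x
    using that \<rho> \<sigma> by (auto simp: irreducible_rep_def representation_def)
  have com_vec: "\<sigma> x *\<^sub>v (P *\<^sub>v v) = P *\<^sub>v (\<rho> x *\<^sub>v v)" if x: "x \<in> carrier G" and v: "v \<in> carrier_vec d" for x v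
    using assoc_mult_mat_vec[OF sc[OF x] P(1) v] assoc_mult_mat_vec[OF P(1) rc[OF x] v] com[OF x] by simp
  have P0: "P = 0\<^sub>m e d" if "\<And>v. v \<in> carrier_vec d \<Longrightarrow> P *\<^sub>v v = 0\<^sub>v e"
    by (rule mat_eqI_mult_vec[OF P(1)]) (use that in auto)
  define K where "K = {v \<in> carrier_vec d. P *\<^sub>v v = 0\<^sub>v e}"
  have "linear_subspace d K"
    using P(1) unfolding linear_subspace_def K_def
    by (auto simp: mult_add_distrib_mat_vec[OF P(1)] mult_mat_vec[OF P(1)])
  moreover have "\<rho> x *\<^sub>v v \<in> K" if x: "x \<in> carrier G" and v: "v \<in> K" for x v
  proof -
    have vd: "v \<in> carrier_vec d" "P *\<^sub>v v = 0\<^sub>v e" using v by (auto simp: K_def)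
    have "\<rho> x *\<^sub>v v \<in> carrier_vec d" using mult_mat_vec_carrier[OF rc[OF x] vd(1)] .
    moreover have "\<sigma> x *\<^sub>v 0\<^sub>v e = 0\<^sub>v e" using sc[OF x] by auto
    ultimately show ?thesis using com_vec[OF x vd(1)] vd(2) by (simp add: K_def)
  qed
  ultimately have "K = {0\<^sub>v d} \<or> K = carrier_vec d" using \<rho> unfolding irreducible_rep_def by blast
  moreover have "K \<noteq> carrier_vec d" using P0 P(2) by (auto simp: K_def)
  ultimately have K: "K = {0\<^sub>v d}" by simp
  define I where "I = (*\<^sub>v) P ` carrier_vec d"
  have "linear_subspace e I" unfolding linear_subspace_def
  proof (intro conjI ballI allI)
    show "I \<subseteq> carrier_vec e" using P(1) by (auto simp: I_def)
    show "0\<^sub>v e \<in> I" unfolding I_def using P(1) by (intro image_eqI[of _ _ "0\<^sub>v d"]) auto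
  next
    fix u v assume "u \<in> I" "v \<in> I"
    then obtain u' v' where "u = P *\<^sub>v u'" "v = P *\<^sub>v v'" "u' \<in> carrier_vec d" "v' \<in> carrier_vec d"
      by (auto simp: I_def)
    then show "u + v \<in> I" unfolding I_def
      by (intro image_eqI[of _ _ "u' + v'"]) (auto simp: mult_add_distrib_mat_vec[OF P(1)])
  next
    fix c v assume "v \<in> I"
    then obtain v' where "v = P *\<^sub>v v'" "v' \<in> carrier_vec d" by (auto simp: I_def)
    then show "c \<cdot>\<^sub>v v \<in> I" unfolding I_def
      by (intro image_eqI[of _ _ "c \<cdot>\<^sub>v v'"]) (auto simp: mult_mat_vec[OF P(1)])
  qed
  moreover have "\<sigma> x *\<^sub>v v \<in> I" if x: "x \<in> carrier G" and v: "v \<in> I" for x v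
  proof -
    obtain v' where v': "v = P *\<^sub>v v'" "v' \<in> carrier_vec d" using v by (auto simp: I_def)
    have "\<rho> x *\<^sub>v v' \<in> carrier_vec d" using mult_mat_vec_carrier[OF rc[OF x] v'(2)] .
    then show ?thesis using com_vec[OF x v'(2)] v'(1) by (auto simp: I_def)
  qed
  ultimately have "I = {0\<^sub>v e} \<or> I = carrier_vec e" using \<sigma> unfolding irreducible_rep_def by blast
  moreover have "I \<noteq> {0\<^sub>v e}" using P0 P(2) by (auto simp: I_def)
  ultimately have I: "I = carrier_vec e" by simp
  have "\<exists>w. w \<in> carrier_vec d \<and> P *\<^sub>v w = unit_vec e j" for j
  proof -
    have "unit_vec e j \<in> I" using I by simp
    then show ?thesis unfolding I_def by force
  qed
  then obtain f where f: "\<And>j. f j \<in> carrier_vec d" "\<And>j. P *\<^sub>v f j = unit_vec e j" by metis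
  define Q where "Q = mat_of_cols d (map f [0..<e])"
  have Q: "Q \<in> carrier_mat d e" using mat_of_cols_carrier(1)[of d "map f [0..<e]"] by (simp add: Q_def)
  have PQ: "P * Q = 1\<^sub>m e"
  proof (rule mat_col_eqI)
    fix j assume "j < dim_col (1\<^sub>m e :: complex mat)"
    then have j: "j < e" by simp
    have "col Q j = f j" using j f(1) by (simp add: Q_def)
    then show "col (P * Q) j = col (1\<^sub>m e) j" using j f(2)[of j] col_mult2[OF P(1) Q j] by simp
  qed (use P Q in auto)
  have QP: "Q * P = 1\<^sub>m d"
  proof (rule mat_eqI_mult_vec[of _ d d])
    fix v :: "complex vec" assume v: "v \<in> carrier_vec d"
    let ?w = "Q *\<^sub>v (P *\<^sub>v v)"
    have Pv: "P *\<^sub>v v \<in> carrier_vec e" using mult_mat_vec_carrier[OF P(1) v] .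
    have w: "?w \<in> carrier_vec d" using mult_mat_vec_carrier[OF Q Pv] .
    have "P *\<^sub>v ?w = P *\<^sub>v v"
      using assoc_mult_mat_vec[OF P(1) Q Pv] PQ Pv by simp
    then have "P *\<^sub>v (?w - v) = 0\<^sub>v e" using mult_minus_distrib_mat_vec[OF P(1) w v] Pv by simp
    then have "?w - v \<in> K" using w v by (simp add: K_def)
    then have z: "?w - v = 0\<^sub>v d" using K by simp
    have "?w = v"
    proof (rule eq_vecI)
      fix i assume "i < dim_vec v"
      then have i: "i < d" using v by simp
      then have "(?w - v) $ i = 0" unfolding z by simp
      then show "?w $ i = v $ i" using i v w by simp
    qed (use Q w v in auto)
    then show "Q * P *\<^sub>v v = 1\<^sub>m d *\<^sub>v v" using assoc_mult_mat_vec[OF Q P(1) v] v by simp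
  qed (use P Q in auto)
  show ?thesis using that[OF Q PQ QP] .
qed

lemma intertwined_traces_eq:
  assumes \<rho>: "irreducible_rep G d \<rho>" and \<sigma>: "irreducible_rep G e \<sigma>"
    and P: "P \<in> carrier_mat e d" "P \<noteq> 0\<^sub>m e d"
    and com: "\<And>x. x \<in> carrier G \<Longrightarrow> \<sigma> x * P = P * \<rho> x" and x: "x \<in> carrier G"
  shows "mat_trace (\<sigma> x) = mat_trace (\<rho> x)"
proof -
  obtain Q where Q: "Q \<in> carrier_mat d e" "P * Q = 1\<^sub>m e" "Q * P = 1\<^sub>m d"
    using schur_intertwiner_invertible[OF \<rho> \<sigma> P com] by blast
  have rc: "\<rho> x \<in> carrier_mat d d" and sc: "\<sigma> x \<in> carrier_mat e e"
    using x \<rho> \<sigma> by (auto simp: irreducible_rep_def representation_def)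
  have "\<sigma> x = \<sigma> x * (P * Q)" using sc Q by simp
  also have "\<dots> = (\<sigma> x * P) * Q" using sc P(1) Q(1) by (simp add: assoc_mult_mat[of _ e e _ d _ e])
  also have "\<dots> = (P * \<rho> x) * Q" using com[OF x] by simp
  finally have "mat_trace (\<sigma> x) = mat_trace ((P * \<rho> x) * Q)" by simp
  also have "\<dots> = mat_trace (Q * (P * \<rho> x))"
    using P(1) Q(1) rc by (intro mat_trace_mult_commute[of _ e d]) auto
  also have "Q * (P * \<rho> x) = (Q * P) * \<rho> x" using P(1) Q(1) rc by (simp add: assoc_mult_mat[of _ d e _ d _ d])
  also have "\<dots> = \<rho> x" using Q(3) rc by simp
  finally show ?thesis .
qed

text \<open>Subtracting an eigenvalue times the identity leaves an intertwiner that is not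
invertible.\<close>

lemma schur_scalar:
  assumes \<rho>: "irreducible_rep G d \<rho>" and P: "P \<in> carrier_mat d d"
    and com: "\<And>x. x \<in> carrier G \<Longrightarrow> \<rho> x * P = P * \<rho> x"
  obtains c where "P = c \<cdot>\<^sub>m 1\<^sub>m d"
proof -
  have d: "d > 0" using \<rho> by (simp add: irreducible_rep_def)
  have rc: "\<rho> x \<in> carrier_mat d d" if "x \<in> carrier G" for x
    using that \<rho> by (auto simp: irreducible_rep_def representation_def)
  obtain c where "eigenvalue P c" using spectrum_non_empty[OF P d] by (auto simp: spectrum_def)
  then obtain v where v: "v \<in> carrier_vec d" "v \<noteq> 0\<^sub>v d" "P *\<^sub>v v = c \<cdot>\<^sub>v v"
    using P by (auto simp: eigenvalue_def eigenvector_def)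
  define M where "M = P - c \<cdot>\<^sub>m 1\<^sub>m d"
  have M: "M \<in> carrier_mat d d" unfolding M_def by (rule minus_carrier_mat) simp
  have comM: "\<rho> x * M = M * \<rho> x" if x: "x \<in> carrier G" for x
    using com[OF x] rc[OF x] P unfolding M_def
    by (simp add: mult_minus_distrib_mat[of _ d d _ d] minus_mult_distrib_mat[of _ d d _ _ d]
      mult_smult_distrib[of _ d d _ d] mult_smult_assoc_mat[of _ d d _ d])
  have "M = 0\<^sub>m d d"
  proof (rule ccontr)
    assume "M \<noteq> 0\<^sub>m d d"
    then obtain Q where Q: "Q \<in> carrier_mat d d" "Q * M = 1\<^sub>m d"
      using schur_intertwiner_invertible[OF \<rho> \<rho> M _ comM] by blast
    have "(c \<cdot>\<^sub>m 1\<^sub>m d) *\<^sub>v v = c \<cdot>\<^sub>v v"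
      using v(1) by (intro eq_vecI) (auto simp: row_smult)
    then have "M *\<^sub>v v = 0\<^sub>v d" unfolding M_def using P v
      by (simp add: minus_mult_distrib_mat_vec[of _ d d])
    then have "Q * M *\<^sub>v v = 0\<^sub>v d" using assoc_mult_mat_vec[OF Q(1) M v(1)] Q(1) by auto
    then show False using Q(2) v by simp
  qed
  then have "P = c \<cdot>\<^sub>m 1\<^sub>m d" using P unfolding M_def by (intro eq_matI) (auto simp: mat_eq_iff)
  then show ?thesis by (rule that)
qed

text \<open>The average (without the factor $1/|G|$) over the group of the elementary matrix with
entry $1$ at \<open>(a, b)\<close>.\<close>

definition averaged :: "('g, 'b) monoid_scheme \<Rightarrow> nat \<Rightarrow> nat \<Rightarrow> ('g \<Rightarrow> complex mat) \<Rightarrow> ('g \<Rightarrow> complex mat)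
    \<Rightarrow> nat \<Rightarrow> nat \<Rightarrow> complex mat" where
  "averaged G e d \<sigma> \<rho> a b = mat e d (\<lambda>(i, j). \<Sum>g\<in>carrier G. \<sigma> g $$ (i, a) * \<rho> (inv\<^bsub>G\<^esub> g) $$ (b, j))"

lemma averaged_intertwines:
  fixes G :: "('g, 'b) monoid_scheme" (structure)
  assumes G: "group G" and \<rho>: "representation G d \<rho>" and \<sigma>: "representation G e \<sigma>"
    and ab: "a < e" "b < d" and h: "h \<in> carrier G"
  shows "\<sigma> h * averaged G e d \<sigma> \<rho> a b = averaged G e d \<sigma> \<rho> a b * \<rho> h"
proof (rule eq_matI)
  interpret group G by fact
  have rc: "\<rho> x \<in> carrier_mat d d" and sc: "\<sigma> x \<in> carrier_mat e e" if "x \<in> carrier G" for x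
    using that \<rho> \<sigma> by (auto simp: representation_def)
  have mult: "(M * N) $$ (i, j) = (\<Sum>k<n. M $$ (i, k) * N $$ (k, j))"
    if "M \<in> carrier_mat m n" "N \<in> carrier_mat n l" "i < m" "j < l" for M N :: "complex mat" and m n l i j
    using that by (simp add: scalar_prod_def lessThan_atLeast0)
  have A: "averaged G e d \<sigma> \<rho> a b \<in> carrier_mat e d" by (simp add: averaged_def)
  fix i j assume "i < dim_row (averaged G e d \<sigma> \<rho> a b * \<rho> h)" "j < dim_col (averaged G e d \<sigma> \<rho> a b * \<rho> h)"
  then have ij: "i < e" "j < d" using rc[OF h] by (auto simp: averaged_def)
  have "(\<sigma> h * averaged G e d \<sigma> \<rho> a b) $$ (i, j)
      = (\<Sum>k<e. \<Sum>g\<in>carrier G. \<sigma> h $$ (i, k) * (\<sigma> g $$ (k, a) * \<rho> (inv g) $$ (b, j)))"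
    using ij by (simp add: mult[OF sc[OF h] A ij]) (simp add: averaged_def sum_distrib_left)
  also have "\<dots> = (\<Sum>g\<in>carrier G. (\<Sum>k<e. \<sigma> h $$ (i, k) * \<sigma> g $$ (k, a)) * \<rho> (inv g) $$ (b, j))"
    by (subst sum.swap) (simp add: sum_distrib_right mult.assoc)
  also have "\<dots> = (\<Sum>g\<in>carrier G. \<sigma> (h \<otimes> g) $$ (i, a) * \<rho> (inv g) $$ (b, j))"
  proof (rule sum.cong[OF refl])
    fix g assume g: "g \<in> carrier G"
    have "\<sigma> (h \<otimes> g) = \<sigma> h * \<sigma> g" using \<sigma> h g by (simp add: representation_def)
    then show "(\<Sum>k<e. \<sigma> h $$ (i, k) * \<sigma> g $$ (k, a)) * \<rho> (inv g) $$ (b, j)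
        = \<sigma> (h \<otimes> g) $$ (i, a) * \<rho> (inv g) $$ (b, j)"
      using mult[OF sc[OF h] sc[OF g] ij(1) ab(1)] by simp
  qed
  also have "\<dots> = (\<Sum>g\<in>carrier G. \<sigma> (h \<otimes> g) $$ (i, a) * \<rho> (inv (h \<otimes> g) \<otimes> h) $$ (b, j))"
    using h by (intro sum.cong refl) (simp add: inv_mult_group m_assoc)
  also have "\<dots> = (\<Sum>g\<in>carrier G. \<sigma> g $$ (i, a) * \<rho> (inv g \<otimes> h) $$ (b, j))"
  proof (rule sum.reindex_bij_betw)
    show "bij_betw (\<lambda>g. h \<otimes> g) (carrier G) (carrier G)"
      by (rule bij_betw_byWitness[where f' = "\<lambda>g. inv h \<otimes> g"]) (use h in \<open>auto simp: m_assoc[symmetric]\<close>)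
  qed
  also have "\<dots> = (\<Sum>g\<in>carrier G. \<sigma> g $$ (i, a) * (\<Sum>k<d. \<rho> (inv g) $$ (b, k) * \<rho> h $$ (k, j)))"
  proof (rule sum.cong[OF refl])
    fix g assume g: "g \<in> carrier G"
    have "\<rho> (inv g \<otimes> h) = \<rho> (inv g) * \<rho> h" using \<rho> h g by (simp add: representation_def)
    then show "\<sigma> g $$ (i, a) * \<rho> (inv g \<otimes> h) $$ (b, j)
        = \<sigma> g $$ (i, a) * (\<Sum>k<d. \<rho> (inv g) $$ (b, k) * \<rho> h $$ (k, j))"
      using mult[OF rc[OF inv_closed[OF g]] rc[OF h] ab(2) ij(2)] by simp
  qed
  also have "\<dots> = (\<Sum>k<d. \<Sum>g\<in>carrier G. \<sigma> g $$ (i, a) * \<rho> (inv g) $$ (b, k) * \<rho> h $$ (k, j))"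
    by (subst sum.swap) (simp add: sum_distrib_left mult.assoc)
  also have "\<dots> = (averaged G e d \<sigma> \<rho> a b * \<rho> h) $$ (i, j)"
    using ij by (simp add: mult[OF A rc[OF h] ij]) (simp add: averaged_def sum_distrib_right)
  finally show "(\<sigma> h * averaged G e d \<sigma> \<rho> a b) $$ (i, j) = (averaged G e d \<sigma> \<rho> a b * \<rho> h) $$ (i, j)" .
next
  show "dim_row (\<sigma> h * averaged G e d \<sigma> \<rho> a b) = dim_row (averaged G e d \<sigma> \<rho> a b * \<rho> h)"
    "dim_col (\<sigma> h * averaged G e d \<sigma> \<rho> a b) = dim_col (averaged G e d \<sigma> \<rho> a b * \<rho> h)"
    using h \<rho> \<sigma> by (auto simp: averaged_def representation_def)
qed

lemma sum_traces_averaged: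
  fixes G :: "('g, 'b) monoid_scheme" (structure)
  assumes G: "group G" and \<rho>: "representation G d \<rho>" and \<sigma>: "representation G e \<sigma>"
  shows "(\<Sum>g\<in>carrier G. mat_trace (\<sigma> g) * mat_trace (\<rho> (inv\<^bsub>G\<^esub> g)))
    = (\<Sum>a<e. \<Sum>b<d. averaged G e d \<sigma> \<rho> a b $$ (a, b))"
proof -
  interpret group G by fact
  have "dim_row (\<rho> x) = d" "dim_row (\<sigma> x) = e" if "x \<in> carrier G" for x
    using that \<rho> \<sigma> by (auto simp: representation_def)
  then have "(\<Sum>g\<in>carrier G. mat_trace (\<sigma> g) * mat_trace (\<rho> (inv g)))
      = (\<Sum>g\<in>carrier G. \<Sum>a<e. \<Sum>b<d. \<sigma> g $$ (a, a) * \<rho> (inv g) $$ (b, b))"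
    by (intro sum.cong refl) (simp add: mat_trace_def sum_product)
  also have "\<dots> = (\<Sum>a<e. \<Sum>b<d. \<Sum>g\<in>carrier G. \<sigma> g $$ (a, a) * \<rho> (inv g) $$ (b, b))"
    by (subst sum.swap) (intro sum.cong refl sum.swap)
  also have "\<dots> = (\<Sum>a<e. \<Sum>b<d. averaged G e d \<sigma> \<rho> a b $$ (a, b))"
    by (intro sum.cong refl) (simp add: averaged_def)
  finally show ?thesis .
qed

text \<open>By Schur's lemma the averaged elementary matrices are scalar, and their traces are
known.\<close>

lemma sum_trace_self:
  fixes G :: "('g, 'b) monoid_scheme" (structure)
  assumes G: "group G" "finite (carrier G)" and \<rho>: "irreducible_rep G d \<rho>"
  shows "(\<Sum>g\<in>carrier G. mat_trace (\<rho> g) * mat_trace (\<rho> (inv\<^bsub>G\<^esub> g))) = of_nat (card (carrier G))"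
proof -
  interpret group G by fact
  have d: "d > 0" and rep: "representation G d \<rho>" using \<rho> by (auto simp: irreducible_rep_def)
  have rc: "\<rho> x \<in> carrier_mat d d" if "x \<in> carrier G" for x using that rep by (auto simp: representation_def)
  have "averaged G d d \<rho> \<rho> a b $$ (a, b) = (if a = b then of_nat (card (carrier G)) / of_nat d else 0)"
    if ab: "a < d" "b < d" for a b
  proof -
    have A: "averaged G d d \<rho> \<rho> a b \<in> carrier_mat d d" by (simp add: averaged_def)
    obtain c where c: "averaged G d d \<rho> \<rho> a b = c \<cdot>\<^sub>m 1\<^sub>m d"
      using schur_scalar[OF \<rho> A averaged_intertwines[OF G(1) rep rep ab]] by blast
    have "of_nat d * c = mat_trace (averaged G d d \<rho> \<rho> a b)" unfolding c by (simp add: mat_trace_def)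
    also have "\<dots> = (\<Sum>i<d. \<Sum>g\<in>carrier G. \<rho> g $$ (i, a) * \<rho> (inv g) $$ (b, i))"
      by (simp add: mat_trace_def averaged_def)
    also have "\<dots> = (\<Sum>g\<in>carrier G. \<Sum>i<d. \<rho> (inv g) $$ (b, i) * \<rho> g $$ (i, a))"
      by (subst sum.swap) (simp add: mult.commute)
    also have "\<dots> = (\<Sum>g\<in>carrier G. (1\<^sub>m d :: complex mat) $$ (b, a))"
    proof (rule sum.cong[OF refl])
      fix g assume g: "g \<in> carrier G"
      have "\<rho> (inv g) * \<rho> g = \<rho> (inv g \<otimes> g)"
        using rep g inv_closed[OF g] unfolding representation_def by metis
      also have "\<dots> = 1\<^sub>m d" unfolding l_inv[OF g] using rep by (simp add: representation_def)
      finally have e: "\<rho> (inv g) * \<rho> g = 1\<^sub>m d" .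
      show "(\<Sum>i<d. \<rho> (inv g) $$ (b, i) * \<rho> g $$ (i, a)) = (1\<^sub>m d :: complex mat) $$ (b, a)"
        using rc[OF g] rc[OF inv_closed[OF g]] ab unfolding e[symmetric]
        by (simp add: scalar_prod_def lessThan_atLeast0)
    qed
    also have "\<dots> = (if a = b then of_nat (card (carrier G)) else 0)" using ab by simp
    finally have "c = (if a = b then of_nat (card (carrier G)) / of_nat d else 0)"
      using d by (auto simp: field_simps split: if_splits)
    then show ?thesis using ab by (simp add: c)
  qed
  then have "(\<Sum>a<d. \<Sum>b<d. averaged G d d \<rho> \<rho> a b $$ (a, b))
      = (\<Sum>a<d. \<Sum>b<d. if a = b then of_nat (card (carrier G)) / of_nat d else 0)"
    by (intro sum.cong refl) auto
  then show ?thesis unfolding sum_traces_averaged[OF G(1) rep rep] using d by simp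
qed

text \<open>The inner product is the sum of entries of averaged elementary matrices, which
intertwine the two representations, and a nonzero intertwiner would force equal characters.\<close>

theorem irr_chars_orthonormal:
  fixes G :: "('g, 'b) monoid_scheme" (structure)
  assumes fin: "finite (carrier G)" and \<chi>: "\<chi> \<in> irr_chars G" and \<chi>': "\<chi>' \<in> irr_chars G"
  shows "cf_inner G \<chi> \<chi>' = (if \<chi> = \<chi>' then 1 else 0)"
proof -
  have G: "group G" using \<chi> by (simp add: irr_chars_def)
  then interpret group G .
  have card: "card (carrier G) > 0" using fin by (auto simp: card_gt_0_iff)
  obtain e \<sigma> where \<sigma>: "irreducible_rep G e \<sigma>" "\<chi> = (\<lambda>x. if x \<in> carrier G then mat_trace (\<sigma> x) else 0)"
    using \<chi> by (auto simp: irr_chars_def)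
  obtain d \<rho> where \<rho>: "irreducible_rep G d \<rho>" "\<chi>' = (\<lambda>x. if x \<in> carrier G then mat_trace (\<rho> x) else 0)"
    using \<chi>' by (auto simp: irr_chars_def)
  show ?thesis
  proof (cases "\<chi> = \<chi>'")
    case True
    have "(\<Sum>g\<in>carrier G. \<chi> g * \<chi> (inv g)) = of_nat (card (carrier G))"
      unfolding sum_trace_self[OF G fin \<sigma>(1), symmetric] using \<sigma>(2) by (intro sum.cong) auto
    then show ?thesis using True card by (simp add: cf_inner_def)
  next
    case False
    have rep: "representation G d \<rho>" "representation G e \<sigma>" using \<rho> \<sigma> by (auto simp: irreducible_rep_def)
    have zero: "averaged G e d \<sigma> \<rho> a b = 0\<^sub>m e d" if ab: "a < e" "b < d" for a b
    proof (rule ccontr)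
      assume nz: "averaged G e d \<sigma> \<rho> a b \<noteq> 0\<^sub>m e d"
      have A: "averaged G e d \<sigma> \<rho> a b \<in> carrier_mat e d" by (simp add: averaged_def)
      have "mat_trace (\<sigma> x) = mat_trace (\<rho> x)" if "x \<in> carrier G" for x
        using intertwined_traces_eq[OF \<rho>(1) \<sigma>(1) A nz averaged_intertwines[OF G rep ab] that] .
      then show False using False \<sigma>(2) \<rho>(2) by auto
    qed
    have "(\<Sum>g\<in>carrier G. \<chi> g * \<chi>' (inv g))
        = (\<Sum>g\<in>carrier G. mat_trace (\<sigma> g) * mat_trace (\<rho> (inv g)))"
      using \<sigma>(2) \<rho>(2) by (intro sum.cong) auto
    also have "\<dots> = 0" unfolding sum_traces_averaged[OF G rep] by (intro sum.neutral ballI) (simp add: zero)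
    finally show ?thesis using False by (simp add: cf_inner_def)
  qed
qed

text \<open>More than $|G|$ orthonormal functions cannot exist: the matrix of their values would
have a right inverse although it has fewer columns than rows. Padding with a zero column makes it
square, and the right inverse a left inverse.\<close>

theorem finite_irr_chars:
  fixes G :: "('g, 'b) monoid_scheme" (structure)
  assumes fin: "finite (carrier G)"
  shows "finite (irr_chars G)"
proof (rule ccontr)
  assume inf: "infinite (irr_chars G)"
  then have "group G" by (auto simp: irr_chars_def)
  then interpret group G .
  let ?n = "card (carrier G)"
  obtain F where F: "F \<subseteq> irr_chars G" "finite F" "card F = Suc ?n"
    using infinite_arbitrarily_large[OF inf] by blast
  obtain \<chi> where \<chi>: "bij_betw \<chi> {0..<Suc ?n} F"
    using ex_bij_betw_nat_finite[OF F(2)] F(3) by auto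
  obtain h where h: "bij_betw h {0..<?n} (carrier G)" using ex_bij_betw_nat_finite[OF fin] by blast
  define M where "M = mat (Suc ?n) (Suc ?n) (\<lambda>(i, j). if j < ?n then \<chi> i (h j) else 0)"
  define N where "N = mat (Suc ?n) (Suc ?n) (\<lambda>(j, i). if j < ?n then \<chi> i (inv (h j)) / of_nat ?n else 0)"
  have M: "M \<in> carrier_mat (Suc ?n) (Suc ?n)" and N: "N \<in> carrier_mat (Suc ?n) (Suc ?n)"
    by (auto simp: M_def N_def)
  have "M * N = 1\<^sub>m (Suc ?n)"
  proof (rule eq_matI)
    fix i j assume "i < dim_row (1\<^sub>m (Suc ?n) :: complex mat)" "j < dim_col (1\<^sub>m (Suc ?n) :: complex mat)"
    then have ij: "i < Suc ?n" "j < Suc ?n" by auto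
    have mem: "\<chi> i \<in> irr_chars G" "\<chi> j \<in> irr_chars G" using bij_betwE[OF \<chi>] ij F(1) by auto
    have "(M * N) $$ (i, j) = (\<Sum>k\<in>{0..<?n}. \<chi> i (h k) * (\<chi> j (inv (h k)) / of_nat ?n))"
      using ij by (simp add: M_def N_def scalar_prod_def)
    also have "\<dots> = (\<Sum>g\<in>carrier G. \<chi> i g * (\<chi> j (inv g) / of_nat ?n))"
      by (rule sum.reindex_bij_betw[OF h])
    also have "\<dots> = cf_inner G (\<chi> i) (\<chi> j)" by (simp add: cf_inner_def sum_divide_distrib)
    also have "\<dots> = (if i = j then 1 else 0)"
      using irr_chars_orthonormal[OF fin mem] bij_betw_imp_inj_on[OF \<chi>] ij by (auto simp: inj_on_def)
    finally show "(M * N) $$ (i, j) = 1\<^sub>m (Suc ?n) $$ (i, j)" using ij by simp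
  qed (use M N in auto)
  then have "N * M = 1\<^sub>m (Suc ?n)" using mat_mult_left_right_inverse[OF M N] by simp
  moreover have "(N * M) $$ (?n, ?n) = 0" by (simp add: M_def N_def scalar_prod_def)
  ultimately show False by simp
qed

section \<open>Characters of the formal groups\<close>

lemma finite_carrier_mat: "finite (carrier_mat n m :: 'a::finite mat set)"
proof -
  have "(A :: 'a mat) \<in> (\<lambda>f. mat n m f) ` (({0..<n} \<times> {0..<m}) \<rightarrow>\<^sub>E UNIV)" if "A \<in> carrier_mat n m" for A
  proof
    show "A = mat n m (restrict (\<lambda>ij. A $$ ij) ({0..<n} \<times> {0..<m}))"
      using that by (intro eq_matI) auto
  qed auto
  then have "carrier_mat n m \<subseteq> (\<lambda>f. mat n m f :: 'a mat) ` (({0..<n} \<times> {0..<m}) \<rightarrow>\<^sub>E UNIV)" by blast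
  then show ?thesis by (rule finite_subset) (intro finite_imageI finite_PiE; simp)
qed

lemma finite_component: "finite (carrier (component (G :: 'a::{field,finite} classical) \<epsilon>))"
proof -
  have "carrier (component G \<epsilon>) \<subseteq> carrier_mat (cl_dim G) (cl_dim G)"
    by (cases G) (auto simp: component_def matrix_group_def isometries_def sisometries_def)
  then show ?thesis using finite_carrier_mat finite_subset by blast
qed

lemma finite_fchars: "finite (fchars (G :: 'a::{field,finite} classical))"
proof -
  have "fchars G \<subseteq> (\<Union>\<epsilon>\<in>{Plus, Minus}. {\<epsilon>} \<times> irr_chars (component G \<epsilon>))"
  proof
    fix x assume "x \<in> fchars G"
    then show "x \<in> (\<Union>\<epsilon>\<in>{Plus, Minus}. {\<epsilon>} \<times> irr_chars (component G \<epsilon>))"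
      by (cases x; cases "fst x") (auto simp: fchars_def)
  qed
  moreover have "finite (\<Union>\<epsilon>\<in>{Plus, Minus}. {\<epsilon>} \<times> irr_chars (component G \<epsilon>))"
    using finite_irr_chars[OF finite_component] by blast
  ultimately show ?thesis by (rule finite_subset)
qed

lemma fcf_inner_rho:
  assumes "x \<in> fchars (G :: 'a::{field,finite} classical)" "y \<in> fchars G"
  shows "fcf_inner G (rho x) (rho y) = (if x = y then 1 else 0)"
proof -
  obtain \<epsilon> \<chi> \<eta> \<chi>' where xy: "x = (\<epsilon>, \<chi>)" "y = (\<eta>, \<chi>')" by (cases x; cases y)
  have \<chi>: "\<chi> \<in> irr_chars (component G \<epsilon>)" "\<chi>' \<in> irr_chars (component G \<eta>)" using assms xy by (auto simp: fchars_def)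
  have r: "rho x \<delta> = (if \<delta> = \<epsilon> then \<chi> else (\<lambda>_. 0))" "rho y \<delta> = (if \<delta> = \<eta> then \<chi>' else (\<lambda>_. 0))" for \<delta>
    by (auto simp: rho_def xy)
  have "cf_inner (component G \<delta>) (rho x \<delta>) (rho y \<delta>) = (if \<delta> = \<epsilon> \<and> x = y then 1 else 0)" for \<delta>
  proof (cases "\<delta> = \<epsilon> \<and> \<epsilon> = \<eta>")
    case True
    then have "rho x \<delta> = \<chi>" "rho y \<delta> = \<chi>'" by (simp_all add: r)
    then show ?thesis using irr_chars_orthonormal[OF finite_component \<chi>(1), of \<chi>'] \<chi>(2) True
      by (simp add: xy(1) xy(2))
  next
    case False
    then have "rho x \<delta> = (\<lambda>_. 0) \<or> rho y \<delta> = (\<lambda>_. 0)" by (auto simp: r)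
    moreover have "\<not> (\<delta> = \<epsilon> \<and> x = y)" using False xy by auto
    ultimately show ?thesis by (auto simp: cf_inner_def)
  qed
  then show ?thesis by (cases \<epsilon>) (simp_all add: fcf_inner_def)
qed

lemma fcf_inner_sum:
  "fcf_inner G (\<lambda>\<epsilon> g. \<Sum>i\<in>I. c i * f i \<epsilon> g) f' = (\<Sum>i\<in>I. c i * fcf_inner G (f i) f')"
proof -
  have "cf_inner H (\<lambda>g. \<Sum>i\<in>I. c i * u i g) u' = (\<Sum>i\<in>I. c i * cf_inner H (u i) u')" for H :: "'a mat monoid" and u u'
  proof -
    have "(\<Sum>g\<in>carrier H. (\<Sum>i\<in>I. c i * u i g) * u' (inv\<^bsub>H\<^esub> g))
        = (\<Sum>i\<in>I. c i * (\<Sum>g\<in>carrier H. u i g * u' (inv\<^bsub>H\<^esub> g)))"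
      unfolding sum_distrib_right sum_distrib_left by (subst sum.swap) (simp add: mult.assoc)
    then show ?thesis unfolding cf_inner_def by (simp add: sum_divide_distrib[where A = I])
  qed
  then show ?thesis by (simp add: fcf_inner_def sum.distrib distrib_left)
qed

lemma rho_expansion_inner:
  assumes x: "x \<in> fchars (G :: 'a::{field,finite} classical)"
  shows "fcf_inner G (\<lambda>\<epsilon> g. \<Sum>y\<in>fchars G. c y * rho y \<epsilon> g) (rho x) = c x"
proof -
  have "fcf_inner G (\<lambda>\<epsilon> g. \<Sum>y\<in>fchars G. c y * rho y \<epsilon> g) (rho x) = (\<Sum>y\<in>fchars G. if y = x then c y else 0)"
    unfolding fcf_inner_sum using fcf_inner_rho[OF _ x] by (intro sum.cong) auto
  then show ?thesis using x finite_fchars[of G] by simp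
qed

text \<open>Taking inner products in both variables recovers the coefficients.\<close>

lemma rho_tensor_coefficients_unique:
  fixes G G' :: "'a::{field,finite} classical"
  assumes eq: "\<And>\<epsilon> g \<epsilon>' h. (\<Sum>x\<in>fchars G. \<Sum>x'\<in>fchars G'. a x x' * (rho x \<epsilon> g * rho x' \<epsilon>' h))
      = (\<Sum>x\<in>fchars G. \<Sum>x'\<in>fchars G'. b x x' * (rho x \<epsilon> g * rho x' \<epsilon>' h))"
    and x: "x \<in> fchars G" "x' \<in> fchars G'"
  shows "a x x' = b x x'"
proof -
  have "fcf_inner G' (\<lambda>\<epsilon>' h. fcf_inner G (\<lambda>\<epsilon> g. \<Sum>x\<in>fchars G. \<Sum>x'\<in>fchars G'.
      c x x' * (rho x \<epsilon> g * rho x' \<epsilon>' h)) (rho x)) (rho x') = c x x'" for c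
  proof -
    have "(\<Sum>y\<in>fchars G. \<Sum>y'\<in>fchars G'. c y y' * (rho y \<epsilon> g * rho y' \<epsilon>' h))
        = (\<Sum>y\<in>fchars G. (\<Sum>y'\<in>fchars G'. c y y' * rho y' \<epsilon>' h) * rho y \<epsilon> g)" for \<epsilon> g \<epsilon>' h
      by (simp add: sum_distrib_left sum_distrib_right mult.assoc mult.left_commute mult.commute)
    then show ?thesis by (simp add: rho_expansion_inner x)
  qed
  from this[of a] this[of b] show ?thesis unfolding eq by simp
qed

section \<open>Unipotent characters and their almost characters\<close>

lemma centralizer_one: "centralizer N S (1\<^sub>m N) = sisometries N S"
  by (auto simp: centralizer_def sisometries_def isometries_def)

text \<open>The groups whose unipotent characters are labelled by symbols; the factors $\mathbf
G^{(-)}$ and $\mathbf G^{(+)}$ are always of this kind.\<close>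

definition has_symbols :: "'k classical \<Rightarrow> bool" where
  "has_symbols G \<longleftrightarrow> (\<exists>n. G = Sp n \<or> G = Opm n)"

lemma has_symbols_simps [simp]: "has_symbols (Sp n)" "has_symbols (Opm n)"
  by (auto simp: has_symbols_def)

lemma symbols_class:
  assumes "has_symbols G"
  shows "symbols G = symbol_class (case G of Sp _ \<Rightarrow> True | _ \<Rightarrow> False) (cl_rank G)"
  using assms by (auto simp: has_symbols_def S_Sp_eq S_O_eq)

lemma unip_subset_fchars:
  assumes "has_symbols (H :: 'a::{field,finite} classical)"
  shows "unip H \<subseteq> fchars H"
proof (cases H)
  case (Sp n)
  have "component H Plus = matrix_group (2 * n) (centralizer (2 * n) (sp_form n) (1\<^sub>m (2 * n)))"
    unfolding centralizer_one by (simp add: Sp component_def)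
  then have "unip_centralizer (2 * n) (sp_form n) (sp_form n) (1\<^sub>m (2 * n)) \<subseteq> irr_chars (component H Plus)"
    unfolding unip_centralizer_def by (simp only:) blast
  then show ?thesis unfolding fchars_def Sp unip.simps by blast
next
  case (Opm n)
  have "induced_constituents H \<epsilon> E \<subseteq> irr_chars (component H \<epsilon>)" for \<epsilon> E
    unfolding induced_constituents_def by blast
  then show ?thesis unfolding fchars_def Opm unip.simps by blast
next
  case (SOodd n S)
  then show ?thesis using assms by (simp add: has_symbols_def)
qed

text \<open>For $\mathrm O^\pm$ the two partial parametrizations combine, as they take values in
characters of different components.\<close>

lemma bij_betw_prm:
  fixes prm :: "'a::{field,finite} classical \<Rightarrow> symbol \<Rightarrow> 'a fchar"
  assumes prm: "unip_parametrization \<psi> prm" and H: "has_symbols H"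
  shows "bij_betw (prm H) (symbols H) (unip H)"
proof (cases H)
  case (Sp n)
  then show ?thesis using prm by (simp add: unip_parametrization_def)
next
  case (Opm n)
  let ?U = "\<lambda>\<epsilon>. {y \<in> unip H. fst y = \<epsilon>}"
  have "bij_betw (prm H) (S_O \<epsilon> n) (?U \<epsilon>)" for \<epsilon>
    using prm unfolding Opm unip_parametrization_def by blast
  then have "bij_betw (prm H) (S_O Plus n \<union> S_O Minus n) (?U Plus \<union> ?U Minus)"
    by (intro bij_betw_combine) auto
  moreover have "unip H = ?U Plus \<union> ?U Minus" using sgn_type.exhaust by auto
  ultimately show ?thesis by (simp add: Opm)
next
  case (SOodd n S)
  then show ?thesis using H by (simp add: has_symbols_def)
qed

lemma finite_symbols:
  fixes prm :: "'a::{field,finite} classical \<Rightarrow> symbol \<Rightarrow> 'a fchar"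
  assumes "unip_parametrization \<psi> prm" and "has_symbols (H :: 'a::{field,finite} classical)"
  shows "finite (symbols H)"
  using bij_betw_finite[OF bij_betw_prm[OF assms]] finite_subset[OF unip_subset_fchars[OF assms(2)] finite_fchars]
  by blast

lemma unip_almost_inner:
  fixes prm :: "'a::{field,finite} classical \<Rightarrow> symbol \<Rightarrow> 'a fchar"
  assumes prm: "unip_parametrization \<psi> prm" and H: "has_symbols H"
    and L: "\<Lambda> \<in> symbols H" and L1: "\<Lambda>1 \<in> symbols H"
  shows "fcf_inner H (unip_almost prm H \<Lambda>) (rho (prm H \<Lambda>1)) = fourier \<Lambda> \<Lambda>1"
proof -
  let ?F = "sym_family (special_of \<Lambda>)"
  note bij = bij_betw_prm[OF prm H]
  have ad: "admissible \<Lambda>" using L symbols_class[OF H] by (simp add: symbol_class_def)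
  have F: "?F \<subseteq> symbols H" "finite ?F"
  proof -
    show "?F \<subseteq> symbols H" using L symbol_of_class unfolding symbols_class[OF H] sym_family_eq[OF ad] by blast
    then show "finite ?F" using finite_symbols[OF prm H] finite_subset by blast
  qed
  have "unip_almost prm H \<Lambda> = (\<lambda>\<epsilon> g. \<Sum>\<Lambda>'\<in>?F. fourier \<Lambda> \<Lambda>' * rho (prm H \<Lambda>') \<epsilon> g)"
    by (intro ext) (simp add: unip_almost_def fourier_def sum_divide_distrib)
  then have "fcf_inner H (unip_almost prm H \<Lambda>) (rho (prm H \<Lambda>1))
      = (\<Sum>\<Lambda>'\<in>?F. fourier \<Lambda> \<Lambda>' * fcf_inner H (rho (prm H \<Lambda>')) (rho (prm H \<Lambda>1)))"
    by (simp add: fcf_inner_sum)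
  also have "\<dots> = (\<Sum>\<Lambda>'\<in>?F. if \<Lambda>' = \<Lambda>1 then fourier \<Lambda> \<Lambda>' else 0)"
  proof (rule sum.cong[OF refl])
    fix \<Lambda>' assume "\<Lambda>' \<in> ?F"
    then have L': "\<Lambda>' \<in> symbols H" using F by blast
    have "prm H \<Lambda>' \<in> fchars H" "prm H \<Lambda>1 \<in> fchars H"
      using bij_betwE[OF bij] L' L1 unip_subset_fchars[OF H] by blast+
    moreover have "prm H \<Lambda>' = prm H \<Lambda>1 \<longleftrightarrow> \<Lambda>' = \<Lambda>1"
      using bij_betw_imp_inj_on[OF bij] L' L1 by (auto dest: inj_onD)
    ultimately show "fourier \<Lambda> \<Lambda>' * fcf_inner H (rho (prm H \<Lambda>')) (rho (prm H \<Lambda>1))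
        = (if \<Lambda>' = \<Lambda>1 then fourier \<Lambda> \<Lambda>' else 0)" by (simp add: fcf_inner_rho)
  qed
  also have "\<dots> = fourier \<Lambda> \<Lambda>1" using F(2) by (simp add: fourier_def)
  finally show ?thesis .
qed

section \<open>Almost characters in a Lusztig series\<close>

text \<open>The Lusztig series are disjoint because their images are disjoint and the class and
the signs can be read off from an image.\<close>

lemma bij_betw_lusztig:
  assumes "lusztig_correspondence \<kappa> G \<Xi>"
  shows "bij_betw \<Xi> (fchars G) (\<Union>M\<in>ss_classes (cl_rank G). {M} \<times> unip_zero (ss_zero M)
     \<times> unip (G_minus G (n_minus M)) \<times> unip (G_plus G (n_plus M)))"
proof -
  let ?E = "lusztig_series \<kappa> G"
  let ?T = "\<lambda>M e1 e2. {M} \<times> unip_zero (ss_zero M) \<times> {y \<in> unip (G_minus G (n_minus M)). fst y = e1}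
             \<times> {y \<in> unip (G_plus G (n_plus M)). fst y = e2}"
  have bij: "bij_betw \<Xi> (?E M e1 e2) (?T M e1 e2)" if "M \<in> ss_classes (cl_rank G)" for M e1 e2
    using assms that by (simp add: lusztig_correspondence_def)
  have un: "fchars G = (\<Union>M\<in>ss_classes (cl_rank G). \<Union>e1. \<Union>e2. ?E M e1 e2)"
    using assms by (simp add: lusztig_correspondence_def)
  show ?thesis
  proof (rule bij_betw_imageI)
    show "inj_on \<Xi> (fchars G)"
    proof (rule inj_onI)
      fix x y assume x: "x \<in> fchars G" and y: "y \<in> fchars G" and eq: "\<Xi> x = \<Xi> y"
      obtain M e1 e2 where M: "M \<in> ss_classes (cl_rank G)" "x \<in> ?E M e1 e2" using x un by blast
      obtain M' e1' e2' where M': "M' \<in> ss_classes (cl_rank G)" "y \<in> ?E M' e1' e2'" using y un by blast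
      have "\<Xi> x \<in> ?T M e1 e2" "\<Xi> x \<in> ?T M' e1' e2'"
        using bij_betwE[OF bij[OF M(1), of e1 e2], rule_format, OF M(2)]
          bij_betwE[OF bij[OF M'(1), of e1' e2'], rule_format, OF M'(2)] unfolding eq by simp_all
      then have "M' = M" "e1' = e1" "e2' = e2" by auto
      then show "x = y" using bij_betw_imp_inj_on[OF bij[OF M(1)]] M(2) M'(2) eq by (auto dest: inj_onD)
    qed
    have "\<Xi> ` fchars G = (\<Union>M\<in>ss_classes (cl_rank G). \<Union>e1. \<Union>e2. \<Xi> ` ?E M e1 e2)"
      unfolding un by blast
    also have "\<dots> = (\<Union>M\<in>ss_classes (cl_rank G). \<Union>e1. \<Union>e2. ?T M e1 e2)"
      using bij by (simp add: bij_betw_def)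
    also have "\<dots> = (\<Union>M\<in>ss_classes (cl_rank G). {M} \<times> unip_zero (ss_zero M)
     \<times> unip (G_minus G (n_minus M)) \<times> unip (G_plus G (n_plus M)))" by auto
    finally show "\<Xi> ` fchars G = (\<Union>M\<in>ss_classes (cl_rank G). {M} \<times> unip_zero (ss_zero M)
     \<times> unip (G_minus G (n_minus M)) \<times> unip (G_plus G (n_plus M)))" .
  qed
qed

text \<open>The characters among which the constituents of the almost character of
\<open>x\<close> are found.\<close>

definition fibre :: "'a::{field,finite} classical \<Rightarrow> 'a jordan \<Rightarrow> 'a fchar \<Rightarrow> 'a fchar set" where
  "fibre G \<Xi> x = {x1 \<in> fchars G. ss_class \<Xi> x1 = ss_class \<Xi> x \<and> zero_part \<Xi> x1 = zero_part \<Xi> x}"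

definition minus_symbols :: "'a::{field,finite} classical \<Rightarrow> 'a jordan \<Rightarrow> 'a fchar \<Rightarrow> symbol set" where
  "minus_symbols G \<Xi> x = symbols (G_minus G (n_minus (ss_class \<Xi> x)))"

definition plus_symbols :: "'a::{field,finite} classical \<Rightarrow> 'a jordan \<Rightarrow> 'a fchar \<Rightarrow> symbol set" where
  "plus_symbols G \<Xi> x = symbols (G_plus G (n_plus (ss_class \<Xi> x)))"

lemma has_symbols_parts: "has_symbols (G_minus G k)" "has_symbols (G_plus G k)"
  by (cases G; simp add: has_symbols_def)+

lemma bij_betw_fibre:
  fixes prm :: "'a::{field,finite} classical \<Rightarrow> symbol \<Rightarrow> 'a fchar"
  assumes prm: "unip_parametrization \<psi> prm" and \<Xi>: "lusztig_correspondence \<kappa> G \<Xi>" and x: "x \<in> fchars G"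
  shows "bij_betw (\<lambda>y. (minus_symbol prm G \<Xi> y, plus_symbol prm G \<Xi> y)) (fibre G \<Xi> x)
    (minus_symbols G \<Xi> x \<times> plus_symbols G \<Xi> x)"
proof -
  define M where "M = ss_class \<Xi> x"
  define z where "z = zero_part \<Xi> x"
  let ?m = "G_minus G (n_minus M)" and ?p = "G_plus G (n_plus M)"
  note bij = bij_betw_lusztig[OF \<Xi>]
  have M: "M \<in> ss_classes (cl_rank G)" "z \<in> unip_zero (ss_zero M)"
    using bij_betwE[OF bij] x unfolding M_def z_def ss_class_def zero_part_def by fastforce+
  have b1: "bij_betw \<Xi> (fibre G \<Xi> x) ({M} \<times> {z} \<times> unip ?m \<times> unip ?p)"
  proof (rule bij_betw_imageI)
    show "inj_on \<Xi> (fibre G \<Xi> x)"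
      using bij_betw_imp_inj_on[OF bij] by (rule inj_on_subset) (auto simp: fibre_def)
    show "\<Xi> ` fibre G \<Xi> x = {M} \<times> {z} \<times> unip ?m \<times> unip ?p"
    proof
      show "\<Xi> ` fibre G \<Xi> x \<subseteq> {M} \<times> {z} \<times> unip ?m \<times> unip ?p"
      proof
        fix t assume "t \<in> \<Xi> ` fibre G \<Xi> x"
        then obtain y where y: "y \<in> fchars G" "t = \<Xi> y" "fst t = M" "fst (snd t) = z"
          by (auto simp: fibre_def M_def z_def ss_class_def zero_part_def)
        then show "t \<in> {M} \<times> {z} \<times> unip ?m \<times> unip ?p" using bij_betwE[OF bij, rule_format, OF y(1)] by auto
      qed
      show "{M} \<times> {z} \<times> unip ?m \<times> unip ?p \<subseteq> \<Xi> ` fibre G \<Xi> x"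
      proof
        fix t assume t: "t \<in> {M} \<times> {z} \<times> unip ?m \<times> unip ?p"
        then have "t \<in> \<Xi> ` fchars G" unfolding bij_betw_imp_surj_on[OF bij] using M by auto
        then obtain y where "y \<in> fchars G" "t = \<Xi> y" by blast
        then show "t \<in> \<Xi> ` fibre G \<Xi> x"
          using t by (auto simp: fibre_def M_def z_def ss_class_def zero_part_def intro!: image_eqI[of _ _ y])
      qed
    qed
  qed
  have lab: "bij_betw (unip_label prm H) (unip H) (symbols H)" if "has_symbols H" for H
    unfolding unip_label_def by (rule bij_betw_inv_into[OF bij_betw_prm[OF prm that]])
  let ?l = "\<lambda>(M', z', u, w). (unip_label prm ?m u, unip_label prm ?p w)"
  have b2: "bij_betw ?l ({M} \<times> {z} \<times> unip ?m \<times> unip ?p) (symbols ?m \<times> symbols ?p)"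
  proof -
    have "bij_betw (\<lambda>(M', z', u, w). (u, w)) ({M} \<times> {z} \<times> unip ?m \<times> unip ?p) (unip ?m \<times> unip ?p)"
      by (rule bij_betwI[where g = "\<lambda>(u, w). (M, z, u, w)"]) auto
    from bij_betw_trans[OF this bij_betw_map_prod[OF lab[OF has_symbols_parts(1)] lab[OF has_symbols_parts(2)]]]
    show ?thesis by (rule bij_betw_cong[THEN iffD1, rotated]) auto
  qed
  show ?thesis
    using bij_betw_trans[OF b1 b2] unfolding minus_symbols_def plus_symbols_def M_def[symmetric]
    by (rule bij_betw_cong[THEN iffD1, rotated])
      (auto simp: fibre_def minus_symbol_def plus_symbol_def M_def split: prod.splits)
qed

definition almost_coeff :: "('a::{field,finite} classical \<Rightarrow> symbol \<Rightarrow> 'a fchar) \<Rightarrow> 'a classical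
    \<Rightarrow> 'a jordan \<Rightarrow> 'a fchar \<Rightarrow> 'a fchar \<Rightarrow> complex" where
  "almost_coeff prm G \<Xi> x y = (if y \<in> fibre G \<Xi> x
     then fourier (minus_symbol prm G \<Xi> x) (minus_symbol prm G \<Xi> y)
        * fourier (plus_symbol prm G \<Xi> x) (plus_symbol prm G \<Xi> y) else 0)"

lemma symbols_mem_fibre:
  assumes "unip_parametrization \<psi> prm" "lusztig_correspondence \<kappa> G \<Xi>" "x \<in> fchars G" "y \<in> fibre G \<Xi> x"
  shows "minus_symbol prm G \<Xi> y \<in> minus_symbols G \<Xi> x" "plus_symbol prm G \<Xi> y \<in> plus_symbols G \<Xi> x"
  using bij_betwE[OF bij_betw_fibre[OF assms(1-3)]] assms(4) by auto

lemma mem_fibre_self: "x \<in> fchars G \<Longrightarrow> x \<in> fibre G \<Xi> x"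
  by (simp add: fibre_def)

lemma almost_char_expansion:
  assumes prm: "unip_parametrization \<psi> prm" and \<Xi>: "lusztig_correspondence \<kappa> G \<Xi>" and x: "x \<in> fchars G"
  shows "almost_char prm G \<Xi> x \<epsilon> g = (\<Sum>y\<in>fchars G. almost_coeff prm G \<Xi> x y * rho y \<epsilon> g)"
proof -
  let ?m = "G_minus G (n_minus (ss_class \<Xi> x))" and ?p = "G_plus G (n_plus (ss_class \<Xi> x))"
  have "almost_char prm G \<Xi> x \<epsilon> g = (\<Sum>y\<in>fibre G \<Xi> x.
      fcf_inner ?m (unip_almost prm ?m (minus_symbol prm G \<Xi> x)) (rho (prm ?m (minus_symbol prm G \<Xi> y))) *
      fcf_inner ?p (unip_almost prm ?p (plus_symbol prm G \<Xi> x)) (rho (prm ?p (plus_symbol prm G \<Xi> y))) * rho y \<epsilon> g)"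
    by (simp add: almost_char_def Let_def fibre_def)
  also have "\<dots> = (\<Sum>y\<in>fibre G \<Xi> x. almost_coeff prm G \<Xi> x y * rho y \<epsilon> g)"
  proof (rule sum.cong[OF refl])
    fix y assume y: "y \<in> fibre G \<Xi> x"
    show "fcf_inner ?m (unip_almost prm ?m (minus_symbol prm G \<Xi> x)) (rho (prm ?m (minus_symbol prm G \<Xi> y))) *
      fcf_inner ?p (unip_almost prm ?p (plus_symbol prm G \<Xi> x)) (rho (prm ?p (plus_symbol prm G \<Xi> y))) * rho y \<epsilon> g
      = almost_coeff prm G \<Xi> x y * rho y \<epsilon> g"
      using symbols_mem_fibre[OF prm \<Xi> x y] symbols_mem_fibre[OF prm \<Xi> x mem_fibre_self[OF x]] y
      unfolding minus_symbols_def plus_symbols_def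
      by (simp add: unip_almost_inner[OF prm] has_symbols_parts almost_coeff_def)
  qed
  also have "\<dots> = (\<Sum>y\<in>fchars G. almost_coeff prm G \<Xi> x y * rho y \<epsilon> g)"
    by (rule sum.mono_neutral_left[OF finite_fchars]) (auto simp: fibre_def almost_coeff_def)
  finally show ?thesis .
qed

lemma sum_almost_coeff:
  assumes prm: "unip_parametrization \<psi> prm" and \<Xi>: "lusztig_correspondence \<kappa> G \<Xi>" and x: "x \<in> fchars G"
    and h: "\<And>y. y \<in> fibre G \<Xi> x \<Longrightarrow> h y = f (minus_symbol prm G \<Xi> y) (plus_symbol prm G \<Xi> y)"
  shows "(\<Sum>y\<in>fchars G. almost_coeff prm G \<Xi> x y * h y) = (\<Sum>a\<in>minus_symbols G \<Xi> x. \<Sum>b\<in>plus_symbols G \<Xi> x.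
     fourier (minus_symbol prm G \<Xi> x) a * fourier (plus_symbol prm G \<Xi> x) b * f a b)"
proof -
  let ?g = "\<lambda>(a, b). fourier (minus_symbol prm G \<Xi> x) a * fourier (plus_symbol prm G \<Xi> x) b * f a b"
  have "(\<Sum>y\<in>fchars G. almost_coeff prm G \<Xi> x y * h y) = (\<Sum>y\<in>fibre G \<Xi> x. almost_coeff prm G \<Xi> x y * h y)"
    by (rule sum.mono_neutral_right[OF finite_fchars]) (auto simp: fibre_def almost_coeff_def)
  also have "\<dots> = (\<Sum>y\<in>fibre G \<Xi> x. ?g (minus_symbol prm G \<Xi> y, plus_symbol prm G \<Xi> y))"
    by (rule sum.cong[OF refl]) (simp add: almost_coeff_def h)
  also have "\<dots> = (\<Sum>ab\<in>minus_symbols G \<Xi> x \<times> plus_symbols G \<Xi> x. ?g ab)"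
    by (rule sum.reindex_bij_betw[OF bij_betw_fibre[OF prm \<Xi> x]])
  finally show ?thesis by (simp add: sum.cartesian_product)
qed

lemma symbols_fourier_orthonormal:
  fixes prm :: "'a::{field,finite} classical \<Rightarrow> symbol \<Rightarrow> 'a fchar"
  assumes "unip_parametrization \<psi> prm" "has_symbols (H :: 'a::{field,finite} classical)"
    "\<Lambda> \<in> symbols H" "\<Lambda>' \<in> symbols H"
  shows "(\<Sum>a\<in>symbols H. fourier \<Lambda> a * fourier \<Lambda>' a) = of_bool (\<Lambda> = \<Lambda>')"
  using fourier_orthonormal finite_symbols[OF assms(1,2)] assms(3,4) unfolding symbols_class[OF assms(2)]
  by (simp add: of_bool_def)

text \<open>On a fibre the matrix is the Kronecker product of two Fourier matrices.\<close>

lemma almost_coeff_orthonormal: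
  assumes prm: "unip_parametrization \<psi> prm" and \<Xi>: "lusztig_correspondence \<kappa> G \<Xi>"
    and x: "x \<in> fchars G" and z: "z \<in> fchars G"
  shows "(\<Sum>y\<in>fchars G. almost_coeff prm G \<Xi> x y * almost_coeff prm G \<Xi> z y) = (if x = z then 1 else 0)"
proof (cases "z \<in> fibre G \<Xi> x")
  case True
  let ?m = "minus_symbol prm G \<Xi>" and ?p = "plus_symbol prm G \<Xi>"
  have fib: "fibre G \<Xi> z = fibre G \<Xi> x" using True by (auto simp: fibre_def)
  note mem = symbols_mem_fibre[OF prm \<Xi> x True] symbols_mem_fibre[OF prm \<Xi> x mem_fibre_self[OF x]]
  have "(\<Sum>y\<in>fchars G. almost_coeff prm G \<Xi> x y * almost_coeff prm G \<Xi> z y)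
    = (\<Sum>a\<in>minus_symbols G \<Xi> x. \<Sum>b\<in>plus_symbols G \<Xi> x. fourier (?m x) a * fourier (?p x) b * (fourier (?m z) a * fourier (?p z) b))"
    by (rule sum_almost_coeff[OF prm \<Xi> x]) (simp add: almost_coeff_def fib)
  also have "\<dots> = (\<Sum>a\<in>minus_symbols G \<Xi> x. fourier (?m x) a * fourier (?m z) a) *
      (\<Sum>b\<in>plus_symbols G \<Xi> x. fourier (?p x) b * fourier (?p z) b)"
    by (simp add: sum_product mult.assoc mult.left_commute)
  also have "\<dots> = of_bool (?m x = ?m z) * of_bool (?p x = ?p z)"
    using mem unfolding minus_symbols_def plus_symbols_def
    by (simp add: symbols_fourier_orthonormal[OF prm has_symbols_parts(1)] symbols_fourier_orthonormal[OF prm has_symbols_parts(2)])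
  also have "\<dots> = (if x = z then 1 else 0)"
    using bij_betw_imp_inj_on[OF bij_betw_fibre[OF prm \<Xi> x]] True mem_fibre_self[OF x]
    by (auto dest: inj_onD)
  finally show ?thesis .
next
  case False
  then have "almost_coeff prm G \<Xi> x y * almost_coeff prm G \<Xi> z y = 0" for y
    using z by (auto simp: almost_coeff_def fibre_def)
  moreover have "x \<noteq> z" using False mem_fibre_self[OF x] by blast
  ultimately show ?thesis by simp
qed

section \<open>Fourier invariance of the theta correspondence\<close>

text \<open>A Kronecker product of two matrices acts factor by factor.\<close>

lemma sum_four_split:
  fixes f1 f2 f3 f4 :: "_ \<Rightarrow> complex"
  shows "(\<Sum>a\<in>A. \<Sum>b\<in>B. f1 a * f2 b * (\<Sum>a'\<in>A'. \<Sum>b'\<in>B'. f3 a' * f4 b' * of_bool (P a a' \<and> Q b b')))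
    = (\<Sum>a\<in>A. \<Sum>a'\<in>A'. f1 a * (f3 a' * of_bool (P a a'))) * (\<Sum>b\<in>B. \<Sum>b'\<in>B'. f2 b * (f4 b' * of_bool (Q b b')))"
proof -
  have "(\<Sum>a'\<in>A'. \<Sum>b'\<in>B'. f3 a' * f4 b' * of_bool (P a a' \<and> Q b b'))
      = (\<Sum>a'\<in>A'. f3 a' * of_bool (P a a')) * (\<Sum>b'\<in>B'. f4 b' * of_bool (Q b b'))" for a b
    by (simp add: sum_product of_bool_conj mult.assoc mult.left_commute)
  note inner = this
  have "(\<Sum>a\<in>A. \<Sum>b\<in>B. f1 a * f2 b * (\<Sum>a'\<in>A'. \<Sum>b'\<in>B'. f3 a' * f4 b' * of_bool (P a a' \<and> Q b b')))
    = (\<Sum>a\<in>A. \<Sum>b\<in>B. (f1 a * (\<Sum>a'\<in>A'. f3 a' * of_bool (P a a'))) * (f2 b * (\<Sum>b'\<in>B'. f4 b' * of_bool (Q b b'))))"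
    unfolding inner by (intro sum.cong refl) (simp only: mult.assoc mult.left_commute)
  also have "\<dots> = (\<Sum>a\<in>A. f1 a * (\<Sum>a'\<in>A'. f3 a' * of_bool (P a a'))) * (\<Sum>b\<in>B. f2 b * (\<Sum>b'\<in>B'. f4 b' * of_bool (Q b b')))"
    by (simp only: sum_product)
  finally show ?thesis by (simp only: sum_distrib_left)
qed

lemma fourier_diagonal:
  fixes prm :: "'a::{field,finite} classical \<Rightarrow> symbol \<Rightarrow> 'a fchar"
  assumes prm: "unip_parametrization \<psi> prm" and H: "has_symbols (H :: 'a::{field,finite} classical)"
    and L: "\<Lambda> \<in> symbols H" "\<Lambda>' \<in> symbols H"
  shows "(\<Sum>a\<in>symbols H. \<Sum>a'\<in>symbols H. fourier \<Lambda> a * (fourier \<Lambda>' a' * of_bool (a = a'))) = of_bool (\<Lambda> = \<Lambda>')"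
proof -
  have "(\<Sum>a\<in>symbols H. \<Sum>a'\<in>symbols H. fourier \<Lambda> a * (fourier \<Lambda>' a' * of_bool (a = a')))
      = (\<Sum>a\<in>symbols H. fourier \<Lambda> a * fourier \<Lambda>' a)"
    by (rule sum.cong[OF refl]) (simp add: of_bool_def if_distrib[of "(*) _"] sum.delta finite_symbols[OF prm H] cong: if_cong)
  then show ?thesis by (simp add: symbols_fourier_orthonormal[OF assms])
qed

lemma fourier_theta:
  fixes prm :: "'a::{field,finite} classical \<Rightarrow> symbol \<Rightarrow> 'a fchar"
  assumes prm: "unip_parametrization \<psi> prm"
    and L: "\<Lambda> \<in> symbols (Sp n :: 'a classical)" "\<Lambda>' \<in> symbols (Opm n' :: 'a classical)"
  shows "(\<Sum>a\<in>symbols (Sp n :: 'a classical). \<Sum>a'\<in>symbols (Opm n' :: 'a classical).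
      fourier \<Lambda> a * (fourier \<Lambda>' a' * of_bool ((a, a') \<in> B_pm n n'))) = of_bool ((\<Lambda>, \<Lambda>') \<in> B_pm n n')"
  using B_pm_fourier[of n n' \<Lambda> \<Lambda>'] L finite_symbols[OF prm, of "Sp n"] finite_symbols[OF prm, of "Opm n'"]
  by (simp add: has_symbols_def S_Sp_eq S_O_eq)

text \<open>Between two fibres the relation is either empty or the product of an equality and of
the relation \<open>B_pm\<close> between symbols. For $\mathrm O^\pm$ the equality concerns the
minus parts and \<open>B_pm\<close> the plus parts. For $\mathrm{SO}$ the plus part of the
symplectic group is identified with the minus part of the orthogonal group, and
\<open>B_pm\<close> has the orthogonal group's plus part on its symplectic side.\<close>

lemma theta_matrix_fourier_invariant:
  fixes prm :: "'a::{field,finite} classical \<Rightarrow> symbol \<Rightarrow> 'a fchar"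
  assumes prm: "unip_parametrization \<psi> prm"
    and \<Xi>: "lusztig_correspondence \<kappa> (Sp n) \<Xi>" and \<Xi>': "lusztig_correspondence \<kappa> G' \<Xi>'"
    and z: "z \<in> fchars (Sp n)" and z': "z' \<in> fchars G'"
  shows "(\<Sum>y\<in>fchars (Sp n). almost_coeff prm (Sp n) \<Xi> z y *
      (\<Sum>y'\<in>fchars G'. almost_coeff prm G' \<Xi>' z' y' * of_bool (theta_related prm n G' \<Xi> \<Xi>' y y')))
    = of_bool (theta_related prm n G' \<Xi> \<Xi>' z z')" (is "?lhs = _")
proof -
  let ?G = "Sp n :: 'a classical"
  let ?m = "minus_symbol prm ?G \<Xi>" and ?p = "plus_symbol prm ?G \<Xi>"
  let ?m' = "minus_symbol prm G' \<Xi>'" and ?p' = "plus_symbol prm G' \<Xi>'"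
  let ?M = "ss_class \<Xi> z" and ?M' = "ss_class \<Xi>' z'"
  note mem = symbols_mem_fibre[OF prm \<Xi> z mem_fibre_self[OF z]] symbols_mem_fibre[OF prm \<Xi>' z' mem_fibre_self[OF z']]
  have reduce: "?lhs = (\<Sum>a\<in>minus_symbols ?G \<Xi> z. \<Sum>b\<in>plus_symbols ?G \<Xi> z. fourier (?m z) a * fourier (?p z) b *
        (\<Sum>a'\<in>minus_symbols G' \<Xi>' z'. \<Sum>b'\<in>plus_symbols G' \<Xi>' z'. fourier (?m' z') a' * fourier (?p' z') b' * of_bool (R a b a' b')))"
    if R: "\<And>y y'. y \<in> fibre ?G \<Xi> z \<Longrightarrow> y' \<in> fibre G' \<Xi>' z' \<Longrightarrow>
        theta_related prm n G' \<Xi> \<Xi>' y y' \<longleftrightarrow> R (?m y) (?p y) (?m' y') (?p' y')" for R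
    by (rule sum_almost_coeff[OF prm \<Xi> z], rule sum_almost_coeff[OF prm \<Xi>' z']) (simp add: R)
  show ?thesis
  proof (cases G')
    case (Sp k)
    then show ?thesis by simp
  next
    case (Opm n')
    define C where "C \<longleftrightarrow> same_zero 1 (ss_zero ?M) (ss_zero ?M') (zero_part \<Xi> z) (zero_part \<Xi>' z') \<and> n_minus ?M = n_minus ?M'"
    have R: "theta_related prm n G' \<Xi> \<Xi>' y y' \<longleftrightarrow> C \<and> ?m y = ?m' y' \<and> (?p y, ?p' y') \<in> B_pm (n_plus ?M) (n_plus ?M')"
      if "y \<in> fibre ?G \<Xi> z" "y' \<in> fibre G' \<Xi>' z'" for y y'
      using that by (auto simp: Opm fibre_def C_def Let_def)
    note Rz = R[OF mem_fibre_self[OF z] mem_fibre_self[OF z']]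
    show ?thesis
    proof (cases C)
      case False
      then show ?thesis using Rz by (simp add: reduce[OF R])
    next
      case C: True
      then have eq: "n_minus ?M' = n_minus ?M" by (simp add: C_def)
      have sets: "minus_symbols ?G \<Xi> z = symbols (Opm (n_minus ?M) :: 'a classical)"
        "plus_symbols ?G \<Xi> z = symbols (Sp (n_plus ?M) :: 'a classical)"
        "minus_symbols G' \<Xi>' z' = symbols (Opm (n_minus ?M) :: 'a classical)"
        "plus_symbols G' \<Xi>' z' = symbols (Opm (n_plus ?M') :: 'a classical)"
        by (simp_all add: minus_symbols_def plus_symbols_def Opm eq del: symbols.simps)
      have "?lhs = (\<Sum>a\<in>minus_symbols ?G \<Xi> z. \<Sum>b\<in>plus_symbols ?G \<Xi> z. fourier (?m z) a * fourier (?p z) b *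
            (\<Sum>a'\<in>minus_symbols G' \<Xi>' z'. \<Sum>b'\<in>plus_symbols G' \<Xi>' z'. fourier (?m' z') a' * fourier (?p' z') b' *
              of_bool (a = a' \<and> (b, b') \<in> B_pm (n_plus ?M) (n_plus ?M'))))"
        by (rule reduce) (simp only: R C simp_thms)
      also have "\<dots> = of_bool (?m z = ?m' z') * of_bool ((?p z, ?p' z') \<in> B_pm (n_plus ?M) (n_plus ?M'))"
        unfolding sum_four_split using mem unfolding sets
        by (simp only: fourier_diagonal[OF prm has_symbols_simps(2)] fourier_theta[OF prm])
      finally show ?thesis unfolding Rz by (simp only: C simp_thms of_bool_conj)
    qed
  next
    case (SOodd n' S)
    define C where "C \<longleftrightarrow> same_zero (- 1) (ss_zero ?M) (ss_zero ?M') (zero_part \<Xi> z) (zero_part \<Xi>' z') \<and> n_plus ?M = n_minus ?M'"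
    have R: "theta_related prm n G' \<Xi> \<Xi>' y y' \<longleftrightarrow> C \<and> ?p y = ?m' y' \<and> (?p' y', ?m y) \<in> B_pm (n_plus ?M') (n_minus ?M)"
      if "y \<in> fibre ?G \<Xi> z" "y' \<in> fibre G' \<Xi>' z'" for y y'
      using that by (auto simp: SOodd fibre_def C_def Let_def)
    note Rz = R[OF mem_fibre_self[OF z] mem_fibre_self[OF z']]
    show ?thesis
    proof (cases C)
      case False
      then show ?thesis using Rz by (simp add: reduce[OF R])
    next
      case C: True
      then have eq: "n_minus ?M' = n_plus ?M" by (simp add: C_def)
      have sets: "minus_symbols ?G \<Xi> z = symbols (Opm (n_minus ?M) :: 'a classical)"
        "plus_symbols ?G \<Xi> z = symbols (Sp (n_plus ?M) :: 'a classical)"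
        "minus_symbols G' \<Xi>' z' = symbols (Sp (n_plus ?M) :: 'a classical)"
        "plus_symbols G' \<Xi>' z' = symbols (Sp (n_plus ?M') :: 'a classical)"
        by (simp_all add: minus_symbols_def plus_symbols_def SOodd eq del: symbols.simps)
      have "?lhs = (\<Sum>a\<in>minus_symbols ?G \<Xi> z. \<Sum>b\<in>plus_symbols ?G \<Xi> z. fourier (?m z) a * fourier (?p z) b *
            (\<Sum>a'\<in>minus_symbols G' \<Xi>' z'. \<Sum>b'\<in>plus_symbols G' \<Xi>' z'. fourier (?m' z') a' * fourier (?p' z') b' *
              of_bool (b = a' \<and> (b', a) \<in> B_pm (n_plus ?M') (n_minus ?M))))"
        by (rule reduce) (simp only: R C simp_thms)
      also have "\<dots> = (\<Sum>b\<in>plus_symbols ?G \<Xi> z. \<Sum>a\<in>minus_symbols ?G \<Xi> z. fourier (?p z) b * fourier (?m z) a *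
            (\<Sum>a'\<in>minus_symbols G' \<Xi>' z'. \<Sum>b'\<in>plus_symbols G' \<Xi>' z'. fourier (?m' z') a' * fourier (?p' z') b' *
              of_bool (b = a' \<and> (b', a) \<in> B_pm (n_plus ?M') (n_minus ?M))))"
        by (subst sum.swap) (simp only: mult.commute[of "fourier (?m z) _"])
      also have "\<dots> = of_bool (?p z = ?m' z') * (\<Sum>a\<in>minus_symbols ?G \<Xi> z. \<Sum>b'\<in>plus_symbols G' \<Xi>' z'.
           fourier (?m z) a * (fourier (?p' z') b' * of_bool ((b', a) \<in> B_pm (n_plus ?M') (n_minus ?M))))"
        unfolding sum_four_split using mem unfolding sets
        by (simp only: fourier_diagonal[OF prm has_symbols_simps(1)])
      also have "(\<Sum>a\<in>minus_symbols ?G \<Xi> z. \<Sum>b'\<in>plus_symbols G' \<Xi>' z'.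
           fourier (?m z) a * (fourier (?p' z') b' * of_bool ((b', a) \<in> B_pm (n_plus ?M') (n_minus ?M))))
        = of_bool ((?p' z', ?m z) \<in> B_pm (n_plus ?M') (n_minus ?M))"
        by (subst sum.swap) (use mem in \<open>simp only: sets mult.left_commute[of "fourier (?m z) _"] fourier_theta[OF prm]\<close>)
      finally show ?thesis unfolding Rz by (simp only: C simp_thms of_bool_conj)
    qed
  qed
qed

text \<open>A square matrix with orthonormal rows is inverted by its transpose.\<close>

lemma orthonormal_rows_inversion:
  fixes c :: "'b \<Rightarrow> 'b \<Rightarrow> complex"
  assumes "finite A" "z \<in> A" "\<And>x. x \<in> A \<Longrightarrow> (\<Sum>y\<in>A. c x y * c z y) = (if x = z then 1 else 0)"
  shows "(\<Sum>y\<in>A. c z y * (\<Sum>x\<in>A. f x * c x y)) = f z"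
proof -
  have "(\<Sum>y\<in>A. c z y * (\<Sum>x\<in>A. f x * c x y)) = (\<Sum>x\<in>A. f x * (\<Sum>y\<in>A. c x y * c z y))"
    unfolding sum_distrib_left by (subst sum.swap) (simp only: mult.assoc mult.left_commute mult.commute)
  also have "\<dots> = (\<Sum>x\<in>A. if x = z then f x else 0)"
    using assms(3) by (intro sum.cong) auto
  finally show ?thesis using assms by simp
qed

theorem theorem1p1:
  fixes \<psi> :: "'a::{field,finite} \<Rightarrow> complex"
    and \<kappa> :: "'a alg_closure \<Rightarrow> complex"
    and n n' :: nat and G G' :: "'a classical"
    and prm :: "'a classical \<Rightarrow> symbol \<Rightarrow> 'a fchar"
    and \<Xi> \<Xi>' :: "'a jordan"
    and m m' :: "'a fchar \<Rightarrow> 'a fchar \<Rightarrow> complex"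
  assumes "odd (CHAR('a))"
    and "nontrivial_additive_char \<psi>"
    and "root_embedding \<kappa>"
    and "G = Sp n"
    and "G' = Opm n' \<or> (\<exists>S. G' = SOodd n' S \<and> wf_classical (SOodd n' S))"
    and "unip_parametrization \<psi> prm"
    and "lusztig_correspondence \<kappa> G \<Xi>"
    and "lusztig_correspondence \<kappa> G' \<Xi>'"
    and "theta_compatible \<psi> prm n G' \<Xi> \<Xi>'"
    and "\<forall>\<epsilon> g \<epsilon>' h. weil \<psi> n G' \<epsilon> g \<epsilon>' h =
           (\<Sum>x\<in>fchars G. \<Sum>x'\<in>fchars G'. m x x' * (rho x \<epsilon> g * rho x' \<epsilon>' h))"
    and "\<forall>\<epsilon> g \<epsilon>' h. weil \<psi> n G' \<epsilon> g \<epsilon>' h =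
           (\<Sum>x\<in>fchars G. \<Sum>x'\<in>fchars G'.
              m' x x' * (almost_char prm G \<Xi> x \<epsilon> g * almost_char prm G' \<Xi>' x' \<epsilon>' h))"
  shows "\<forall>x\<in>fchars G. \<forall>x'\<in>fchars G'. m x x' = m' x x'"
proof (intro ballI)
  note prm = assms(6) and \<Xi> = assms(7) and \<Xi>' = assms(8)
  let ?c = "almost_coeff prm G \<Xi>" and ?c' = "almost_coeff prm G' \<Xi>'"
  let ?R = "\<lambda>y y'. of_bool (theta_related prm n G' \<Xi> \<Xi>' y y') :: complex"
  have theta: "weil \<psi> n G' \<epsilon> g \<epsilon>' h = (\<Sum>y\<in>fchars G. \<Sum>y'\<in>fchars G'. ?R y y' * (rho y \<epsilon> g * rho y' \<epsilon>' h))" for \<epsilon> g \<epsilon>' h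
  proof -
    have "weil \<psi> n G' \<epsilon> g \<epsilon>' h = (\<Sum>(y, y')\<in>{(y, y') \<in> fchars G \<times> fchars G'. theta_related prm n G' \<Xi> \<Xi>' y y'}.
        rho y \<epsilon> g * rho y' \<epsilon>' h)" using assms(4,9) by (simp add: theta_compatible_def)
    also have "\<dots> = (\<Sum>(y, y')\<in>fchars G \<times> fchars G'. ?R y y' * (rho y \<epsilon> g * rho y' \<epsilon>' h))"
      by (rule sum.mono_neutral_cong_left) (auto simp: finite_fchars)
    finally show ?thesis by (simp only: sum.cartesian_product)
  qed
  have m: "m y y' = ?R y y'" if "y \<in> fchars G" "y' \<in> fchars G'" for y y'
    by (rule rho_tensor_coefficients_unique[OF _ that]) (use assms(10) theta in metis)
  \<comment> \<open>The irreducible coefficients of the second expansion are the entries of \<open>C\<^sup>T m' C'\<close>.\<close>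
  have expand: "(\<Sum>x\<in>fchars G. \<Sum>x'\<in>fchars G'. m' x x' * (almost_char prm G \<Xi> x \<epsilon> g * almost_char prm G' \<Xi>' x' \<epsilon>' h))
      = (\<Sum>y\<in>fchars G. \<Sum>y'\<in>fchars G'. (\<Sum>x\<in>fchars G. \<Sum>x'\<in>fchars G'. m' x x' * (?c x y * ?c' x' y')) * (rho y \<epsilon> g * rho y' \<epsilon>' h))"
    (is "?l = ?r") for \<epsilon> g \<epsilon>' h
  proof -
    let ?t = "\<lambda>x x' y y'. m' x x' * (?c x y * ?c' x' y') * (rho y \<epsilon> g * rho y' \<epsilon>' h)"
    let ?X = "fchars G" and ?Y = "fchars G'"
    have "?l = (\<Sum>x\<in>?X. \<Sum>x'\<in>?Y. \<Sum>y\<in>?X. \<Sum>y'\<in>?Y. ?t x x' y y')"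
    proof (intro sum.cong refl)
      fix x x' assume "x \<in> fchars G" "x' \<in> fchars G'"
      then have "almost_char prm G \<Xi> x \<epsilon> g * almost_char prm G' \<Xi>' x' \<epsilon>' h
         = (\<Sum>y\<in>?X. \<Sum>y'\<in>?Y. ?c x y * rho y \<epsilon> g * (?c' x' y' * rho y' \<epsilon>' h))"
        by (simp only: almost_char_expansion[OF prm \<Xi>] almost_char_expansion[OF prm \<Xi>'] sum_product)
      then show "m' x x' * (almost_char prm G \<Xi> x \<epsilon> g * almost_char prm G' \<Xi>' x' \<epsilon>' h)
          = (\<Sum>y\<in>?X. \<Sum>y'\<in>?Y. ?t x x' y y')"
        unfolding sum_distrib_left by (simp only: sum_distrib_left mult.assoc mult.left_commute)
    qed
    also have "\<dots> = (\<Sum>x\<in>?X. \<Sum>y\<in>?X. \<Sum>x'\<in>?Y. \<Sum>y'\<in>?Y. ?t x x' y y')"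
      by (intro sum.cong refl sum.swap)
    also have "\<dots> = (\<Sum>y\<in>?X. \<Sum>x\<in>?X. \<Sum>x'\<in>?Y. \<Sum>y'\<in>?Y. ?t x x' y y')"
      by (rule sum.swap)
    also have "\<dots> = (\<Sum>y\<in>?X. \<Sum>x\<in>?X. \<Sum>y'\<in>?Y. \<Sum>x'\<in>?Y. ?t x x' y y')"
      by (intro sum.cong refl sum.swap)
    also have "\<dots> = (\<Sum>y\<in>?X. \<Sum>y'\<in>?Y. \<Sum>x\<in>?X. \<Sum>x'\<in>?Y. ?t x x' y y')"
      by (intro sum.cong refl sum.swap)
    also have "\<dots> = ?r" by (simp only: sum_distrib_right)
    finally show ?thesis .
  qed
  have Rm': "?R y y' = (\<Sum>x\<in>fchars G. \<Sum>x'\<in>fchars G'. m' x x' * (?c x y * ?c' x' y'))"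
    if "y \<in> fchars G" "y' \<in> fchars G'" for y y'
    by (rule rho_tensor_coefficients_unique[OF _ that, of "?R"]) (use assms(11) theta expand in metis)
  fix z z' assume z: "z \<in> fchars G" and z': "z' \<in> fchars G'"
  have "m z z' = ?R z z'" using m z z' .
  also have "\<dots> = (\<Sum>y\<in>fchars G. ?c z y * (\<Sum>y'\<in>fchars G'. ?c' z' y' * ?R y y'))"
    using theta_matrix_fourier_invariant[OF prm _ \<Xi>', of n \<Xi> z z'] \<Xi> z z' assms(4) by simp
  also have "\<dots> = (\<Sum>y\<in>fchars G. ?c z y * (\<Sum>y'\<in>fchars G'. ?c' z' y' * (\<Sum>x\<in>fchars G. \<Sum>x'\<in>fchars G'. m' x x' * (?c x y * ?c' x' y'))))"
    using Rm' by (intro sum.cong refl arg_cong2[of _ _ _ _ "(*)"]) auto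
  \<comment> \<open>Inverting \<open>C'\<close> on the right first, and then \<open>C\<close> on the left.\<close>
  also have "\<dots> = (\<Sum>y\<in>fchars G. ?c z y * (\<Sum>x\<in>fchars G. m' x z' * ?c x y))"
  proof (rule sum.cong[OF refl], rule arg_cong[of _ _ "\<lambda>u. _ * u"])
    fix y
    have "(\<Sum>x\<in>fchars G. \<Sum>x'\<in>fchars G'. m' x x' * (?c x y * ?c' x' y'))
        = (\<Sum>x'\<in>fchars G'. (\<Sum>x\<in>fchars G. m' x x' * ?c x y) * ?c' x' y')" for y'
      by (subst sum.swap) (simp only: sum_distrib_right mult.assoc)
    then show "(\<Sum>y'\<in>fchars G'. ?c' z' y' * (\<Sum>x\<in>fchars G. \<Sum>x'\<in>fchars G'. m' x x' * (?c x y * ?c' x' y')))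
        = (\<Sum>x\<in>fchars G. m' x z' * ?c x y)"
      using orthonormal_rows_inversion[OF finite_fchars z' almost_coeff_orthonormal[OF prm \<Xi>' _ z'],
        of "\<lambda>x'. \<Sum>x\<in>fchars G. m' x x' * ?c x y"] by simp
  qed
  also have "\<dots> = m' z z'"
    by (rule orthonormal_rows_inversion[OF finite_fchars z almost_coeff_orthonormal[OF prm \<Xi> _ z]])
  finally show "m z z' = m' z z'" .
qed

end
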